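(* We have the equality of sets $\widetilde{H}_{W,V}(\mathbb{T})=H_{W,V}(\mathbb{T})$, where $\widetilde{H}_{W,V}(\mathbb{T})$ is the space of functions in $L^2_V(\mathbb{T})$ having a $W$-left weak derivative in $L^2_{W,0}(\mathbb{T})$ and $H_{W,V}(\mathbb{T})$ is the energetic space of $I-D^+_VD^-_W$.
   Context: Notation. $\mathbb{T}=\mathbb{R}/\mathbb{Z}$; functions on $\mathbb{T}$ are identified with $1$-periodic functions on $\mathbb{R}$. Càdlàg means right-continuous with left limits; càglàd means left-continuous with right limits. $W,V:\mathbb{R}\to\mathbb{R}$ are strictly increasing, $W$ is càdlàg, $V$ is càglàd, and $W(x+1)-W(x)=W(1)-W(0)$, $V(x+1)-V(x)=V(1)-V(0)$ for all $x\in\mathbb{R}$; both are continuous at $0$ and $W(0)=V(0)=0$. No further continuity is assumed. $dW$ and $dV$ are the induced finite Borel measures on $\mathbb{T}$, with $dW((a,b])=W(b)-W(a)$ and $dV([a,b))=V(b)-V(a)$. $L^2_W(\mathbb{T})$, $L^2_V(\mathbb{T})$ are the corresponding (real) $L^2$ spaces; $\langle\cdot,\cdot\rangle_V$ is the inner product of $L^2_V(\mathbb{T})$; $L^2_{W,0}(\mathbb{T})=\{F\in L^2_W(\mathbb{T}):\int_{\mathbb{T}}F\,dW=0\}$. Lateral derivatives: $D^-_Wf(x)=\lim_{h\to0^-}\frac{f(x+h)-f(x)}{W(x+h)-W(x)}$ and $D^+_Vg(x)=\lim_{h\to0^+}\frac{g(x+h)-g(x)}{V(x+h)-V(x)}$;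 a function is $W$-left (resp. $V$-right) differentiable if the limit exists at every $x\in\mathbb{T}$. $\mathfrak{D}_{W,V}(\mathbb{T})$ is the set of càdlàg $f:\mathbb{T}\to\mathbb{R}$ that are $W$-left differentiable, with $D^-_Wf$ càglàd and $V$-right differentiable, and $D^+_VD^-_Wf$ càdlàg. $H_{W,V}(\mathbb{T})$: with the energetic norm $\|f\|_{1,2}^2=\langle(I-D^+_VD^-_W)f,f\rangle_V$ on $\mathfrak{D}_{W,V}(\mathbb{T})$, a function $f\in L^2_V(\mathbb{T})$ belongs to $H_{W,V}(\mathbb{T})$ iff there is a sequence $(f_n)$ in $\mathfrak{D}_{W,V}(\mathbb{T})$ with $f_n\to f$ in $L^2_V(\mathbb{T})$ and $(f_n)$ Cauchy with respect to $\|\cdot\|_{1,2}$. Test functions: let $C_0(\mathbb{T})=\{f:\mathbb{T}\to\mathbb{R}\text{ càdlàg},\ \int_{\mathbb{T}}f\,dV=0\}$ and $C_1(\mathbb{T})=\{f:\mathbb{T}\to\mathbb{R}\text{ càglàd},\ \int_{\mathbb{T}}f\,dW=0\}$. $C^\infty_{V,W,0}(\mathbb{T})$ is the set of $g\in C_1(\mathbb{T})$ for which all iterated lateral derivatives $D^+_Vg,\ D^-_WD^+_Vg,\ D^+_VD^-_WD^+_Vg,\dots$ exist at every point, those with an odd number of factors belonging to $C_0(\mathbb{T})$ and those with an even number of factors belonging to $C_1(\mathbb{T})$. $C^\infty_{V,W}(\mathbb{T})=\langle1\rangle\oplus C^\infty_{V,W,0}(\mathbb{T})$, where $\langle 1\rangle$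 is the space of constants. Weak derivative: $f\in L^2_V(\mathbb{T})$ has a $W$-left weak derivative if there exists $F\in L^2_W(\mathbb{T})$ such that $\int_{\mathbb{T}}f\,D^+_Vg\,dV=-\int_{\mathbb{T}}F\,g\,dW$ for every $g\in C^\infty_{V,W}(\mathbb{T})$; such an $F$ is unique and is denoted $\partial^-_Wf$. $\widetilde{H}_{W,V}(\mathbb{T})=\{f\in L^2_V(\mathbb{T}):\ \partial^-_Wf\text{ exists and } \partial^-_Wf\in L^2_{W,0}(\mathbb{T})\}$. *)

theory Defs
  imports "HOL-Analysis.Analysis"
begin

text \<open>Functions on the circle are represented by 1-periodic functions on the real line.\<close>

definition periodic :: "(real \<Rightarrow> real) \<Rightarrow> bool" where
  "periodic f \<longleftrightarrow> (\<forall>x. f (x + 1) = f x)"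

definition cadlag :: "(real \<Rightarrow> real) \<Rightarrow> bool" where
  "cadlag f \<longleftrightarrow> (\<forall>x. continuous (at_right x) f \<and> (\<exists>l. (f \<longlongrightarrow> l) (at_left x)))"

definition caglad :: "(real \<Rightarrow> real) \<Rightarrow> bool" where
  "caglad f \<longleftrightarrow> (\<forall>x. continuous (at_left x) f \<and> (\<exists>l. (f \<longlongrightarrow> l) (at_right x)))"

subsection \<open>The measures and their square-integrable functions\<close>

text \<open>
  The circle is identified with a fundamental domain.  The choice of the half-open unit interval is
  immaterial, because \<open>W\<close> and \<open>V\<close> are continuous at the integers, so that these carry no mass.
\<close>

definition dW :: "(real \<Rightarrow> real) \<Rightarrow> real measure" where
  "dW W = restrict_space (interval_measure W) {0<..1}"

text \<open>
  \<open>interval_measure\<close> expects a right-continuous function, whereas \<open>V\<close> is left-continuous;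
  reflecting the line turns \<open>V\<close> into the right-continuous function \<open>\<lambda>x. - V (- x)\<close>.
\<close>

definition dV :: "(real \<Rightarrow> real) \<Rightarrow> real measure" where
  "dV V = restrict_space (distr (interval_measure (\<lambda>x. - V (- x))) borel uminus) {0..<1}"

lemma emeasure_dW:
  assumes "strict_mono W" "cadlag W" "0 \<le> a" "a \<le> b" "b \<le> 1"
  shows "emeasure (dW W) {a<..b} = ennreal (W b - W a)"
proof -
  have "emeasure (dW W) {a<..b} = emeasure (interval_measure W) {a<..b}"
    unfolding dW_def by (rule emeasure_restrict_space) (use assms in auto)
  also have "\<dots> = ennreal (W b - W a)"
    using assms by (intro emeasure_interval_measure_Ioc)
      (auto simp: cadlag_def dest: strict_mono_mono monoD)
  finally show ?thesis .
qed

lemma emeasure_dV: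
  assumes "strict_mono V" "caglad V" "0 \<le> a" "a \<le> b" "b \<le> 1"
  shows "emeasure (dV V) {a..<b} = ennreal (V b - V a)"
proof -
  let ?U = "\<lambda>x. - V (- x)"
  have cont: "continuous (at_right x) ?U" for x
  proof -
    have "(V \<longlongrightarrow> V (- x)) (at_left (- x))"
      using assms(2) by (simp add: caglad_def continuous_within)
    then have "((\<lambda>y. V (- y)) \<longlongrightarrow> V (- x)) (at_right x)"
      by (simp add: filterlim_at_left_to_right)
    then show ?thesis
      by (auto simp: continuous_within intro: tendsto_minus)
  qed
  have mono: "?U x \<le> ?U y" if "x \<le> y" for x y
    using assms(1) that by (simp add: strict_mono_less_eq)
  have "emeasure (dV V) {a..<b} = emeasure (distr (interval_measure ?U) borel uminus) {a..<b}"
    unfolding dV_def by (rule emeasure_restrict_space) (use assms in auto)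
  also have "\<dots> = emeasure (interval_measure ?U) (uminus -` {a..<b})"
    by (subst emeasure_distr) auto
  also have "uminus -` {a..<b} = {- b<..- a}"
    by auto
  also have "emeasure (interval_measure ?U) {- b<..- a} = ennreal (V b - V a)"
    using emeasure_interval_measure_Ioc[of "- b" "- a" ?U] assms(4) cont mono by simp
  finally show ?thesis .
qed

text \<open>
  Elements of the \<open>L\<^sup>2\<close> spaces are given by Borel representatives; the sets \<open>L2_mean_zero\<close>,
  \<open>H_energetic\<close> and \<open>H_weak\<close> below contain with a function every other representative of its
  class, so that equalities between them are equalities between sets of classes.
\<close>

definition L2 :: "real measure \<Rightarrow> (real \<Rightarrow> real) set" where
  "L2 M = {f. periodic f \<and> f \<in> borel_measurable borel \<and> integrable M (\<lambda>x. (f x)\<^sup>2)}"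

definition L2_mean_zero :: "real measure \<Rightarrow> (real \<Rightarrow> real) set" where
  "L2_mean_zero M = {F \<in> L2 M. (\<integral>x. F x \<partial>M) = 0}"

definition L2_inner :: "real measure \<Rightarrow> (real \<Rightarrow> real) \<Rightarrow> (real \<Rightarrow> real) \<Rightarrow> real" where
  "L2_inner M f g = (\<integral>x. f x * g x \<partial>M)"

definition L2_norm :: "real measure \<Rightarrow> (real \<Rightarrow> real) \<Rightarrow> real" where
  "L2_norm M f = sqrt (L2_inner M f f)"

subsection \<open>Lateral derivatives\<close>

definition has_left_derivative ::
    "(real \<Rightarrow> real) \<Rightarrow> (real \<Rightarrow> real) \<Rightarrow> real \<Rightarrow> real \<Rightarrow> bool" where
  "has_left_derivative W f D x \<longleftrightarrow>
     ((\<lambda>h. (f (x + h) - f x) / (W (x + h) - W x)) \<longlongrightarrow> D) (at_left 0)"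

definition has_right_derivative ::
    "(real \<Rightarrow> real) \<Rightarrow> (real \<Rightarrow> real) \<Rightarrow> real \<Rightarrow> real \<Rightarrow> bool" where
  "has_right_derivative V g D x \<longleftrightarrow>
     ((\<lambda>h. (g (x + h) - g x) / (V (x + h) - V x)) \<longlongrightarrow> D) (at_right 0)"

definition left_differentiable :: "(real \<Rightarrow> real) \<Rightarrow> (real \<Rightarrow> real) \<Rightarrow> bool" where
  "left_differentiable W f \<longleftrightarrow> (\<forall>x. \<exists>D. has_left_derivative W f D x)"

definition right_differentiable :: "(real \<Rightarrow> real) \<Rightarrow> (real \<Rightarrow> real) \<Rightarrow> bool" where
  "right_differentiable V g \<longleftrightarrow> (\<forall>x. \<exists>D. has_right_derivative V g D x)"

definition left_deriv :: "(real \<Rightarrow> real) \<Rightarrow> (real \<Rightarrow> real) \<Rightarrow> real \<Rightarrow> real" where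
  "left_deriv W f x = (THE D. has_left_derivative W f D x)"

definition right_deriv :: "(real \<Rightarrow> real) \<Rightarrow> (real \<Rightarrow> real) \<Rightarrow> real \<Rightarrow> real" where
  "right_deriv V g x = (THE D. has_right_derivative V g D x)"

subsection \<open>The energetic space\<close>

definition D_space :: "(real \<Rightarrow> real) \<Rightarrow> (real \<Rightarrow> real) \<Rightarrow> (real \<Rightarrow> real) set" where
  "D_space W V = {f. periodic f \<and> cadlag f \<and> left_differentiable W f \<and>
     caglad (left_deriv W f) \<and> right_differentiable V (left_deriv W f) \<and>
     cadlag (right_deriv V (left_deriv W f))}"

definition energetic_norm :: "(real \<Rightarrow> real) \<Rightarrow> (real \<Rightarrow> real) \<Rightarrow> (real \<Rightarrow> real) \<Rightarrow> real" where
  "energetic_norm W V f =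
     sqrt (L2_inner (dV V) (\<lambda>x. f x - right_deriv V (left_deriv W f) x) f)"

definition H_energetic :: "(real \<Rightarrow> real) \<Rightarrow> (real \<Rightarrow> real) \<Rightarrow> (real \<Rightarrow> real) set" where
  "H_energetic W V = {f \<in> L2 (dV V). \<exists>u :: nat \<Rightarrow> real \<Rightarrow> real.
     (\<forall>n. u n \<in> D_space W V) \<and>
     (\<lambda>n. L2_norm (dV V) (\<lambda>x. u n x - f x)) \<longlonglongrightarrow> 0 \<and>
     (\<forall>e>0. \<exists>N. \<forall>m\<ge>N. \<forall>n\<ge>N. energetic_norm W V (\<lambda>x. u m x - u n x) < e)}"

subsection \<open>Test functions and the weak derivative\<close>

definition C0 :: "(real \<Rightarrow> real) \<Rightarrow> (real \<Rightarrow> real) set" where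
  "C0 V = {f. periodic f \<and> cadlag f \<and> (\<integral>x. f x \<partial>dV V) = 0}"

definition C1 :: "(real \<Rightarrow> real) \<Rightarrow> (real \<Rightarrow> real) set" where
  "C1 W = {f. periodic f \<and> caglad f \<and> (\<integral>x. f x \<partial>dW W) = 0}"

primrec iter_deriv ::
    "(real \<Rightarrow> real) \<Rightarrow> (real \<Rightarrow> real) \<Rightarrow> (real \<Rightarrow> real) \<Rightarrow> nat \<Rightarrow> real \<Rightarrow> real" where
  "iter_deriv V W g 0 = g"
| "iter_deriv V W g (Suc n) =
     (if even n then right_deriv V (iter_deriv V W g n) else left_deriv W (iter_deriv V W g n))"

definition C_inf_zero :: "(real \<Rightarrow> real) \<Rightarrow> (real \<Rightarrow> real) \<Rightarrow> (real \<Rightarrow> real) set" where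
  "C_inf_zero V W = {g. \<forall>n.
     (if even n
      then iter_deriv V W g n \<in> C1 W \<and> right_differentiable V (iter_deriv V W g n)
      else iter_deriv V W g n \<in> C0 V \<and> left_differentiable W (iter_deriv V W g n))}"

definition C_inf :: "(real \<Rightarrow> real) \<Rightarrow> (real \<Rightarrow> real) \<Rightarrow> (real \<Rightarrow> real) set" where
  "C_inf V W = {\<lambda>x. c + g x | c g. g \<in> C_inf_zero V W}"

definition has_weak_derivative ::
    "(real \<Rightarrow> real) \<Rightarrow> (real \<Rightarrow> real) \<Rightarrow> (real \<Rightarrow> real) \<Rightarrow> (real \<Rightarrow> real) \<Rightarrow> bool" where
  "has_weak_derivative W V f F \<longleftrightarrow> F \<in> L2 (dW W) \<and>
     (\<forall>g \<in> C_inf V W. (\<integral>x. f x * right_deriv V g x \<partial>dV V) = - (\<integral>x. F x * g x \<partial>dW W))"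

definition H_weak :: "(real \<Rightarrow> real) \<Rightarrow> (real \<Rightarrow> real) \<Rightarrow> (real \<Rightarrow> real) set" where
  "H_weak W V = {f \<in> L2 (dV V). \<exists>F. has_weak_derivative W V f F \<and> F \<in> L2_mean_zero (dW W)}"

end

theory Submission imports Defs
begin

text \<open>
  Both spaces consist of the functions that agree almost everywhere with
  \<open>c + \<integral>\<^bsub>(0,x]\<^esub> F dW\<close> for a constant \<open>c\<close> and some \<open>F \<in> L\<^sup>2\<^bsub>W,0\<^esub>\<close>, and \<open>F\<close> is the weak derivative.

  Two facts link lateral derivatives to integrals.  A fundamental theorem holds on each side
  (\<open>left_fundamental_theorem\<close>, \<open>right_fundamental_theorem\<close>): a cadlag function whose left
  \<open>W\<close>-derivative is zero everywhere is constant, because the set on which a Lipschitz-type bound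
  holds can be extended to the left at every point.  Fubini gives the integration by parts formula
  \<open>integration_by_parts\<close> between \<open>\<integral>\<^bsub>(0,x]\<^esub> F dW\<close> and \<open>\<integral>\<^bsub>[0,y)\<^esub> G dV\<close>.  Together they show
  that the energetic norm of \<open>u\<close> is \<open>(\<parallel>u\<parallel>\<^sup>2 + \<parallel>D\<^sup>-\<^sub>W u\<parallel>\<^sup>2)\<^sup>1\<^sup>/\<^sup>2\<close> and that \<open>D\<^sup>-\<^sub>W u\<close> is a weak derivative of
  \<open>u\<close>.  So if \<open>u\<^sub>n \<rightarrow> f\<close> is Cauchy in this norm, then \<open>D\<^sup>-\<^sub>W u\<^sub>n\<close> converges in \<open>L\<^sup>2\<^sub>W\<close>, and its limit is
  the weak derivative of \<open>f\<close>; this is the inclusion of the energetic space.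

  The other inclusion needs many test functions.  If in a sequence each term is the primitive,
  normalised to mean zero, of the next one, taken with respect to \<open>dV\<close> and \<open>dW\<close> alternately, then
  its first term is a test function.  Such sequences are obtained without spectral theory from the
  Mittag-Leffler principle for the projective system formed by the two primitive operators.
  Both operators have dense range (\<open>T_range_dense\<close>), since the normalised indicator of a short
  interval to the right of \<open>a\<close> has a primitive close to the indicator of \<open>(a, \<infinity>)\<close>; they also
  map \<open>L\<^sup>1\<close> boundedly to the sup norm.  Hence the approximate solutions \<open>y\<^sub>n \<approx> T y\<^sub>n\<^sub>+\<^sub>1\<close> can be
  corrected to exact ones, and the first terms of exact sequences are dense in the mean-zero
  \<open>L\<^sup>2\<close> functions (\<open>smooth_chain_dense\<close>).

  Density on the \<open>V\<close> side shows that a function orthogonal to all derivatives of test functions is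
  constant, so a function with weak derivative \<open>F\<close> is \<open>c + \<integral>\<^bsub>(0,x]\<^esub> F dW\<close>.  Density on the \<open>W\<close> side
  approximates \<open>F\<close> by first terms \<open>F\<^sub>n\<close>, and \<open>c + \<integral>\<^bsub>(0,x]\<^esub> F\<^sub>n dW\<close> is the sequence that the
  definition of the energetic space asks for.
\<close>

section \<open>Square-integrable functions\<close>

definition bounded_borel :: "(real \<Rightarrow> real) \<Rightarrow> bool" where
  "bounded_borel f \<longleftrightarrow> f \<in> borel_measurable borel \<and> (\<exists>B. \<forall>x. \<bar>f x\<bar> \<le> B)"

definition square_integrable :: "real measure \<Rightarrow> (real \<Rightarrow> real) \<Rightarrow> bool" where
  "square_integrable M f \<longleftrightarrow> f \<in> borel_measurable borel \<and> integrable M (\<lambda>x. (f x)\<^sup>2)"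

lemma bounded_borelI:
  "f \<in> borel_measurable borel \<Longrightarrow> (\<And>x. \<bar>f x\<bar> \<le> B) \<Longrightarrow> bounded_borel f"
  by (auto simp: bounded_borel_def)

lemma bounded_borel_const: "bounded_borel (\<lambda>x. c)"
  by (rule bounded_borelI[where B = "\<bar>c\<bar>"]) auto

lemma bounded_borel_add:
  assumes "bounded_borel f" "bounded_borel g"
  shows "bounded_borel (\<lambda>x. f x + g x)"
proof -
  obtain B C where "\<And>x. \<bar>f x\<bar> \<le> B" "\<And>x. \<bar>g x\<bar> \<le> C"
    using assms unfolding bounded_borel_def by blast
  then have "\<bar>f x + g x\<bar> \<le> B + C" for x
    by (intro order_trans[OF abs_triangle_ineq] add_mono)
  with assms show ?thesis
    by (intro bounded_borelI[where B = "B + C"]) (auto simp: bounded_borel_def)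
qed

lemma bounded_borel_mult:
  assumes "bounded_borel f" "bounded_borel g"
  shows "bounded_borel (\<lambda>x. f x * g x)"
proof -
  obtain B C where *: "\<And>x. \<bar>f x\<bar> \<le> B" "\<And>x. \<bar>g x\<bar> \<le> C"
    using assms by (auto simp: bounded_borel_def)
  then have "\<bar>f x * g x\<bar> \<le> B * C" for x
    unfolding abs_mult by (intro mult_mono) (auto intro: order_trans[OF abs_ge_zero])
  with assms show ?thesis
    by (intro bounded_borelI[where B = "B * C"]) (auto simp: bounded_borel_def)
qed

lemma bounded_borel_diff:
  "bounded_borel f \<Longrightarrow> bounded_borel g \<Longrightarrow> bounded_borel (\<lambda>x. f x - g x)"
  using bounded_borel_add[OF _ bounded_borel_mult[OF bounded_borel_const[of "- 1"]], of f g] by simp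

lemma bounded_borel_indicator: "A \<in> sets borel \<Longrightarrow> bounded_borel (indicator A)"
  by (rule bounded_borelI[where B = 1]) (auto simp: indicator_def)

text \<open>
  The circle measures live on restricted spaces, whereas functions are Borel on the whole line;
  measurability of the identity is what transfers the latter to the former.
\<close>

locale borel_finite_measure = finite_measure M for M :: "real measure" +
  assumes ident: "(\<lambda>x. x) \<in> borel_measurable M"
begin

lemma borel: "f \<in> borel_measurable borel \<Longrightarrow> f \<in> borel_measurable M"
  using measurable_compose[OF ident] by auto

lemma bounded_integrable:
  assumes "bounded_borel f" shows "integrable M f"
proof -
  obtain B where "\<And>x. \<bar>f x\<bar> \<le> B" using assms by (auto simp: bounded_borel_def)
  then show ?thesis
    using assms by (intro integrable_const_bound[where B = B]) (auto simp: bounded_borel_def borel)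
qed

lemma bounded_square_integrable: "bounded_borel f \<Longrightarrow> square_integrable M f"
  using bounded_integrable[OF bounded_borel_mult[of f f]]
  by (auto simp: square_integrable_def bounded_borel_def power2_eq_square)

lemma square_integrable_product:
  assumes "square_integrable M f" "square_integrable M g"
  shows "integrable M (\<lambda>x. f x * g x)"
proof (rule Bochner_Integration.integrable_bound)
  show "integrable M (\<lambda>x. (f x)\<^sup>2 + (g x)\<^sup>2)"
    using assms by (auto simp: square_integrable_def)
  show "(\<lambda>x. f x * g x) \<in> borel_measurable M"
    using assms by (auto simp: square_integrable_def intro!: borel borel_measurable_times)
  have "\<bar>f x * g x\<bar> \<le> (f x)\<^sup>2 + (g x)\<^sup>2" for x
  proof -
    have "2 * (\<bar>f x\<bar> * \<bar>g x\<bar>) \<le> (f x)\<^sup>2 + (g x)\<^sup>2"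
      using sum_squares_bound[of "\<bar>f x\<bar>" "\<bar>g x\<bar>"] by (simp add: mult.assoc)
    moreover have "0 \<le> \<bar>f x\<bar> * \<bar>g x\<bar>" by simp
    ultimately show ?thesis unfolding abs_mult by linarith
  qed
  then show "AE x in M. norm (f x * g x) \<le> norm ((f x)\<^sup>2 + (g x)\<^sup>2)"
    by auto
qed

lemma square_integrable_integrable:
  "square_integrable M f \<Longrightarrow> integrable M f"
  by (rule square_integrable_imp_integrable) (auto simp: square_integrable_def borel)

lemma square_integrable_add:
  assumes "square_integrable M f" "square_integrable M g"
  shows "square_integrable M (\<lambda>x. f x + g x)"
  using assms square_integrable_product[OF assms]
  by (auto simp: square_integrable_def power2_sum mult.assoc)

lemma square_integrable_cmult:
  assumes "square_integrable M f" shows "square_integrable M (\<lambda>x. c * f x)"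
  using assms by (auto simp: square_integrable_def power_mult_distrib)

lemma square_integrable_diff:
  assumes "square_integrable M f" "square_integrable M g"
  shows "square_integrable M (\<lambda>x. f x - g x)"
  using square_integrable_add[OF assms(1) square_integrable_cmult[OF assms(2), of "-1"]] by simp

lemma square_integrable_const: "square_integrable M (\<lambda>x. c)"
  by (intro bounded_square_integrable bounded_borel_const)

lemma Cauchy_Schwarz_integral:
  assumes f: "square_integrable M f" and g: "square_integrable M g"
  shows "(\<integral>x. f x * g x \<partial>M)\<^sup>2 \<le> (\<integral>x. (f x)\<^sup>2 \<partial>M) * (\<integral>x. (g x)\<^sup>2 \<partial>M)"
proof -
  define a b c where "a = (\<integral>x. (f x)\<^sup>2 \<partial>M)" and "b = (\<integral>x. f x * g x \<partial>M)" and "c = (\<integral>x. (g x)\<^sup>2 \<partial>M)"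
  have quad: "0 \<le> s\<^sup>2 * a + 2 * s * t * b + t\<^sup>2 * c" for s t
  proof -
    have "0 \<le> (\<integral>x. (s * f x + t * g x)\<^sup>2 \<partial>M)"
      by simp
    also have "\<dots> = (\<integral>x. s\<^sup>2 * (f x)\<^sup>2 + 2 * s * t * (f x * g x) + t\<^sup>2 * (g x)\<^sup>2 \<partial>M)"
      by (rule Bochner_Integration.integral_cong) (auto simp: power2_eq_square algebra_simps)
    also have "\<dots> = s\<^sup>2 * a + 2 * s * t * b + t\<^sup>2 * c"
      using f g square_integrable_product[OF f g]
      by (simp add: square_integrable_def a_def b_def c_def)
    finally show ?thesis .
  qed
  have "0 \<le> a" "0 \<le> c" by (simp_all add: a_def c_def)
  have "b\<^sup>2 \<le> a * c"
  proof (cases "c = 0")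
    case True
    have "b = 0"
    proof (rule ccontr)
      assume "b \<noteq> 0"
      \<comment> \<open>With \<open>c = 0\<close> the quadratic form is affine in \<open>t\<close>; this \<open>t\<close> gives it the value \<open>- 1\<close>.\<close>
      with quad[of 1 "- (a + 1) / (2 * b)"] True show False
        by (simp add: field_simps)
    qed
    then show ?thesis using \<open>0 \<le> a\<close> \<open>0 \<le> c\<close> by simp
  next
    case False
    with \<open>0 \<le> c\<close> have "c > 0" by simp
    have "0 \<le> c * (a * c - b\<^sup>2)"
      using quad[of c "- b"] by (simp add: power2_eq_square algebra_simps)
    with \<open>c > 0\<close> show ?thesis by (simp add: zero_le_mult_iff)
  qed
  then show ?thesis by (simp add: a_def b_def c_def)
qed

lemma L1_le_L2:
  assumes f: "square_integrable M f"
  shows "(\<integral>x. \<bar>f x\<bar> \<partial>M)\<^sup>2 \<le> measure M (space M) * (\<integral>x. (f x)\<^sup>2 \<partial>M)"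
proof -
  have "square_integrable M (\<lambda>x. \<bar>f x\<bar>)"
    using f by (auto simp: square_integrable_def)
  from Cauchy_Schwarz_integral[OF this square_integrable_const[of 1]]
  show ?thesis by (simp add: mult.commute)
qed

lemma L2_sum_le:
  assumes "square_integrable M f" "square_integrable M g"
  shows "(\<integral>x. (f x + g x)\<^sup>2 \<partial>M) \<le> 2 * (\<integral>x. (f x)\<^sup>2 \<partial>M) + 2 * (\<integral>x. (g x)\<^sup>2 \<partial>M)"
proof -
  have "(\<integral>x. (f x + g x)\<^sup>2 \<partial>M) \<le> (\<integral>x. 2 * (f x)\<^sup>2 + 2 * (g x)\<^sup>2 \<partial>M)"
  proof (rule integral_mono)
    show "integrable M (\<lambda>x. (f x + g x)\<^sup>2)"
      using square_integrable_add[OF assms] by (simp add: square_integrable_def)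
    show "integrable M (\<lambda>x. 2 * (f x)\<^sup>2 + 2 * (g x)\<^sup>2)"
      using assms by (auto simp: square_integrable_def)
    show "(f x + g x)\<^sup>2 \<le> 2 * (f x)\<^sup>2 + 2 * (g x)\<^sup>2" for x
      using sum_squares_bound[of "f x" "g x"] by (simp add: power2_sum)
  qed
  also have "\<dots> = 2 * (\<integral>x. (f x)\<^sup>2 \<partial>M) + 2 * (\<integral>x. (g x)\<^sup>2 \<partial>M)"
    using assms by (simp add: square_integrable_def)
  finally show ?thesis .
qed

lemma L2_dist_triangle:
  assumes "square_integrable M f" "square_integrable M g" "square_integrable M h"
  shows "(\<integral>x. (f x - h x)\<^sup>2 \<partial>M) \<le> 2 * (\<integral>x. (f x - g x)\<^sup>2 \<partial>M) + 2 * (\<integral>x. (g x - h x)\<^sup>2 \<partial>M)"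
  using L2_sum_le[OF square_integrable_diff[OF assms(1,2)] square_integrable_diff[OF assms(2,3)]]
  by simp

lemma L2_pairing_tendsto:
  assumes u: "\<And>n. square_integrable M (u n)" and f: "square_integrable M f"
    and g: "square_integrable M g"
    and lim: "(\<lambda>n. \<integral>x. (u n x - f x)\<^sup>2 \<partial>M) \<longlonglongrightarrow> 0"
  shows "(\<lambda>n. \<integral>x. u n x * g x \<partial>M) \<longlonglongrightarrow> (\<integral>x. f x * g x \<partial>M)"
proof -
  have "(\<lambda>n. (\<integral>x. (u n x - f x)\<^sup>2 \<partial>M) * (\<integral>x. (g x)\<^sup>2 \<partial>M)) \<longlonglongrightarrow> 0"
    using tendsto_mult_right[OF lim] by simp
  then have "(\<lambda>n. (\<integral>x. (u n x - f x) * g x \<partial>M)\<^sup>2) \<longlonglongrightarrow> 0"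
    by (rule tendsto_sandwich[OF _ _ tendsto_const, rotated 2])
       (auto intro!: always_eventually Cauchy_Schwarz_integral square_integrable_diff u f g)
  then have "(\<lambda>n. \<integral>x. (u n x - f x) * g x \<partial>M) \<longlonglongrightarrow> 0"
    by (simp add: power_tendsto_0_iff)
  moreover have "(\<integral>x. (u n x - f x) * g x \<partial>M) = (\<integral>x. u n x * g x \<partial>M) - (\<integral>x. f x * g x \<partial>M)" for n
    using square_integrable_product[OF u g] square_integrable_product[OF f g]
    by (simp add: left_diff_distrib)
  ultimately show ?thesis
    by (simp add: LIM_zero_cancel)
qed

lemma dominated_L2_tendsto:
  assumes s: "\<And>n. square_integrable M (s n)" and f: "square_integrable M f"
    and g: "square_integrable M g" and dom: "\<And>n. AE x in M. \<bar>s n x\<bar> \<le> \<bar>g x\<bar>"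
    and lim: "AE x in M. (\<lambda>n. s n x) \<longlonglongrightarrow> f x"
  shows "(\<lambda>n. \<integral>x. (f x - s n x)\<^sup>2 \<partial>M) \<longlonglongrightarrow> 0"
proof -
  have "(\<lambda>n. \<integral>x. (f x - s n x)\<^sup>2 \<partial>M) \<longlonglongrightarrow> (\<integral>x. 0 \<partial>M)"
  proof (rule integral_dominated_convergence)
    show "(\<lambda>x. 0) \<in> borel_measurable M" by simp
    show "(\<lambda>x. (f x - s n x)\<^sup>2) \<in> borel_measurable M" for n
      using square_integrable_diff[OF f s] by (auto simp: square_integrable_def intro: borel)
    show "integrable M (\<lambda>x. 2 * (f x)\<^sup>2 + 2 * (g x)\<^sup>2)"
      using f g by (auto simp: square_integrable_def)
    show "AE x in M. (\<lambda>n. (f x - s n x)\<^sup>2) \<longlonglongrightarrow> 0"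
      using lim
    proof eventually_elim
      case (elim x)
      from tendsto_power[OF tendsto_diff[OF tendsto_const elim], of "f x" 2] show ?case by simp
    qed
    show "AE x in M. norm ((f x - s n x)\<^sup>2) \<le> 2 * (f x)\<^sup>2 + 2 * (g x)\<^sup>2" for n
      using dom[of n]
    proof eventually_elim
      case (elim x)
      then have "(s n x)\<^sup>2 \<le> (g x)\<^sup>2"
        by (simp add: abs_le_square_iff)
      moreover have "(f x - s n x)\<^sup>2 \<le> 2 * (f x)\<^sup>2 + 2 * (s n x)\<^sup>2"
        using sum_squares_bound[of "f x" "- s n x"] by (simp add: power2_diff)
      ultimately show ?case by simp
    qed
  qed
  then show ?thesis by simp
qed

text \<open>
  A class of functions containing the constants and approximating all half-line indicators is dense:
  its closure is stable under disjoint unions, so by Dynkin's lemma it contains all Borel indicators,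
  and it is stable under dominated limits, so it contains everything.
\<close>

lemma L2_dense:
  assumes S: "\<And>g. g \<in> S \<Longrightarrow> square_integrable M g"
    and one: "(\<lambda>x. 1) \<in> S"
    and add: "\<And>g h. g \<in> S \<Longrightarrow> h \<in> S \<Longrightarrow> (\<lambda>x. g x + h x) \<in> S"
    and cmult: "\<And>g c. g \<in> S \<Longrightarrow> (\<lambda>x. c * g x) \<in> S"
    and gen: "\<And>a e. 0 < e \<Longrightarrow> \<exists>g\<in>S. (\<integral>x. (indicator {a<..} x - g x)\<^sup>2 \<partial>M) < e"
    and f: "square_integrable M f" and e: "0 < e"
  shows "\<exists>g\<in>S. (\<integral>x. (f x - g x)\<^sup>2 \<partial>M) < e"
proof -
  define cl where "cl f \<longleftrightarrow> square_integrable M f \<and> (\<forall>e>0. \<exists>g\<in>S. (\<integral>x. (f x - g x)\<^sup>2 \<partial>M) < e)" for f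
  have cl_S: "cl g" if "g \<in> S" for g
    using that S by (auto simp: cl_def intro!: bexI[of _ g])
  have cl_add: "cl (\<lambda>x. u x + v x)" if u: "cl u" and v: "cl v" for u v
    unfolding cl_def
  proof (intro conjI allI impI)
    show "square_integrable M (\<lambda>x. u x + v x)"
      using u v by (auto simp: cl_def intro: square_integrable_add)
    fix e :: real assume "e > 0"
    then have "e / 4 > 0" by simp
    then obtain g h where gh: "g \<in> S" "h \<in> S" and
      lt: "(\<integral>x. (u x - g x)\<^sup>2 \<partial>M) < e / 4" "(\<integral>x. (v x - h x)\<^sup>2 \<partial>M) < e / 4"
      using u v unfolding cl_def by meson
    have "(\<integral>x. ((u x - g x) + (v x - h x))\<^sup>2 \<partial>M) \<le>
        2 * (\<integral>x. (u x - g x)\<^sup>2 \<partial>M) + 2 * (\<integral>x. (v x - h x)\<^sup>2 \<partial>M)"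
      using u v gh S by (intro L2_sum_le square_integrable_diff) (auto simp: cl_def)
    with lt have "(\<integral>x. (u x + v x - (g x + h x))\<^sup>2 \<partial>M) < e"
      by (simp add: algebra_simps)
    with gh show "\<exists>g\<in>S. (\<integral>x. (u x + v x - g x)\<^sup>2 \<partial>M) < e"
      by (intro bexI[of _ "\<lambda>x. g x + h x"] add) auto
  qed
  have cl_cmult: "cl (\<lambda>x. c * u x)" if u: "cl u" for u c
    unfolding cl_def
  proof (intro conjI allI impI)
    show "square_integrable M (\<lambda>x. c * u x)"
      using u by (auto simp: cl_def intro: square_integrable_cmult)
    fix e :: real assume "e > 0"
    then have "e / (c\<^sup>2 + 1) > 0" by (simp add: add_nonneg_pos)
    then obtain g where g: "g \<in> S" and lt: "(\<integral>x. (u x - g x)\<^sup>2 \<partial>M) < e / (c\<^sup>2 + 1)"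
      using u unfolding cl_def by meson
    have "(\<integral>x. (c * u x - c * g x)\<^sup>2 \<partial>M) = (\<integral>x. c\<^sup>2 * (u x - g x)\<^sup>2 \<partial>M)"
      by (simp add: power_mult_distrib flip: right_diff_distrib)
    also have "\<dots> \<le> (c\<^sup>2 + 1) * (\<integral>x. (u x - g x)\<^sup>2 \<partial>M)"
      by (simp add: distrib_right)
    also have "\<dots> < e"
      using lt by (simp add: pos_less_divide_eq mult.commute add_nonneg_pos)
    finally show "\<exists>g\<in>S. (\<integral>x. (c * u x - g x)\<^sup>2 \<partial>M) < e"
      using g by (intro bexI[of _ "\<lambda>x. c * g x"] cmult) auto
  qed
  have cl_lim: "cl u" if u: "square_integrable M u" and s: "\<And>n. cl (s n)"
    and dom: "\<And>n x. \<bar>s n x\<bar> \<le> \<bar>u x\<bar>" and lim: "AE x in M. (\<lambda>n. s n x) \<longlonglongrightarrow> u x" for u s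
    unfolding cl_def
  proof (intro conjI allI impI u)
    fix e :: real assume "e > 0"
    have "(\<lambda>n. \<integral>x. (u x - s n x)\<^sup>2 \<partial>M) \<longlonglongrightarrow> 0"
      using s dom lim by (intro dominated_L2_tendsto[OF _ u u]) (auto simp: cl_def)
    then have "eventually (\<lambda>n. (\<integral>x. (u x - s n x)\<^sup>2 \<partial>M) < e / 4) sequentially"
      using \<open>e > 0\<close> by (intro order_tendstoD) auto
    then obtain n where n: "(\<integral>x. (u x - s n x)\<^sup>2 \<partial>M) < e / 4"
      by (auto simp: eventually_sequentially)
    have "e / 4 > 0" using \<open>e > 0\<close> by simp
    then obtain g where g: "g \<in> S" "(\<integral>x. (s n x - g x)\<^sup>2 \<partial>M) < e / 4"
      using s[of n] unfolding cl_def by meson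
    have "(\<integral>x. (u x - g x)\<^sup>2 \<partial>M) < e"
      using L2_dist_triangle[OF u, of "s n" g] s[of n] g S n by (auto simp: cl_def)
    with g show "\<exists>g\<in>S. (\<integral>x. (u x - g x)\<^sup>2 \<partial>M) < e" by blast
  qed
  have cl_indicator: "cl (indicator A)" if "A \<in> sets borel" for A
  proof -
    have sigma: "A \<in> sigma_sets UNIV (range greaterThan)"
      using that by (subst (asm) borel_Ioi) (simp add: sets_measure_of)
    have stable: "Int_stable (range (greaterThan :: real \<Rightarrow> real set))"
    proof (rule Int_stableI)
      fix A B :: "real set" assume "A \<in> range greaterThan" "B \<in> range greaterThan"
      then obtain a b where "A = {a<..}" "B = {b<..}" by auto
      then have "A \<inter> B = {max a b<..}" by auto
      then show "A \<inter> B \<in> range greaterThan" by blast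
    qed
    show ?thesis
      using stable Pow_UNIV[THEN equalityD2, THEN order_trans[OF subset_UNIV]] sigma
    proof (induction A rule: sigma_sets_induct_disjoint)
      case (basic A)
      then obtain a where "A = {a<..}" by auto
      then show ?case
        by (auto simp: cl_def intro!: gen bounded_square_integrable bounded_borel_indicator)
    next
      case empty
      show ?case using cl_cmult[OF cl_S[OF one], of 0] by (simp add: indicator_def[abs_def])
    next
      case (compl A)
      have "(\<lambda>x. 1 + (- 1) * indicator A x :: real) = indicator (UNIV - A)"
        by (auto simp: indicator_def)
      with cl_add[OF cl_S[OF one] cl_cmult[OF compl(2), of "- 1"]] show ?case by simp
    next
      case (union A)
      have sets: "A i \<in> sets borel" for i
        using union(2) by (subst borel_Ioi) (auto simp: sets_measure_of)
      have partial: "cl (indicator (\<Union>i<n. A i))" for n :: nat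
      proof (induction n)
        case 0
        show ?case using cl_cmult[OF cl_S[OF one], of 0] by (simp add: indicator_def[abs_def])
      next
        case (Suc n)
        have "x \<notin> A n" if "x \<in> A i" "i < n" for x i
          using disjoint_family_onD[OF union(1), of i n] that by auto
        then have "(\<lambda>x. indicator (\<Union>i<n. A i) x + indicator (A n) x :: real) = indicator (\<Union>i<Suc n. A i)"
          by (auto simp: lessThan_Suc indicator_def fun_eq_iff)
        with cl_add[OF Suc union(3)[of n]] show ?case by simp
      qed
      show ?case
      proof (rule cl_lim[OF _ partial])
        show "square_integrable M (indicator (\<Union>i. A i))"
          using sets by (intro bounded_square_integrable bounded_borel_indicator) auto
        show "\<bar>indicator (\<Union>i<n. A i) x\<bar> \<le> \<bar>indicator (\<Union>i. A i) x :: real\<bar>" for n x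
          by (auto simp: indicator_def)
        show "AE x in M. (\<lambda>n. indicator (\<Union>i<n. A i) x) \<longlonglongrightarrow> (indicator (\<Union>i. A i) x :: real)"
          by (intro AE_I2 LIMSEQ_indicator_UN)
      qed
    qed
  qed
  have cl_nonneg: "square_integrable M u \<longrightarrow> cl u"
    if "u \<in> borel_measurable borel" "\<And>x. 0 \<le> u x" for u
    using that
  proof (induction u rule: borel_measurable_induct_real)
    case (set A)
    then show ?case using cl_indicator by simp
  next
    case (mult u c)
    show ?case
    proof (cases "c = 0")
      case True
      then show ?thesis using cl_cmult[OF cl_S[OF one], of 0] by simp
    next
      case False
      then show ?thesis
        using mult(4) cl_cmult[of u c] square_integrable_cmult[of "\<lambda>x. c * u x" "1 / c"] by auto
    qed
  next
    case (add u v)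
    have "square_integrable M u \<and> square_integrable M v" if "square_integrable M (\<lambda>x. v x + u x)"
    proof -
      have "(u x)\<^sup>2 \<le> (v x + u x)\<^sup>2" "(v x)\<^sup>2 \<le> (v x + u x)\<^sup>2" for x
        using add.hyps(2)[of x] add.hyps(4)[of x] by (auto intro: power_mono)
      moreover have "integrable M (\<lambda>x. (v x + u x)\<^sup>2)"
        using that by (simp add: square_integrable_def)
      ultimately show ?thesis
        using add.hyps(1,3) unfolding square_integrable_def
        by (auto intro!: Bochner_Integration.integrable_bound[where f = "\<lambda>x. (v x + u x)\<^sup>2"] borel)
    qed
    with add show ?case using cl_add by blast
  next
    case (seq U)
    have le: "U n x \<le> u x" for n x
      using seq.hyps by (intro incseq_le[of "\<lambda>n. U n x"]) (auto simp: incseq_def le_fun_def)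
    show ?case
    proof
      assume u: "square_integrable M u"
      have "square_integrable M (U n)" for n
        using u seq.hyps(1,2) le unfolding square_integrable_def
        by (auto intro!: Bochner_Integration.integrable_bound[where f = "\<lambda>x. (u x)\<^sup>2"] borel AE_I2 power_mono)
      moreover have "\<bar>U n x\<bar> \<le> \<bar>u x\<bar>" for n x
        using le[of n x] seq.hyps(2)[of n x] by simp
      ultimately show "cl u"
        using seq.hyps seq.IH by (intro cl_lim[OF u, of U]) auto
    qed
  qed
  have "square_integrable M (\<lambda>x. max (f x) 0)" "square_integrable M (\<lambda>x. max (- f x) 0)"
  proof -
    have *: "integrable M (\<lambda>x. (f x)\<^sup>2)" "f \<in> borel_measurable borel"
      using f by (auto simp: square_integrable_def)
    show "square_integrable M (\<lambda>x. max (f x) 0)" "square_integrable M (\<lambda>x. max (- f x) 0)"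
      unfolding square_integrable_def using *(2)
      by (auto intro!: Bochner_Integration.integrable_bound[OF *(1)] borel simp: max_def)
  qed
  then have "cl (\<lambda>x. max (f x) 0 + (- 1) * max (- f x) 0)"
    using f by (intro cl_add cl_cmult cl_nonneg[rule_format]) (auto simp: square_integrable_def)
  also have "(\<lambda>x. max (f x) 0 + (- 1) * max (- f x) 0) = f"
    by (auto simp: max_def)
  finally show ?thesis using e by (simp add: cl_def)
qed

end

text \<open>
  The theorem of Riesz and Fischer, for Borel representatives: a subsequence with summable
  \<open>L\<^sup>1\<close> steps converges almost everywhere, and Fatou's lemma identifies its limit as the \<open>L\<^sup>2\<close> limit.
\<close>

lemma (in borel_finite_measure) L2_complete:
  assumes u: "\<And>n. square_integrable M (u n)"
    and Cauchy: "\<And>e. 0 < e \<Longrightarrow> \<exists>N. \<forall>m\<ge>N. \<forall>n\<ge>N. (\<integral>x. (u m x - u n x)\<^sup>2 \<partial>M) < e"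
  obtains f where "square_integrable M f" "(\<lambda>n. \<integral>x. (u n x - f x)\<^sup>2 \<partial>M) \<longlonglongrightarrow> 0"
proof -
  have [measurable]: "u n \<in> borel_measurable borel" for n
    using u by (simp add: square_integrable_def)
  have meas[measurable]: "u n \<in> borel_measurable M" for n
    by (rule borel) measurable
  \<comment> \<open>With this tolerance the Cauchy-Schwarz inequality bounds the \<open>L\<^sup>1\<close> steps of the subsequence by \<open>(1/2)^k\<close>.\<close>
  define e where "e k = (1/4)^k / (measure M (space M) + 1)" for k :: nat
  have mass: "0 < measure M (space M) + 1"
    by (simp add: add_nonneg_pos)
  have "\<forall>k. \<exists>N. \<forall>m\<ge>N. \<forall>n\<ge>N. (\<integral>x. (u m x - u n x)\<^sup>2 \<partial>M) < e k"
    using mass by (intro allI Cauchy) (simp add: e_def)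
  then obtain N where N: "\<And>k m n. N k \<le> m \<Longrightarrow> N k \<le> n \<Longrightarrow> (\<integral>x. (u m x - u n x)\<^sup>2 \<partial>M) < e k"
    by metis
  define r where "r k = (\<Sum>j\<le>k. N j) + k" for k
  have r: "N k \<le> r k" "r k \<le> r (Suc k)" "k \<le> r k" for k
  proof -
    have "N k \<le> (\<Sum>j\<le>k. N j)" by (rule member_le_sum) auto
    then show "N k \<le> r k" by (simp add: r_def)
  qed (simp_all add: r_def)
  have step: "(\<integral>x. \<bar>u (r (Suc k)) x - u (r k) x\<bar> \<partial>M) \<le> (1/2)^k" for k
  proof (rule power2_le_imp_le)
    have "(\<integral>x. \<bar>u (r (Suc k)) x - u (r k) x\<bar> \<partial>M)\<^sup>2
        \<le> measure M (space M) * (\<integral>x. (u (r (Suc k)) x - u (r k) x)\<^sup>2 \<partial>M)"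
      by (rule L1_le_L2[OF square_integrable_diff[OF u u]])
    also have "\<dots> \<le> (measure M (space M) + 1) * e k"
      using N[of k "r (Suc k)" "r k"] r order_trans[OF r(1) r(2), of k]
      by (intro mult_mono) auto
    also have "\<dots> = ((1/2)^k)\<^sup>2"
      using mass by (simp add: e_def power2_eq_square flip: power_mult_distrib)
    finally show "(\<integral>x. \<bar>u (r (Suc k)) x - u (r k) x\<bar> \<partial>M)\<^sup>2 \<le> ((1/2)^k)\<^sup>2" .
  qed simp
  have "AE x in M. summable (\<lambda>k. \<bar>u (r (Suc k)) x - u (r k) x\<bar>)"
  proof -
    have "(\<integral>\<^sup>+x. (\<Sum>k. ennreal \<bar>u (r (Suc k)) x - u (r k) x\<bar>) \<partial>M)
        = (\<Sum>k. \<integral>\<^sup>+x. ennreal \<bar>u (r (Suc k)) x - u (r k) x\<bar> \<partial>M)"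
      by (rule nn_integral_suminf) measurable
    also have "\<dots> \<le> (\<Sum>k. ennreal ((1/2)^k))"
    proof (rule suminf_le)
      fix k
      have "(\<integral>\<^sup>+x. ennreal \<bar>u (r (Suc k)) x - u (r k) x\<bar> \<partial>M) = ennreal (\<integral>x. \<bar>u (r (Suc k)) x - u (r k) x\<bar> \<partial>M)"
        using square_integrable_integrable[OF square_integrable_diff[OF u u]]
        by (intro nn_integral_eq_integral) auto
      then show "(\<integral>\<^sup>+x. ennreal \<bar>u (r (Suc k)) x - u (r k) x\<bar> \<partial>M) \<le> ennreal ((1/2)^k)"
        using step[of k] by (simp add: ennreal_leI)
    qed auto
    also have "\<dots> = ennreal (\<Sum>k. (1/2)^k)"
      by (rule suminf_ennreal2) (auto intro: summable_geometric)
    also have "\<dots> < \<infinity>" by simp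
    finally have "(\<integral>\<^sup>+x. (\<Sum>k. ennreal \<bar>u (r (Suc k)) x - u (r k) x\<bar>) \<partial>M) \<noteq> \<infinity>"
      by simp
    then have "AE x in M. (\<Sum>k. ennreal \<bar>u (r (Suc k)) x - u (r k) x\<bar>) \<noteq> \<infinity>"
      by (intro nn_integral_PInf_AE) measurable
    then show ?thesis
      by eventually_elim (auto intro: summable_suminf_not_top)
  qed
  then have conv: "AE x in M. convergent (\<lambda>k. u (r k) x)"
  proof eventually_elim
    case (elim x)
    then have "summable (\<lambda>k. u (r (Suc k)) x - u (r k) x)"
      by (rule summable_rabs_cancel)
    then have "convergent (\<lambda>n. \<Sum>k<n. u (r (Suc k)) x - u (r k) x)"
      by (simp add: summable_iff_convergent)
    then have "convergent (\<lambda>n. u (r n) x - u (r 0) x)"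
      using sum_lessThan_telescope[of "\<lambda>k. u (r k) x"] by simp
    then show ?case
      by (simp only: convergent_diff_const_right_iff)
  qed
  define f where "f x = lim (\<lambda>k. u (r k) x)" for x
  have f_borel[measurable]: "f \<in> borel_measurable borel"
    unfolding f_def[abs_def] by (rule borel_measurable_lim_metric) measurable
  have fM[measurable]: "f \<in> borel_measurable M" by (rule borel) measurable
  have lim: "AE x in M. (\<lambda>k. u (r k) x) \<longlonglongrightarrow> f x"
    using conv by eventually_elim (simp add: f_def convergent_LIMSEQ_iff)
  have near: "integrable M (\<lambda>x. (u n x - f x)\<^sup>2) \<and> (\<integral>x. (u n x - f x)\<^sup>2 \<partial>M) \<le> \<epsilon>"
    if \<epsilon>: "0 < \<epsilon>" "\<And>k. K \<le> k \<Longrightarrow> (\<integral>x. (u n x - u k x)\<^sup>2 \<partial>M) < \<epsilon>" for n \<epsilon> K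
  proof -
    have "(\<integral>\<^sup>+x. ennreal ((u n x - f x)\<^sup>2) \<partial>M) = (\<integral>\<^sup>+x. liminf (\<lambda>k. ennreal ((u n x - u (r k) x)\<^sup>2)) \<partial>M)"
      using lim
    proof (intro nn_integral_cong_AE, eventually_elim)
      case (elim x)
      then have "(\<lambda>k. ennreal ((u n x - u (r k) x)\<^sup>2)) \<longlonglongrightarrow> ennreal ((u n x - f x)\<^sup>2)"
        by (intro tendsto_ennrealI tendsto_power tendsto_diff tendsto_const)
      then show ?case by (intro lim_imp_Liminf[symmetric]) auto
    qed
    also have "\<dots> \<le> liminf (\<lambda>k. \<integral>\<^sup>+x. ennreal ((u n x - u (r k) x)\<^sup>2) \<partial>M)"
      by (rule nn_integral_liminf) measurable
    also have "\<dots> \<le> ennreal \<epsilon>"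
    proof (rule order_trans[OF Liminf_le_Limsup Limsup_bounded])
      show "eventually (\<lambda>k. (\<integral>\<^sup>+x. ennreal ((u n x - u (r k) x)\<^sup>2) \<partial>M) \<le> ennreal \<epsilon>) sequentially"
        using eventually_ge_at_top[of K]
      proof eventually_elim
        case (elim k)
        have "(\<integral>\<^sup>+x. ennreal ((u n x - u (r k) x)\<^sup>2) \<partial>M) = ennreal (\<integral>x. (u n x - u (r k) x)\<^sup>2 \<partial>M)"
          using square_integrable_diff[OF u u]
          by (intro nn_integral_eq_integral) (auto simp: square_integrable_def)
        also have "\<dots> \<le> ennreal \<epsilon>"
          using \<epsilon>(2)[of "r k"] r(3)[of k] elim by (intro ennreal_leI) auto
        finally show ?case .
      qed
    qed simp
    finally have le: "(\<integral>\<^sup>+x. ennreal ((u n x - f x)\<^sup>2) \<partial>M) \<le> ennreal \<epsilon>" .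
    then have int: "integrable M (\<lambda>x. (u n x - f x)\<^sup>2)"
      by (intro integrableI_nonneg) (auto intro: le_less_trans)
    have "ennreal (\<integral>x. (u n x - f x)\<^sup>2 \<partial>M) \<le> ennreal \<epsilon>"
      using le nn_integral_eq_integral[OF int] by simp
    then have "(\<integral>x. (u n x - f x)\<^sup>2 \<partial>M) \<le> \<epsilon>"
      using \<epsilon>(1) by (simp add: ennreal_le_iff)
    with int show ?thesis ..
  qed
  have "square_integrable M f"
  proof -
    obtain K where "\<And>m n. K \<le> m \<Longrightarrow> K \<le> n \<Longrightarrow> (\<integral>x. (u m x - u n x)\<^sup>2 \<partial>M) < 1"
      using Cauchy[of 1] by auto
    then have "integrable M (\<lambda>x. (u K x - f x)\<^sup>2)"
      using near[of 1 K K] by auto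
    then have "square_integrable M (\<lambda>x. u K x - f x)"
      by (simp add: square_integrable_def)
    from square_integrable_diff[OF u[of K] this] show ?thesis by simp
  qed
  moreover have "(\<lambda>n. \<integral>x. (u n x - f x)\<^sup>2 \<partial>M) \<longlonglongrightarrow> 0"
  proof (rule LIMSEQ_I)
    fix e :: real assume "0 < e"
    then obtain K where K: "\<And>m n. K \<le> m \<Longrightarrow> K \<le> n \<Longrightarrow> (\<integral>x. (u m x - u n x)\<^sup>2 \<partial>M) < e / 2"
      using Cauchy[of "e / 2"] by auto
    have "norm ((\<integral>x. (u n x - f x)\<^sup>2 \<partial>M) - 0) < e" if "K \<le> n" for n
      using near[of "e / 2" K n] K[OF that] \<open>0 < e\<close> by auto
    then show "\<exists>K. \<forall>n\<ge>K. norm ((\<integral>x. (u n x - f x)\<^sup>2 \<partial>M) - 0) < e" by blast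
  qed
  ultimately show ?thesis by (rule that)
qed

lemma L2_iff: "f \<in> L2 M \<longleftrightarrow> periodic f \<and> square_integrable M f"
  by (auto simp: L2_def square_integrable_def)

lemma L2_norm_eq: "L2_norm M f = sqrt (\<integral>x. (f x)\<^sup>2 \<partial>M)"
  by (simp add: L2_norm_def L2_inner_def power2_eq_square)

lemma L2_norm_tendsto_iff:
  "((\<lambda>n. L2_norm M (g n)) \<longlonglongrightarrow> 0) \<longleftrightarrow> ((\<lambda>n. \<integral>x. (g n x)\<^sup>2 \<partial>M) \<longlonglongrightarrow> 0)"
proof
  assume "(\<lambda>n. L2_norm M (g n)) \<longlonglongrightarrow> 0"
  then have "(\<lambda>n. (L2_norm M (g n))\<^sup>2) \<longlonglongrightarrow> 0\<^sup>2" by (rule tendsto_power)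
  then show "(\<lambda>n. \<integral>x. (g n x)\<^sup>2 \<partial>M) \<longlonglongrightarrow> 0" by (simp add: L2_norm_eq)
next
  assume "(\<lambda>n. \<integral>x. (g n x)\<^sup>2 \<partial>M) \<longlonglongrightarrow> 0"
  then have "(\<lambda>n. sqrt (\<integral>x. (g n x)\<^sup>2 \<partial>M)) \<longlonglongrightarrow> sqrt 0" by (rule tendsto_real_sqrt)
  then show "(\<lambda>n. L2_norm M (g n)) \<longlonglongrightarrow> 0" by (simp add: L2_norm_eq)
qed

section \<open>Primitives on the circle and the density of their range\<close>

text \<open>
  The segment \<open>L x\<close> is \<open>{..x}\<close> for the cadlag primitives with respect to \<open>dW\<close> and \<open>{..<x}\<close> for the
  caglad primitives with respect to \<open>dV\<close>; keeping it as a parameter treats both at once.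
\<close>

definition primitive :: "real measure \<Rightarrow> (real \<Rightarrow> real set) \<Rightarrow> (real \<Rightarrow> real) \<Rightarrow> real \<Rightarrow> real" where
  "primitive M L z x = (\<integral>y. z y * indicator (L x) y \<partial>M)"

text \<open>
  Composition with \<open>frac\<close> makes the primitive periodic, and the constant is chosen so that the mean
  with respect to the measure \<open>N\<close> on the other side vanishes.  The result is thus again a mean-zero
  integrand, and the operator can be iterated with the roles of the measures exchanged.
\<close>

definition mean_zero_primitive ::
    "real measure \<Rightarrow> (real \<Rightarrow> real set) \<Rightarrow> real measure \<Rightarrow> (real \<Rightarrow> real) \<Rightarrow> real \<Rightarrow> real" where
  "mean_zero_primitive M L N z x =
     primitive M L z (frac x) - (\<integral>t. primitive M L z t \<partial>N) / measure N (space N)"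

lemma borel_measurable_frac: "(frac :: real \<Rightarrow> real) \<in> borel_measurable borel"
  unfolding frac_def[abs_def] by measurable

text \<open>
  What \<open>dW\<close> and \<open>dV\<close> have in common: no mass at the integers, which makes the choice of the
  fundamental domain immaterial, and positive mass on every open interval, which expresses the
  strict monotonicity of the weights.
\<close>

locale circle_measure = borel_finite_measure M for M :: "real measure" +
  fixes L :: "real \<Rightarrow> real set"
  assumes interior: "AE x in M. 0 < x \<and> x < 1"
    and full_support: "0 \<le> a \<Longrightarrow> a < b \<Longrightarrow> b \<le> 1 \<Longrightarrow> 0 < (\<integral>x. indicator {a<..<b} x \<partial>M :: real)"
    and segments: "L = atMost \<or> L = lessThan"
begin

lemma segment_borel: "L x \<in> sets borel"
  using segments by auto

lemma below_segment: "y < x \<Longrightarrow> y \<in> L x" and segment_le: "y \<in> L x \<Longrightarrow> y \<le> x"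
  using segments by auto

lemma integrable_segment:
  assumes z: "square_integrable M z"
  shows "integrable M (\<lambda>y. z y * indicator (L x) y)"
proof (rule Bochner_Integration.integrable_bound[OF square_integrable_integrable[OF z]])
  show "(\<lambda>y. z y * indicator (L x) y) \<in> borel_measurable M"
    using z segment_borel by (intro borel borel_measurable_times borel_measurable_indicator)
      (auto simp: square_integrable_def)
qed (auto simp: indicator_def)

lemma primitive_diff:
  assumes "square_integrable M z" "square_integrable M w"
  shows "primitive M L (\<lambda>y. z y - w y) x = primitive M L z x - primitive M L w x"
  using assms by (simp add: primitive_def left_diff_distrib integrable_segment)

lemma primitive_add:
  assumes "square_integrable M z" "square_integrable M w"
  shows "primitive M L (\<lambda>y. z y + w y) x = primitive M L z x + primitive M L w x"
  using assms by (simp add: primitive_def distrib_right integrable_segment)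

lemma primitive_cmult:
  "primitive M L (\<lambda>y. c * z y) x = c * primitive M L z x"
  by (simp add: primitive_def mult.assoc)

lemma primitive_bound:
  assumes z: "square_integrable M z"
  shows "\<bar>primitive M L z x\<bar> \<le> (\<integral>y. \<bar>z y\<bar> \<partial>M)"
  unfolding primitive_def
proof (rule order_trans[OF integral_abs_bound integral_mono])
  show "integrable M (\<lambda>y. \<bar>z y * indicator (L x) y\<bar>)" "integrable M (\<lambda>y. \<bar>z y\<bar>)"
    using integrable_segment[OF z] square_integrable_integrable[OF z] by auto
qed (auto simp: indicator_def)

lemma primitive_borel:
  assumes z: "square_integrable M z"
  shows "primitive M L z \<in> borel_measurable borel"
proof -
  have [measurable]: "z \<in> borel_measurable borel"
    using z by (simp add: square_integrable_def)
  have snd: "(\<lambda>p. snd p) \<in> borel_measurable (borel \<Otimes>\<^sub>M M)"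
    using measurable_compose[OF measurable_snd ident] .
  have fst: "(\<lambda>p. fst p) \<in> borel_measurable ((borel :: real measure) \<Otimes>\<^sub>M M)"
    by simp
  have z': "(\<lambda>p. z (snd p)) \<in> borel_measurable ((borel :: real measure) \<Otimes>\<^sub>M M)"
    by (rule measurable_compose[OF snd]) simp
  have "(\<lambda>p. if snd p \<in> L (fst p) then z (snd p) else 0) \<in> borel_measurable (borel \<Otimes>\<^sub>M M)"
    using segments
  proof
    assume "L = atMost"
    then show ?thesis
      by (auto intro!: measurable_If z' borel_measurable_le snd fst)
  next
    assume "L = lessThan"
    then show ?thesis
      by (auto intro!: measurable_If z' borel_measurable_less snd fst)
  qed
  also have "(\<lambda>p. if snd p \<in> L (fst p) then z (snd p) else 0) = (\<lambda>(x, y). z y * indicator (L x) y)"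
    by (auto simp: indicator_def)
  finally have "(\<lambda>x. \<integral>y. z y * indicator (L x) y \<partial>M) \<in> borel_measurable borel"
    by (rule borel_measurable_lebesgue_integral)
  then show ?thesis
    by (simp add: primitive_def[abs_def])
qed

lemma primitive_bounded_borel:
  "square_integrable M z \<Longrightarrow> bounded_borel (primitive M L z)"
  using primitive_borel primitive_bound by (intro bounded_borelI) auto

lemma primitive_left_end:
  assumes "x \<le> 0" shows "primitive M L z x = 0"
proof -
  have "AE y in M. z y * indicator (L x) y = 0"
    using interior by eventually_elim (use assms segment_le in \<open>fastforce simp: indicator_def\<close>)
  then show ?thesis
    unfolding primitive_def by (rule integral_eq_zero_AE)
qed

lemma primitive_right_end:
  assumes z: "square_integrable M z" and "1 \<le> x"
  shows "primitive M L z x = (\<integral>y. z y \<partial>M)"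
proof -
  have "AE y in M. z y * indicator (L x) y = z y"
    using interior by eventually_elim (use assms below_segment in \<open>auto simp: indicator_def\<close>)
  then show ?thesis
    unfolding primitive_def using integrable_segment[OF z] square_integrable_integrable[OF z]
    by (intro integral_cong_AE) auto
qed

lemma mass_pos: "0 < measure M (space M)"
proof -
  have "0 < (\<integral>x. indicator {0<..<1} x \<partial>M :: real)"
    by (rule full_support) auto
  also have "\<dots> = measure M ({0<..<1} \<inter> space M)"
    by simp
  also have "\<dots> \<le> measure M (space M)"
    by (rule bounded_measure)
  finally show ?thesis .
qed

lemma AE_frac: "AE x in M. frac x = x"
  using interior by eventually_elim (auto simp: frac_eq)

text \<open>
  The normalised indicator of an interval, whose primitive rises from 0 to 1 between \<open>s\<close> and \<open>t\<close>.
\<close>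

definition bump :: "real \<Rightarrow> real \<Rightarrow> real \<Rightarrow> real" where
  "bump s t y = indicator {s<..<t} y / (\<integral>x. indicator {s<..<t} x \<partial>M)"

lemma bump_bounded_borel: "bounded_borel (bump s t)"
proof -
  have "bounded_borel (\<lambda>y. (1 / (\<integral>x. indicator {s<..<t} x \<partial>M)) * indicator {s<..<t} y)"
    by (intro bounded_borel_mult bounded_borel_const bounded_borel_indicator) auto
  then show ?thesis by (simp add: bump_def[abs_def])
qed

lemma bump_nonneg: "0 \<le> bump s t y"
  by (simp add: bump_def integral_nonneg_AE)

lemma integral_bump:
  assumes "0 \<le> s" "s < t" "t \<le> 1"
  shows "(\<integral>y. bump s t y \<partial>M) = 1"
  using full_support[OF assms] by (simp add: bump_def)

lemma primitive_bump_left: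
  assumes "x \<le> s" shows "primitive M L (bump s t) x = 0"
proof -
  have "bump s t y * indicator (L x) y = 0" for y
    using assms segment_le[of y x] by (auto simp: bump_def indicator_def)
  then show ?thesis unfolding primitive_def by (simp only: integral_zero)
qed

lemma primitive_bump_right:
  assumes "0 \<le> s" "s < t" "t \<le> 1" "t \<le> x"
  shows "primitive M L (bump s t) x = 1"
proof -
  have "bump s t y * indicator (L x) y = bump s t y" for y
    using assms below_segment[of y x] by (auto simp: bump_def indicator_def)
  then show ?thesis
    unfolding primitive_def using integral_bump[OF assms(1-3)] by (simp only:)
qed

lemma primitive_bump_bound:
  assumes "0 \<le> s" "s < t" "t \<le> 1"
  shows "\<bar>primitive M L (bump s t) x\<bar> \<le> 1"
  using primitive_bound[OF bounded_square_integrable[OF bump_bounded_borel], of s t x]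
    integral_bump[OF assms] bump_nonneg[of s t] by simp

end

locale circle_pair = M: circle_measure M L + N: circle_measure N K for M L N K
begin

abbreviation T :: "(real \<Rightarrow> real) \<Rightarrow> real \<Rightarrow> real" where
  "T \<equiv> mean_zero_primitive M L N"

lemma T_AE: "AE x in N. T z x = primitive M L z x - (\<integral>t. primitive M L z t \<partial>N) / measure N (space N)"
  using N.AE_frac by eventually_elim (simp add: mean_zero_primitive_def)

lemma T_bounded_borel:
  assumes z: "square_integrable M z"
  shows "bounded_borel (T z)"
proof -
  have "(\<lambda>x. primitive M L z (frac x)) \<in> borel_measurable borel"
    using borel_measurable_frac M.primitive_borel[OF z] by (rule measurable_compose)
  then have "bounded_borel (\<lambda>x. primitive M L z (frac x))"
    using M.primitive_bound[OF z] by (intro bounded_borelI) auto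
  then have "bounded_borel (\<lambda>x. primitive M L z (frac x) - (\<integral>t. primitive M L z t \<partial>N) / measure N (space N))"
    by (intro bounded_borel_diff bounded_borel_const)
  then show ?thesis
    by (simp add: mean_zero_primitive_def[abs_def])
qed

lemma T_periodic: "periodic (T z)"
  by (simp add: periodic_def mean_zero_primitive_def frac_1_eq)

lemma T_mean:
  assumes z: "square_integrable M z"
  shows "(\<integral>x. T z x \<partial>N) = 0"
proof -
  have "(\<integral>x. T z x \<partial>N) = (\<integral>x. primitive M L z x - (\<integral>t. primitive M L z t \<partial>N) / measure N (space N) \<partial>N)"
    using T_bounded_borel[OF z] M.primitive_bounded_borel[OF z]
    by (intro integral_cong_AE T_AE) (auto simp: bounded_borel_def intro!: N.borel)
  also have "\<dots> = 0"
    using N.bounded_integrable[OF M.primitive_bounded_borel[OF z]] N.mass_pos by simp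
  finally show ?thesis .
qed

lemma T_bound:
  assumes z: "square_integrable M z"
  shows "\<bar>T z x\<bar> \<le> 2 * (\<integral>y. \<bar>z y\<bar> \<partial>M)"
proof -
  let ?I = "\<integral>y. \<bar>z y\<bar> \<partial>M"
  have "\<bar>\<integral>t. primitive M L z t \<partial>N\<bar> \<le> (\<integral>t. ?I \<partial>N)"
    using N.bounded_integrable[OF M.primitive_bounded_borel[OF z]] M.primitive_bound[OF z]
    by (intro order_trans[OF integral_abs_bound integral_mono]) auto
  then have "\<bar>(\<integral>t. primitive M L z t \<partial>N) / measure N (space N)\<bar> \<le> ?I"
    using N.mass_pos by (simp add: abs_divide pos_divide_le_eq mult.commute)
  then show ?thesis
    using M.primitive_bound[OF z, of "frac x"] unfolding mean_zero_primitive_def by linarith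
qed

lemma T_diff:
  assumes "square_integrable M z" "square_integrable M w"
  shows "T (\<lambda>y. z y - w y) x = T z x - T w x"
  using M.primitive_diff[OF assms] N.bounded_integrable[OF M.primitive_bounded_borel] assms
  by (simp add: mean_zero_primitive_def diff_divide_distrib)

lemma T_dist:
  assumes "square_integrable M z" "square_integrable M w"
  shows "\<bar>T z x - T w x\<bar> \<le> 2 * (\<integral>y. \<bar>z y - w y\<bar> \<partial>M)"
  using T_bound[OF M.square_integrable_diff[OF assms], of x] by (simp add: T_diff[OF assms])

text \<open>
  By \<open>L2_dense\<close> only half-line indicators need to be approximated.  The primitive of a bump on
  \<open>(a, a + \<delta>)\<close> tends to the indicator of \<open>(a, \<infinity>)\<close> at every point as \<open>\<delta> \<rightarrow> 0\<close>, wherever atoms of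
  either measure lie.  A second bump next to 1 makes the mean of the integrand zero, and its
  primitive disappears in the limit.
\<close>

lemma primitives_dense:
  assumes y: "square_integrable N y" and e: "0 < e"
  shows "\<exists>c z. bounded_borel z \<and> (\<integral>x. z x \<partial>M) = 0 \<and> (\<integral>x. (y x - (c + primitive M L z x))\<^sup>2 \<partial>N) < e"
proof -
  define S where "S = {\<lambda>x. c + primitive M L z x | c z. bounded_borel z \<and> (\<integral>x. z x \<partial>M) = 0}"
  have zero: "bounded_borel (\<lambda>x. 0)" by (rule bounded_borel_const)
  have const: "(\<lambda>x. c) \<in> S" for c
    unfolding S_def using zero by (intro CollectI exI[of _ c] exI[of _ "\<lambda>x. 0"]) (auto simp: primitive_def)
  have "\<exists>g\<in>S. (\<integral>x. (y x - g x)\<^sup>2 \<partial>N) < e"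
  proof (rule N.L2_dense[OF _ _ _ _ _ y e])
    fix g assume "g \<in> S"
    then obtain c z where g: "g = (\<lambda>x. c + primitive M L z x)" and z: "bounded_borel z" "(\<integral>x. z x \<partial>M) = 0"
      by (auto simp: S_def)
    show "square_integrable N g"
      unfolding g using z
      by (intro N.bounded_square_integrable bounded_borel_add bounded_borel_const
          M.primitive_bounded_borel M.bounded_square_integrable)
    fix k
    have "bounded_borel (\<lambda>x. k * z x)" "(\<integral>x. k * z x \<partial>M) = 0"
      using z by (auto intro: bounded_borel_mult bounded_borel_const)
    moreover have "(\<lambda>x. k * g x) = (\<lambda>x. k * c + primitive M L (\<lambda>x. k * z x) x)"
      by (simp add: g M.primitive_cmult distrib_left)
    ultimately show "(\<lambda>x. k * g x) \<in> S"
      unfolding S_def by blast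
  next
    show "(\<lambda>x. 1) \<in> S" by (rule const)
  next
    fix g h assume "g \<in> S" "h \<in> S"
    then obtain c z d w where gh: "g = (\<lambda>x. c + primitive M L z x)" "h = (\<lambda>x. d + primitive M L w x)"
      and z: "bounded_borel z" "(\<integral>x. z x \<partial>M) = 0" and w: "bounded_borel w" "(\<integral>x. w x \<partial>M) = 0"
      unfolding S_def by blast
    have "bounded_borel (\<lambda>x. z x + w x)" "(\<integral>x. z x + w x \<partial>M) = 0"
      using z w M.bounded_integrable by (auto intro: bounded_borel_add)
    moreover have "(\<lambda>x. g x + h x) = (\<lambda>x. (c + d) + primitive M L (\<lambda>x. z x + w x) x)"
      using z w by (simp add: gh M.primitive_add M.bounded_square_integrable add_ac)
    ultimately show "(\<lambda>x. g x + h x) \<in> S"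
      unfolding S_def by blast
  next
    fix a e :: real assume "e > 0"
    consider "a < 0" | "a \<ge> 1" | "0 \<le> a" "a < 1" by linarith
    then show "\<exists>g\<in>S. (\<integral>x. (indicator {a<..} x - g x)\<^sup>2 \<partial>N) < e"
    proof cases
      case 1
      have "AE x in N. (indicator {a<..} x - 1 :: real)\<^sup>2 = 0"
        using N.interior by eventually_elim (use 1 in auto)
      then have "(\<integral>x. (indicator {a<..} x - 1 :: real)\<^sup>2 \<partial>N) = 0"
        by (rule integral_eq_zero_AE)
      with \<open>e > 0\<close> show ?thesis by (intro bexI[OF _ const[of 1]]) simp
    next
      case 2
      have "AE x in N. (indicator {a<..} x - 0 :: real)\<^sup>2 = 0"
        using N.interior by eventually_elim (use 2 in auto)
      then have "(\<integral>x. (indicator {a<..} x - 0 :: real)\<^sup>2 \<partial>N) = 0"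
        by (rule integral_eq_zero_AE)
      with \<open>e > 0\<close> show ?thesis by (intro bexI[OF _ const[of 0]]) simp
    next
      case 3
      define d where "d n = (1 - a) * inverse (real (Suc n))" for n
      have d: "0 < d n" "d n \<le> 1 - a" for n
        using 3 mult_left_le[of "inverse (real (Suc n))" "1 - a"] by (auto simp: d_def inverse_le_1_iff)
      have d0: "d \<longlonglongrightarrow> 0"
        unfolding d_def using tendsto_mult_right[OF LIMSEQ_inverse_real_of_nat, of "1 - a"] by (simp add: mult.commute)
      define z where "z n y = M.bump a (a + d n) y - M.bump (1 - d n) 1 y" for n y
      have z: "bounded_borel (z n)" "(\<integral>x. z n x \<partial>M) = 0" for n
        using 3 d[of n] M.bounded_integrable[OF M.bump_bounded_borel] M.integral_bump[of a "a + d n"]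
          M.integral_bump[of "1 - d n" 1]
        by (auto simp: z_def[abs_def] intro!: bounded_borel_diff M.bump_bounded_borel)
      have prim: "primitive M L (z n) x =
          primitive M L (M.bump a (a + d n)) x - primitive M L (M.bump (1 - d n) 1) x" for n x
        unfolding z_def[abs_def]
        by (intro M.primitive_diff M.bounded_square_integrable M.bump_bounded_borel)
      have "(\<lambda>n. \<integral>x. (indicator {a<..} x - primitive M L (z n) x)\<^sup>2 \<partial>N) \<longlonglongrightarrow> 0"
      proof (rule N.dominated_L2_tendsto)
        show "square_integrable N (primitive M L (z n))" for n
          by (intro N.bounded_square_integrable M.primitive_bounded_borel M.bounded_square_integrable z)
        show "square_integrable N (indicator {a<..})"
          by (intro N.bounded_square_integrable bounded_borel_indicator) auto
        show "square_integrable N (\<lambda>x. 2)"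
          by (rule N.square_integrable_const)
        show "AE x in N. \<bar>primitive M L (z n) x\<bar> \<le> \<bar>2\<bar>" for n
        proof (rule AE_I2)
          fix x
          have "\<bar>primitive M L (M.bump a (a + d n)) x\<bar> \<le> 1" "\<bar>primitive M L (M.bump (1 - d n) 1) x\<bar> \<le> 1"
            using 3 d[of n] by (auto intro!: M.primitive_bump_bound)
          then show "\<bar>primitive M L (z n) x\<bar> \<le> \<bar>2\<bar>"
            unfolding prim by linarith
        qed
        show "AE x in N. (\<lambda>n. primitive M L (z n) x) \<longlonglongrightarrow> indicator {a<..} x"
          using N.interior
        proof eventually_elim
          case (elim x)
          have "eventually (\<lambda>n. d n < 1 - x) sequentially"
            using elim by (intro order_tendstoD[OF d0]) auto
          moreover have "eventually (\<lambda>n. a < x \<longrightarrow> d n < x - a) sequentially"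
            using order_tendstoD(2)[OF d0, of "x - a"] by (cases "a < x") auto
          ultimately have "eventually (\<lambda>n. primitive M L (z n) x = indicator {a<..} x) sequentially"
          proof eventually_elim
            case (elim n)
            then show ?case
              using 3 d[of n] M.primitive_bump_left[of x "1 - d n" 1] M.primitive_bump_left[of x a "a + d n"]
                M.primitive_bump_right[of a "a + d n" x]
              by (cases "a < x") (auto simp: prim)
          qed
          then show ?case by (rule tendsto_eventually)
        qed
      qed
      then have "eventually (\<lambda>n. (\<integral>x. (indicator {a<..} x - primitive M L (z n) x)\<^sup>2 \<partial>N) < e) sequentially"
        using \<open>e > 0\<close> by (intro order_tendstoD) auto
      then obtain n where n: "(\<integral>x. (indicator {a<..} x - primitive M L (z n) x)\<^sup>2 \<partial>N) < e"
        by (auto simp: eventually_sequentially)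
      have "(\<lambda>x. 0 + primitive M L (z n) x) \<in> S"
        unfolding S_def using z by blast
      with n show ?thesis by auto
    qed
  qed
  then show ?thesis unfolding S_def by blast
qed

lemma T_range_dense:
  assumes y: "square_integrable N y" and mean: "(\<integral>x. y x \<partial>N) = 0" and e: "0 < e"
  shows "\<exists>z. bounded_borel z \<and> (\<integral>x. z x \<partial>M) = 0 \<and> (\<integral>x. (y x - T z x)\<^sup>2 \<partial>N) < e"
proof -
  obtain c z where z: "bounded_borel z" "(\<integral>x. z x \<partial>M) = 0"
    and lt: "(\<integral>x. (y x - (c + primitive M L z x))\<^sup>2 \<partial>N) < e"
    using primitives_dense[OF y e] by blast
  have z': "square_integrable M z" using z by (intro M.bounded_square_integrable)
  define k where "k = c + (\<integral>t. primitive M L z t \<partial>N) / measure N (space N)"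
  have Tz: "square_integrable N (T z)"
    by (intro N.bounded_square_integrable T_bounded_borel z')
  define r where "r x = y x - T z x" for x
  have r: "square_integrable N r"
    unfolding r_def[abs_def] by (rule N.square_integrable_diff[OF y Tz])
  have r0: "(\<integral>x. r x \<partial>N) = 0"
    unfolding r_def using N.square_integrable_integrable[OF y] N.square_integrable_integrable[OF Tz]
      mean T_mean[OF z'] by simp
  \<comment> \<open>The residual \<open>r\<close> has mean zero, so it is orthogonal to the constant \<open>k\<close> by which it differs from
    \<open>y - (c + primitive M L z)\<close>; dropping \<open>k\<close> only decreases the distance.\<close>
  have "(\<integral>x. (r x)\<^sup>2 \<partial>N) \<le> (\<integral>x. (r x)\<^sup>2 \<partial>N) + k\<^sup>2 * measure N (space N)"
    by simp
  also have "\<dots> = (\<integral>x. (r x)\<^sup>2 - 2 * k * r x + k\<^sup>2 \<partial>N)"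
    using r N.square_integrable_integrable[OF r] r0 by (simp add: square_integrable_def)
  also have "\<dots> = (\<integral>x. (y x - (c + primitive M L z x))\<^sup>2 \<partial>N)"
  proof (rule integral_cong_AE)
    show "AE x in N. (r x)\<^sup>2 - 2 * k * r x + k\<^sup>2 = (y x - (c + primitive M L z x))\<^sup>2"
      using T_AE[of z]
    proof eventually_elim
      case (elim x)
      then have "y x - (c + primitive M L z x) = r x - k"
        by (simp add: r_def k_def)
      then show ?case by (simp add: power2_diff)
    qed
    show "(\<lambda>x. (r x)\<^sup>2 - 2 * k * r x + k\<^sup>2) \<in> borel_measurable N"
      using r by (auto simp: square_integrable_def intro!: N.borel)
    have "primitive M L z \<in> borel_measurable borel" "y \<in> borel_measurable borel"
      using y M.primitive_borel[OF z'] by (auto simp: square_integrable_def)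
    then show "(\<lambda>x. (y x - (c + primitive M L z x))\<^sup>2) \<in> borel_measurable N"
      by (intro N.borel) auto
  qed
  finally show ?thesis
    using lt z unfolding r_def by (intro exI[of _ z]) auto
qed

end

section \<open>Dense chains of iterated primitives\<close>

text \<open>
  The rate of convergence is needed because the limits of the approximating chains have to be uniform
  and quantitatively close to the given function.
\<close>

lemma geometric_Cauchy_limit:
  fixes a :: "nat \<Rightarrow> real"
  assumes step: "\<And>k. \<bar>a (Suc k) - a k\<bar> \<le> C * (1/2)^k"
  shows "\<exists>l. a \<longlonglongrightarrow> l \<and> (\<forall>k. \<bar>l - a k\<bar> \<le> 2 * C * (1/2)^k)"
proof -
  have far: "\<bar>a (k + j) - a k\<bar> \<le> 2 * C * (1/2)^k - 2 * C * (1/2)^(k + j)" for k j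
  proof (induction j)
    case (Suc j)
    have "C * (1/2)^(k + j) = 2 * C * (1/2)^(k + j) - 2 * C * (1/2)^(k + Suc j)"
      by simp
    moreover have "\<bar>a (Suc (k + j)) - a k\<bar> \<le> \<bar>a (Suc (k + j)) - a (k + j)\<bar> + \<bar>a (k + j) - a k\<bar>"
      by linarith
    ultimately show ?case
      using step[of "k + j"] Suc unfolding add_Suc_right by linarith
  qed simp
  have "0 \<le> C" using step[of 0] by simp
  then have far': "\<bar>a (k + j) - a k\<bar> \<le> 2 * C * (1/2)^k" for k j
    using order_trans[OF far[of k j], of "2 * C * (1/2)^k"] by simp
  have "Cauchy a"
  proof (rule CauchyI')
    fix e :: real assume "e > 0"
    have "(\<lambda>k. 2 * C * (1/2)^k) \<longlonglongrightarrow> 2 * C * 0"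
      by (intro tendsto_mult_left LIMSEQ_power_zero) simp
    then have "eventually (\<lambda>k. 2 * C * (1/2)^k < e) sequentially"
      using \<open>e > 0\<close> by (intro order_tendstoD(2)) simp
    then obtain k0 where k0: "\<And>k. k \<ge> k0 \<Longrightarrow> 2 * C * (1/2)^k < e"
      by (auto simp: eventually_sequentially)
    have "dist (a m) (a n) < e" if "m \<ge> k0" "n > m" for m n
      using far'[of m "n - m"] k0[OF that(1)] that by (simp add: dist_real_def abs_minus_commute)
    then show "\<exists>M. \<forall>m\<ge>M. \<forall>n>m. dist (a m) (a n) < e" by blast
  qed
  then obtain l where l: "a \<longlonglongrightarrow> l"
    using Cauchy_convergent_iff convergent_def by blast
  have "\<bar>l - a k\<bar> \<le> 2 * C * (1/2)^k" for k
  proof (rule tendsto_upperbound)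
    have "(\<lambda>j. a (k + j)) \<longlonglongrightarrow> l"
      using LIMSEQ_ignore_initial_segment[OF l, of k] by (simp add: add.commute)
    then show "(\<lambda>j. \<bar>a (k + j) - a k\<bar>) \<longlonglongrightarrow> \<bar>l - a k\<bar>"
      by (intro tendsto_intros)
  qed (use far' in auto)
  with l show ?thesis by blast
qed

context circle_pair begin

interpretation swap: circle_pair N K M L ..

text \<open>
  The Mittag-Leffler principle.  Choose \<open>y = y\<^sub>0, y\<^sub>1, y\<^sub>2, \<dots>\<close> on alternating sides of the circle with
  \<open>T y\<^sub>n\<^sub>+\<^sub>1\<close> so close to \<open>y\<^sub>n\<close> that, for each \<open>n\<close>, the \<open>k\<close>-fold images of \<open>y\<^sub>n\<^sub>+\<^sub>k\<close> form a
  Cauchy sequence in \<open>k\<close>.  Their limits \<open>X\<^sub>n\<close> satisfy \<open>X\<^sub>n = T X\<^sub>n\<^sub>+\<^sub>1\<close> exactly.  After the first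
  application of \<open>T\<close> the convergence is uniform, because \<open>T\<close> maps \<open>L\<^sup>1\<close> to the sup norm.
\<close>

lemma smooth_chain_dense:
  assumes y: "square_integrable N y" and mean: "(\<integral>x. y x \<partial>N) = 0" and e: "0 < e"
  obtains X where "\<And>n. bounded_borel (X n)"
    and "\<And>n. even n \<Longrightarrow> X n = mean_zero_primitive M L N (X (Suc n))"
    and "\<And>n. odd n \<Longrightarrow> X n = mean_zero_primitive N K M (X (Suc n))"
    and "(\<integral>x. (y x - X 0 x)\<^sup>2 \<partial>N) < e"
proof -
  define mm where "mm n = (if even n then N else M)" for n :: nat
  define TT where "TT n = (if even n then mean_zero_primitive M L N else mean_zero_primitive N K M)"
    for n :: nat
  define mass where "mass = 1 + measure M (space M) + measure N (space N)"
  define C where "C = 2 * mass"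
  have mass: "measure (mm n) (space (mm n)) \<le> mass" for n
    by (auto simp: mm_def mass_def)
  have "1 \<le> mass" by (simp add: mass_def)
  then have C: "1 \<le> C" "0 < C" by (auto simp: C_def)
  have bfm: "borel_finite_measure (mm n)" for n
    by (simp add: mm_def M.borel_finite_measure_axioms N.borel_finite_measure_axioms)
  have sqi: "bounded_borel z \<Longrightarrow> square_integrable (mm n) z" for z n
    by (rule borel_finite_measure.bounded_square_integrable[OF bfm])
  have TT_bounded: "bounded_borel (TT n z)" if "square_integrable (mm (Suc n)) z" for n z
    using that by (auto simp: TT_def mm_def intro: T_bounded_borel swap.T_bounded_borel)
  have TT_dist: "\<bar>TT n z x - TT n w x\<bar> \<le> 2 * (\<integral>y. \<bar>z y - w y\<bar> \<partial>mm (Suc n))"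
    if "square_integrable (mm (Suc n)) z" "square_integrable (mm (Suc n)) w" for n z w x
    using that T_dist[of z w x] swap.T_dist[of z w x] by (auto simp: TT_def mm_def)
  have L1_sup: "(\<integral>x. \<bar>f x\<bar> \<partial>mm n) \<le> mass * B" if "bounded_borel f" "\<And>x. \<bar>f x\<bar> \<le> B" for f n B
  proof -
    interpret m: borel_finite_measure "mm n" by (rule bfm)
    have "(\<integral>x. \<bar>f x\<bar> \<partial>mm n) \<le> (\<integral>x. B \<partial>mm n)"
      using m.bounded_integrable[OF that(1)] that(2) by (intro integral_mono) auto
    also have "\<dots> \<le> mass * B"
      using mass[of n] order_trans[OF abs_ge_zero that(2)] by (simp add: mult_right_mono)
    finally show ?thesis .
  qed
  have dense: "\<exists>z. bounded_borel z \<and> (\<integral>x. z x \<partial>mm (Suc n)) = 0 \<and>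
      (\<integral>x. (w x - TT n z x)\<^sup>2 \<partial>mm n) < \<epsilon> \<and> (\<integral>x. \<bar>w x - TT n z x\<bar> \<partial>mm n) < \<delta>"
    if w: "square_integrable (mm n) w" "(\<integral>x. w x \<partial>mm n) = 0" and "0 < \<epsilon>" "0 < \<delta>" for n w \<epsilon> \<delta>
  proof -
    interpret m: borel_finite_measure "mm n" by (rule bfm)
    define \<eta> where "\<eta> = min \<epsilon> (\<delta>\<^sup>2 / mass)"
    have "0 < \<eta>" using that \<open>1 \<le> mass\<close> by (auto simp: \<eta>_def)
    then have "\<exists>z. bounded_borel z \<and> (\<integral>x. z x \<partial>mm (Suc n)) = 0 \<and> (\<integral>x. (w x - TT n z x)\<^sup>2 \<partial>mm n) < \<eta>"
      using w by (auto simp: mm_def TT_def intro: T_range_dense swap.T_range_dense split: if_splits)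
    then obtain z where z: "bounded_borel z" "(\<integral>x. z x \<partial>mm (Suc n)) = 0"
      and lt: "(\<integral>x. (w x - TT n z x)\<^sup>2 \<partial>mm n) < \<eta>" by blast
    have "square_integrable (mm n) (\<lambda>x. w x - TT n z x)"
      by (intro m.square_integrable_diff w sqi TT_bounded z)
    from m.L1_le_L2[OF this]
    have "(\<integral>x. \<bar>w x - TT n z x\<bar> \<partial>mm n)\<^sup>2 \<le> mass * (\<integral>x. (w x - TT n z x)\<^sup>2 \<partial>mm n)"
      using mass[of n] by (elim order_trans) (intro mult_right_mono, auto)
    also have "\<dots> < mass * (\<delta>\<^sup>2 / mass)"
      using lt \<open>1 \<le> mass\<close> by (intro mult_strict_left_mono) (auto simp: \<eta>_def)
    also have "\<dots> = \<delta>\<^sup>2"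
      using \<open>1 \<le> mass\<close> by simp
    finally have "(\<integral>x. \<bar>w x - TT n z x\<bar> \<partial>mm n) < \<delta>"
      by (rule power2_less_imp_less) (use \<open>0 < \<delta>\<close> in simp)
    with z lt show ?thesis by (auto simp: \<eta>_def)
  qed
  \<comment> \<open>The limit differs from the first approximation by at most \<open>4 d\<close>, which this \<open>d\<close> turns into a
    squared \<open>L\<^sup>2\<close> distance of at most \<open>e / 4\<close>.  The tolerance \<open>\<delta> n\<close> beats the growth \<open>C^k\<close> of
    the norms of the iterated operators.\<close>
  define d where "d = sqrt (e / (64 * mass))"
  have "0 < d" using e \<open>1 \<le> mass\<close> by (simp add: d_def)
  define \<delta> where "\<delta> n = d * (1 / (2 * C))^n" for n :: nat
  have \<delta>: "0 < \<delta> n" for n using \<open>0 < d\<close> C by (simp add: \<delta>_def)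
  have "\<exists>Y. \<forall>n. (square_integrable (mm n) (Y n) \<and> (\<integral>x. Y n x \<partial>mm n) = 0 \<and> (n = 0 \<longrightarrow> Y n = y)) \<and>
     ((\<integral>x. (Y n x - TT n (Y (Suc n)) x)\<^sup>2 \<partial>mm n) < e / 4 \<and>
      (\<integral>x. \<bar>Y n x - TT n (Y (Suc n)) x\<bar> \<partial>mm n) < \<delta> n)"
  proof (rule dependent_nat_choice)
    show "\<exists>x. square_integrable (mm 0) x \<and> (\<integral>t. x t \<partial>mm 0) = 0 \<and> (0 = (0::nat) \<longrightarrow> x = y)"
      using y mean by (auto simp: mm_def)
  next
    fix w n assume "square_integrable (mm n) w \<and> (\<integral>x. w x \<partial>mm n) = 0 \<and> (n = 0 \<longrightarrow> w = y)"
    then obtain z where "bounded_borel z" "(\<integral>x. z x \<partial>mm (Suc n)) = 0"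
      "(\<integral>x. (w x - TT n z x)\<^sup>2 \<partial>mm n) < e / 4" "(\<integral>x. \<bar>w x - TT n z x\<bar> \<partial>mm n) < \<delta> n"
      using dense[of n w "e / 4" "\<delta> n"] e \<delta> by auto
    then show "\<exists>z. (square_integrable (mm (Suc n)) z \<and> (\<integral>x. z x \<partial>mm (Suc n)) = 0 \<and> (Suc n = 0 \<longrightarrow> z = y)) \<and>
        (\<integral>x. (w x - TT n z x)\<^sup>2 \<partial>mm n) < e / 4 \<and> (\<integral>x. \<bar>w x - TT n z x\<bar> \<partial>mm n) < \<delta> n"
      using sqi by blast
  qed
  then obtain Y where Y: "\<And>n. square_integrable (mm n) (Y n)" "Y 0 = y"
    "\<And>n. (\<integral>x. (Y n x - TT n (Y (Suc n)) x)\<^sup>2 \<partial>mm n) < e / 4"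
    "\<And>n. (\<integral>x. \<bar>Y n x - TT n (Y (Suc n)) x\<bar> \<partial>mm n) < \<delta> n"
    by auto
  \<comment> \<open>\<open>v k n\<close> is the \<open>k\<close>-fold image of \<open>Y (n + k)\<close> on the side of index \<open>n\<close>.\<close>
  define v where "v = rec_nat Y (\<lambda>k w n. TT n (w (Suc n)))"
  have v0: "v 0 n = Y n" and vS: "v (Suc k) n = TT n (v k (Suc n))" for n k
    by (simp_all add: v_def)
  have v_sqi: "square_integrable (mm n) (v k n)" for k n
    by (induction k arbitrary: n) (auto simp: v0 vS Y intro: sqi TT_bounded)
  have vS_bounded: "bounded_borel (v (Suc k) n)" for k n
    unfolding vS by (intro TT_bounded v_sqi)
  have v_L1: "(\<integral>x. \<bar>v (Suc k) n x - v k n x\<bar> \<partial>mm n) \<le> C^k * \<delta> (n + k)" for k n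
  proof (induction k arbitrary: n)
    case 0
    show ?case using Y(4)[of n] by (simp add: v0 vS abs_minus_commute)
  next
    case (Suc k)
    let ?I = "\<integral>y. \<bar>v (Suc k) (Suc n) y - v k (Suc n) y\<bar> \<partial>mm (Suc n)"
    have "(\<integral>x. \<bar>v (Suc (Suc k)) n x - v (Suc k) n x\<bar> \<partial>mm n) \<le> mass * (2 * ?I)"
    proof (rule L1_sup)
      show "bounded_borel (\<lambda>x. v (Suc (Suc k)) n x - v (Suc k) n x)"
        by (intro bounded_borel_diff vS_bounded)
      show "\<bar>v (Suc (Suc k)) n x - v (Suc k) n x\<bar> \<le> 2 * ?I" for x
        using TT_dist[OF v_sqi[of "Suc n" "Suc k"] v_sqi[of "Suc n" k]] by (simp only: vS)
    qed
    also have "\<dots> = C * ?I" by (simp add: C_def)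
    also have "\<dots> \<le> C * (C^k * \<delta> (Suc n + k))"
      using C by (intro mult_left_mono Suc.IH) auto
    finally show ?case by (simp add: mult.assoc)
  qed
  have v_sup: "\<bar>v (Suc (Suc k)) n x - v (Suc k) n x\<bar> \<le> 2 * d * (1/2)^k" for k n x
  proof -
    have "\<bar>v (Suc (Suc k)) n x - v (Suc k) n x\<bar>
        \<le> 2 * (\<integral>y. \<bar>v (Suc k) (Suc n) y - v k (Suc n) y\<bar> \<partial>mm (Suc n))"
      using TT_dist[OF v_sqi[of "Suc n" "Suc k"] v_sqi[of "Suc n" k]] by (simp only: vS)
    also have "\<dots> \<le> 2 * (C^k * \<delta> (Suc n + k))"
      by (intro mult_left_mono v_L1) simp
    also have "C^k * \<delta> (Suc n + k) = d * (1 / (2 * C))^Suc n * (1/2)^k"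
      using C by (simp add: \<delta>_def power_add power_divide power_mult_distrib field_simps)
    also have "\<dots> \<le> d * 1 * (1/2)^k"
      using C \<open>0 < d\<close> by (intro mult_right_mono mult_left_mono power_le_one) auto
    finally show ?thesis by simp
  qed
  define X where "X n x = lim (\<lambda>k. v (Suc k) n x)" for n x
  have "(\<lambda>k. v (Suc k) n x) \<longlonglongrightarrow> X n x \<and> (\<forall>k. \<bar>X n x - v (Suc k) n x\<bar> \<le> 2 * (2 * d) * (1/2)^k)"
    for n x
    using geometric_Cauchy_limit[of "\<lambda>k. v (Suc k) n x", OF v_sup] by (auto simp: X_def limI)
  then have X_lim: "\<And>n x. (\<lambda>k. v (Suc k) n x) \<longlonglongrightarrow> X n x"
    and X_near: "\<And>n k x. \<bar>X n x - v (Suc k) n x\<bar> \<le> 4 * d * (1/2)^k"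
    by auto
  have X_bounded: "bounded_borel (X n)" for n
  proof -
    have "X n \<in> borel_measurable borel"
      using vS_bounded by (intro borel_measurable_LIMSEQ_real[OF X_lim]) (auto simp: bounded_borel_def)
    moreover obtain B where "\<And>x. \<bar>v (Suc 0) n x\<bar> \<le> B"
      using vS_bounded unfolding bounded_borel_def by blast
    then have "\<bar>X n x\<bar> \<le> B + 4 * d" for x
    proof -
      have "\<bar>X n x\<bar> \<le> \<bar>v (Suc 0) n x\<bar> + \<bar>X n x - v (Suc 0) n x\<bar>" by linarith
      with X_near[of n x 0] \<open>\<bar>v (Suc 0) n x\<bar> \<le> B\<close> show ?thesis by simp
    qed
    ultimately show ?thesis by (rule bounded_borelI)
  qed
  have X_fix: "X n = TT n (X (Suc n))" for n
  proof
    fix x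
    have bound: "\<bar>v (Suc (Suc k)) n x - TT n (X (Suc n)) x\<bar> \<le> 2 * (mass * (4 * d * (1/2)^k))" for k
    proof -
      have "\<bar>v (Suc (Suc k)) n x - TT n (X (Suc n)) x\<bar>
          \<le> 2 * (\<integral>y. \<bar>v (Suc k) (Suc n) y - X (Suc n) y\<bar> \<partial>mm (Suc n))"
        unfolding vS[of "Suc k"] by (intro TT_dist v_sqi sqi X_bounded)
      also have "\<dots> \<le> 2 * (mass * (4 * d * (1/2)^k))"
      proof (intro mult_left_mono L1_sup bounded_borel_diff vS_bounded X_bounded)
        show "\<bar>v (Suc k) (Suc n) y - X (Suc n) y\<bar> \<le> 4 * d * (1/2)^k" for y
          using X_near[of "Suc n" y k] by (simp add: abs_minus_commute)
      qed simp
      finally show "\<bar>v (Suc (Suc k)) n x - TT n (X (Suc n)) x\<bar> \<le> 2 * (mass * (4 * d * (1/2)^k))" .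
    qed
    have "(\<lambda>k. 2 * (mass * (4 * d * (1/2)^k))) \<longlonglongrightarrow> 2 * (mass * (4 * d * 0))"
      by (intro tendsto_mult_left LIMSEQ_power_zero) simp
    then have "(\<lambda>k. 2 * (mass * (4 * d * (1/2)^k))) \<longlonglongrightarrow> 0"
      by simp
    then have "(\<lambda>k. v (Suc (Suc k)) n x - TT n (X (Suc n)) x) \<longlonglongrightarrow> 0"
      by (rule Lim_null_comparison[OF always_eventually, OF allI, rotated])
         (unfold real_norm_def, rule bound)
    then have "(\<lambda>k. v (Suc (Suc k)) n x) \<longlonglongrightarrow> TT n (X (Suc n)) x"
      by (rule LIM_zero_cancel)
    moreover have "(\<lambda>k. v (Suc (Suc k)) n x) \<longlonglongrightarrow> X n x"
      using LIMSEQ_Suc[OF X_lim[of n x]] .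
    ultimately show "X n x = TT n (X (Suc n)) x"
      by (rule LIMSEQ_unique[rotated])
  qed
  have "(\<integral>x. (y x - X 0 x)\<^sup>2 \<partial>N) < e"
  proof -
    have "(\<integral>x. (v 1 0 x - X 0 x)\<^sup>2 \<partial>N) \<le> (\<integral>x. (4 * d)\<^sup>2 \<partial>N)"
    proof (rule integral_mono)
      have "bounded_borel (\<lambda>x. v 1 0 x - X 0 x)"
        using vS_bounded[of 0 0] X_bounded by (auto intro: bounded_borel_diff)
      then show "integrable N (\<lambda>x. (v 1 0 x - X 0 x)\<^sup>2)"
        using N.bounded_square_integrable by (auto simp: square_integrable_def)
      show "(v 1 0 x - X 0 x)\<^sup>2 \<le> (4 * d)\<^sup>2" for x
      proof (rule abs_le_square_iff[THEN iffD1])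
        show "\<bar>v 1 0 x - X 0 x\<bar> \<le> \<bar>4 * d\<bar>"
          using X_near[of 0 x 0] \<open>0 < d\<close> by (simp add: abs_minus_commute)
      qed
    qed simp
    also have "\<dots> \<le> mass * (4 * d)\<^sup>2"
      using mass[of 0] by (simp add: mm_def mult_right_mono)
    also have "\<dots> = e / 4"
      using e \<open>1 \<le> mass\<close> by (simp add: d_def power_mult_distrib)
    finally have "(\<integral>x. (v 1 0 x - X 0 x)\<^sup>2 \<partial>N) \<le> e / 4" .
    moreover have "(\<integral>x. (y x - v 1 0 x)\<^sup>2 \<partial>N) < e / 4"
      using Y(3)[of 0] by (simp add: v0 vS Y(2) mm_def)
    moreover have "(\<integral>x. (y x - X 0 x)\<^sup>2 \<partial>N)
        \<le> 2 * (\<integral>x. (y x - v 1 0 x)\<^sup>2 \<partial>N) + 2 * (\<integral>x. (v 1 0 x - X 0 x)\<^sup>2 \<partial>N)"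
      using y v_sqi[of 0 1] X_bounded
      by (intro N.L2_dist_triangle) (auto simp: mm_def intro: N.bounded_square_integrable)
    ultimately show ?thesis by linarith
  qed
  moreover have "X n = mean_zero_primitive M L N (X (Suc n))" if "even n" for n
    by (rule trans[OF X_fix]) (simp add: TT_def that)
  moreover have "X n = mean_zero_primitive N K M (X (Suc n))" if "odd n" for n
    by (rule trans[OF X_fix]) (simp add: TT_def that)
  ultimately show ?thesis
    by (intro that[OF X_bounded])
qed

end

section \<open>One-sided limits of periodic functions\<close>

lemma periodic_shift:
  assumes "periodic f" shows "f (x + of_int n) = f x"
proof -
  have up: "f (x + of_nat k) = f x" for x and k :: nat
  proof (induction k)
    case (Suc k)
    have "f (x + of_nat (Suc k)) = f ((x + of_nat k) + 1)"
      by (simp add: algebra_simps)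
    then show ?case using Suc assms by (simp add: periodic_def)
  qed simp
  show ?thesis
  proof (cases "n \<ge> 0")
    case True
    then show ?thesis using up[of x "nat n"] by simp
  next
    case False
    then show ?thesis using up[of "x + of_int n" "nat (- n)"] by simp
  qed
qed

lemma filterlim_shift_left: "filterlim (\<lambda>t. t + c) (at_left (x + c)) (at_left x)" for x c :: real
  by (rule tendsto_imp_filterlim_at_left) (auto intro!: tendsto_intros simp: eventually_at_filter)

lemma filterlim_shift_right: "filterlim (\<lambda>t. t + c) (at_right (x + c)) (at_right x)" for x c :: real
  by (rule tendsto_imp_filterlim_at_right) (auto intro!: tendsto_intros simp: eventually_at_filter)

lemma periodic_limit_left:
  assumes u: "periodic u" and lim: "(u \<longlongrightarrow> l) (at_left (x + of_int n))"
  shows "(u \<longlongrightarrow> l) (at_left x)"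
  using filterlim_compose[OF lim filterlim_shift_left] by (simp add: periodic_shift[OF u])

lemma periodic_limit_right:
  assumes u: "periodic u" and lim: "(u \<longlongrightarrow> l) (at_right (x + of_int n))"
  shows "(u \<longlongrightarrow> l) (at_right x)"
  using filterlim_compose[OF lim filterlim_shift_right] by (simp add: periodic_shift[OF u])

lemma shift_into_unit_right: "\<exists>n. 0 < x + of_int n \<and> x + of_int n \<le> (1 :: real)"
  by (rule exI[of _ "1 - \<lceil>x\<rceil>"]) (simp; linarith)

lemma shift_into_unit_left: "\<exists>n. 0 \<le> x + of_int n \<and> x + of_int n < (1 :: real)"
  by (rule exI[of _ "- \<lfloor>x\<rfloor>"]) (simp; linarith)

lemma periodic_caglad:
  assumes u: "periodic u"
    and left: "\<And>x. 0 < x \<Longrightarrow> x \<le> 1 \<Longrightarrow> (u \<longlongrightarrow> u x) (at_left x)"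
    and right: "\<And>x. 0 \<le> x \<Longrightarrow> x < 1 \<Longrightarrow> \<exists>l. (u \<longlongrightarrow> l) (at_right x)"
  shows "caglad u"
  unfolding caglad_def continuous_within
proof (intro allI conjI)
  fix x :: real
  obtain n where n: "0 < x + of_int n \<and> x + of_int n \<le> 1"
    using shift_into_unit_right by blast
  with periodic_limit_left[OF u left[of "x + of_int n"]] show "(u \<longlongrightarrow> u x) (at_left x)"
    by (simp add: periodic_shift[OF u])
  obtain n where "0 \<le> x + of_int n" "x + of_int n < 1"
    using shift_into_unit_left by blast
  with right obtain l where "(u \<longlongrightarrow> l) (at_right (x + of_int n))" by blast
  from periodic_limit_right[OF u this] show "\<exists>l. (u \<longlongrightarrow> l) (at_right x)" ..
qed

lemma periodic_cadlag:
  assumes u: "periodic u"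
    and right: "\<And>x. 0 \<le> x \<Longrightarrow> x < 1 \<Longrightarrow> (u \<longlongrightarrow> u x) (at_right x)"
    and left: "\<And>x. 0 < x \<Longrightarrow> x \<le> 1 \<Longrightarrow> \<exists>l. (u \<longlongrightarrow> l) (at_left x)"
  shows "cadlag u"
  unfolding cadlag_def continuous_within
proof (intro allI conjI)
  fix x :: real
  obtain n where n: "0 \<le> x + of_int n \<and> x + of_int n < 1"
    using shift_into_unit_left by blast
  with periodic_limit_right[OF u right[of "x + of_int n"]] show "(u \<longlongrightarrow> u x) (at_right x)"
    by (simp add: periodic_shift[OF u])
  obtain n where "0 < x + of_int n" "x + of_int n \<le> 1"
    using shift_into_unit_right by blast
  with left obtain l where "(u \<longlongrightarrow> l) (at_left (x + of_int n))" by blast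
  from periodic_limit_left[OF u this] show "\<exists>l. (u \<longlongrightarrow> l) (at_left x)" ..
qed

text \<open>
  Evaluating at the left neighbours \<open>(\<lceil>n x\<rceil> - 1) / n\<close>, which take countably many values and lie
  strictly below \<open>x\<close>, exhibits the function as a pointwise limit of Borel functions.
\<close>

lemma caglad_borel:
  assumes "caglad f" shows "f \<in> borel_measurable borel"
proof (rule borel_measurable_LIMSEQ_real)
  let ?p = "\<lambda>n x. (of_int \<lceil>real (Suc n) * x\<rceil> - 1) / real (Suc n)"
  show "(\<lambda>n. f (?p n x)) \<longlonglongrightarrow> f x" for x
  proof -
    have lt: "?p n x < x" and gt: "x - inverse (real (Suc n)) \<le> ?p n x" for n
    proof -
      have "of_int \<lceil>real (Suc n) * x\<rceil> - 1 < real (Suc n) * x" by linarith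
      then show "?p n x < x" by (simp add: divide_less_eq mult.commute)
      have "real (Suc n) * x - 1 \<le> of_int \<lceil>real (Suc n) * x\<rceil> - 1" by simp
      then have "(real (Suc n) * x - 1) / real (Suc n) \<le> ?p n x"
        by (rule divide_right_mono) simp
      moreover have "(real (Suc n) * x - 1) / real (Suc n) = x - inverse (real (Suc n))"
        by (simp add: field_simps)
      ultimately show "x - inverse (real (Suc n)) \<le> ?p n x" by simp
    qed
    have "(\<lambda>n. ?p n x) \<longlonglongrightarrow> x"
    proof (rule tendsto_sandwich)
      have "(\<lambda>n. x - inverse (real (Suc n))) \<longlonglongrightarrow> x - 0"
        by (intro tendsto_diff tendsto_const LIMSEQ_inverse_real_of_nat)
      then show "(\<lambda>n. x - inverse (real (Suc n))) \<longlonglongrightarrow> x"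
        by (simp only: diff_zero)
      show "(\<lambda>n::nat. x) \<longlonglongrightarrow> x" by (rule tendsto_const)
      show "eventually (\<lambda>n. x - inverse (real (Suc n)) \<le> ?p n x) sequentially"
        by (intro always_eventually allI gt)
      show "eventually (\<lambda>n. ?p n x \<le> x) sequentially"
        by (intro always_eventually allI less_imp_le lt)
    qed
    then have "filterlim (\<lambda>n. ?p n x) (at_left x) sequentially"
      by (rule tendsto_imp_filterlim_at_left) (intro always_eventually allI lt)
    moreover have "(f \<longlongrightarrow> f x) (at_left x)"
      using assms by (simp add: caglad_def continuous_within)
    ultimately show ?thesis
      by (rule filterlim_compose[rotated])
  qed
  show "(\<lambda>x. f (?p n x)) \<in> borel_measurable borel" for n
  proof -
    have "(\<lambda>x::real. \<lceil>real (Suc n) * x\<rceil>) \<in> measurable borel (count_space UNIV)"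
      by measurable
    then show ?thesis
      by (rule measurable_compose) simp
  qed
qed

text \<open>
  The reflection \<open>f \<mapsto> (\<lambda>x. - f (- x))\<close> exchanges left and right while preserving monotonicity, so
  one-sided results need a proof on one side only.
\<close>

lemma cadlag_reflect: "cadlag f \<longleftrightarrow> caglad (\<lambda>x. - f (- x))"
proof -
  have 1: "((\<lambda>t. - f (- t)) \<longlongrightarrow> l) (at_left x) \<longleftrightarrow> (f \<longlongrightarrow> - l) (at_right (- x))" for x l
    using tendsto_minus_cancel_left[of "\<lambda>t. f (- t)" l "at_left x"]
    by (simp add: filterlim_at_left_to_right)
  have 2: "((\<lambda>t. - f (- t)) \<longlongrightarrow> l) (at_right x) \<longleftrightarrow> (f \<longlongrightarrow> - l) (at_left (- x))" for x l
    using tendsto_minus_cancel_left[of "\<lambda>t. f (- t)" l "at_right x"]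
    by (simp add: filterlim_at_left_to_right)
  have ex: "(\<exists>l. (f \<longlongrightarrow> - l) F) \<longleftrightarrow> (\<exists>l. (f \<longlongrightarrow> l) F)" for F :: "real filter"
    by (metis minus_minus)
  have all: "(\<forall>x. P (- x)) \<longleftrightarrow> (\<forall>x. P x)" for P :: "real \<Rightarrow> bool"
    by (metis minus_minus)
  show ?thesis
    unfolding cadlag_def caglad_def continuous_within 1 2 ex minus_minus
    using all[of "\<lambda>x. (f \<longlongrightarrow> f x) (at_right x) \<and> (\<exists>l. (f \<longlongrightarrow> l) (at_left x))"] by simp
qed

lemma cadlag_borel:
  assumes "cadlag f" shows "f \<in> borel_measurable borel"
proof -
  have "(\<lambda>x. - f (- x)) \<in> borel_measurable borel"
    using assms by (intro caglad_borel) (simp add: cadlag_reflect)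
  then have "(\<lambda>x. - (\<lambda>x. - f (- x)) (- x)) \<in> borel_measurable borel"
    by measurable
  then show ?thesis by simp
qed

lemma cadlag_diff: "cadlag f \<Longrightarrow> cadlag g \<Longrightarrow> cadlag (\<lambda>x. f x - g x)"
  unfolding cadlag_def continuous_within by (intro allI conjI) (blast intro: tendsto_diff)+

lemma caglad_diff: "caglad f \<Longrightarrow> caglad g \<Longrightarrow> caglad (\<lambda>x. f x - g x)"
  unfolding caglad_def continuous_within by (intro allI conjI) (blast intro: tendsto_diff)+

text \<open>
  One-sided limits give local bounds, and a period is compact.
\<close>

lemma periodic_one_sided_limits_bounded:
  fixes f :: "real \<Rightarrow> real"
  assumes f: "periodic f" and left: "\<And>x. \<exists>l. (f \<longlongrightarrow> l) (at_left x)"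
    and right: "\<And>x. \<exists>l. (f \<longlongrightarrow> l) (at_right x)"
  shows "\<exists>B. \<forall>x. \<bar>f x\<bar> \<le> B"
proof -
  have "\<exists>d>0. \<exists>B. \<forall>y\<in>ball x d. \<bar>f y\<bar> \<le> B" for x
  proof -
    obtain l r where lr: "(f \<longlongrightarrow> l) (at_left x)" "(f \<longlongrightarrow> r) (at_right x)"
      using left right by blast
    have "eventually (\<lambda>y. \<bar>f y\<bar> \<le> \<bar>l\<bar> + 1) (at_left x)"
      using tendstoD[OF lr(1), of 1] by (rule eventually_mono) (auto simp: dist_real_def)
    moreover have "eventually (\<lambda>y. \<bar>f y\<bar> \<le> \<bar>r\<bar> + 1) (at_right x)"
      using tendstoD[OF lr(2), of 1] by (rule eventually_mono) (auto simp: dist_real_def)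
    ultimately have "eventually (\<lambda>y. \<bar>f y\<bar> \<le> \<bar>l\<bar> + \<bar>r\<bar> + 1) (at x)"
      unfolding eventually_at_split by (auto elim: eventually_mono)
    then obtain d where d: "d > 0" "\<And>y. y \<noteq> x \<Longrightarrow> dist y x < d \<Longrightarrow> \<bar>f y\<bar> \<le> \<bar>l\<bar> + \<bar>r\<bar> + 1"
      unfolding eventually_at by blast
    have "\<bar>f y\<bar> \<le> \<bar>l\<bar> + \<bar>r\<bar> + 1 + \<bar>f x\<bar>" if "y \<in> ball x d" for y
      using d(2)[of y] that by (cases "y = x") (auto simp: dist_commute)
    with d(1) show ?thesis by blast
  qed
  then obtain d B where d: "\<And>x. d x > 0" and B: "\<And>x y. y \<in> ball x (d x) \<Longrightarrow> \<bar>f y\<bar> \<le> B x"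
    by metis
  have "compact {0..1::real}" by simp
  moreover have "{0..1} \<subseteq> (\<Union>x\<in>{0..1}. ball x (d x))"
    using d by fastforce
  ultimately obtain C where C: "C \<subseteq> {0..1}" "finite C" "{0..1} \<subseteq> (\<Union>x\<in>C. ball x (d x))"
    using compactE_image[of "{0..1}" "{0..1}" "\<lambda>x. ball x (d x)"] by (metis open_ball)
  have "\<bar>f x\<bar> \<le> (\<Sum>c\<in>C. \<bar>B c\<bar>)" for x
  proof -
    obtain n where "0 < x + of_int n \<and> x + of_int n \<le> 1"
      using shift_into_unit_right by blast
    then have "x + of_int n \<in> {0..1}" by simp
    then have "x + of_int n \<in> (\<Union>c\<in>C. ball c (d c))"
      using C(3) by (rule rev_subsetD)
    then obtain c where c: "c \<in> C" "x + of_int n \<in> ball c (d c)"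
      by (elim UN_E)
    have "\<bar>f x\<bar> \<le> \<bar>B c\<bar>"
      using B[OF c(2)] by (simp add: periodic_shift[OF f])
    also have "\<dots> \<le> (\<Sum>c\<in>C. \<bar>B c\<bar>)"
      using c(1) C(2) by (intro member_le_sum) auto
    finally show ?thesis .
  qed
  then show ?thesis by blast
qed

lemma caglad_bounded_borel:
  assumes "periodic f" "caglad f" shows "bounded_borel f"
  using periodic_one_sided_limits_bounded[OF assms(1)] caglad_borel[OF assms(2)] assms(2)
  unfolding bounded_borel_def caglad_def continuous_within by blast

lemma cadlag_bounded_borel:
  assumes "periodic f" "cadlag f" shows "bounded_borel f"
  using periodic_one_sided_limits_bounded[OF assms(1)] cadlag_borel[OF assms(2)] assms(2)
  unfolding bounded_borel_def cadlag_def continuous_within by blast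

section \<open>One-sided limits of primitives\<close>

context circle_measure begin

text \<open>
  Whether or not the segments contain their end point, from the left only \<open>{..<x}\<close> is exhausted, and
  from the right (below) they shrink to \<open>{..x}\<close>.  So primitives over \<open>{..x}\<close> are cadlag and those over
  \<open>{..<x}\<close> are caglad, whatever the integrand.
\<close>

lemma primitive_left_limit:
  assumes z: "square_integrable M z"
  shows "(primitive M L z \<longlongrightarrow> primitive M lessThan z x) (at_left x)"
proof (rule tendsto_at_left_sequentially[of "x - 1"])
  fix S :: "nat \<Rightarrow> real" assume S: "\<And>n. S n < x" "S \<longlonglongrightarrow> x"
  show "(\<lambda>n. primitive M L z (S n)) \<longlonglongrightarrow> primitive M lessThan z x"
    unfolding primitive_def
  proof (rule integral_dominated_convergence)
    show "(\<lambda>y. z y * indicator {..<x} y) \<in> borel_measurable M"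
      using z by (intro borel borel_measurable_times borel_measurable_indicator)
        (auto simp: square_integrable_def)
    show "(\<lambda>y. z y * indicator (L (S n)) y) \<in> borel_measurable M" for n
      using integrable_segment[OF z] by auto
    show "integrable M (\<lambda>y. \<bar>z y\<bar>)"
      using square_integrable_integrable[OF z] by auto
    show "AE y in M. (\<lambda>n. z y * indicator (L (S n)) y) \<longlonglongrightarrow> z y * indicator {..<x} y"
    proof (rule AE_I2)
      fix y
      have "eventually (\<lambda>n. y < x \<longrightarrow> y < S n) sequentially"
        using order_tendstoD(1)[OF S(2), of y] by (cases "y < x") auto
      then have "eventually (\<lambda>n. indicator (L (S n)) y = (indicator {..<x} y :: real)) sequentially"
      proof eventually_elim
        case (elim n)
        then show ?case
          using below_segment[of y "S n"] segment_le[of y "S n"] S(1)[of n] by (auto simp: indicator_def)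
      qed
      then show "(\<lambda>n. z y * indicator (L (S n)) y) \<longlonglongrightarrow> z y * indicator {..<x} y"
        by (intro tendsto_mult_left tendsto_eventually)
    qed
  qed (auto simp: indicator_def)
qed auto

lemma primitive_right_limit:
  assumes z: "square_integrable M z"
  shows "(primitive M L z \<longlongrightarrow> primitive M atMost z x) (at_right x)"
proof (rule tendsto_at_right_sequentially[of x "x + 1"])
  fix S :: "nat \<Rightarrow> real" assume S: "\<And>n. x < S n" "S \<longlonglongrightarrow> x"
  show "(\<lambda>n. primitive M L z (S n)) \<longlonglongrightarrow> primitive M atMost z x"
    unfolding primitive_def
  proof (rule integral_dominated_convergence)
    show "(\<lambda>y. z y * indicator {..x} y) \<in> borel_measurable M"
      using z by (intro borel borel_measurable_times borel_measurable_indicator)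
        (auto simp: square_integrable_def)
    show "(\<lambda>y. z y * indicator (L (S n)) y) \<in> borel_measurable M" for n
      using integrable_segment[OF z] by auto
    show "integrable M (\<lambda>y. \<bar>z y\<bar>)"
      using square_integrable_integrable[OF z] by auto
    show "AE y in M. (\<lambda>n. z y * indicator (L (S n)) y) \<longlonglongrightarrow> z y * indicator {..x} y"
    proof (rule AE_I2)
      fix y
      have "eventually (\<lambda>n. x < y \<longrightarrow> S n < y) sequentially"
        using order_tendstoD(2)[OF S(2), of y] by (cases "x < y") auto
      then have "eventually (\<lambda>n. indicator (L (S n)) y = (indicator {..x} y :: real)) sequentially"
      proof eventually_elim
        case (elim n)
        then show ?case
          using below_segment[of y "S n"] segment_le[of y "S n"] S(1)[of n] by (auto simp: indicator_def)
      qed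
      then show "(\<lambda>n. z y * indicator (L (S n)) y) \<longlonglongrightarrow> z y * indicator {..x} y"
        by (intro tendsto_mult_left tendsto_eventually)
    qed
  qed (auto simp: indicator_def)
qed auto

end

context circle_pair begin

text \<open>
  A mean-zero integrand makes the primitive take the same value at 0 and 1, so that the jump of \<open>frac\<close>
  at the right end of the period does no harm.
\<close>

lemma T_on_unit:
  assumes z: "square_integrable M z" and z0: "(\<integral>y. z y \<partial>M) = 0" and x: "0 \<le> x" "x \<le> 1"
  shows "T z x = - ((\<integral>t. primitive M L z t \<partial>N) / measure N (space N)) + primitive M L z x"
proof (cases "x = 1")
  case True
  then show ?thesis
    using M.primitive_right_end[OF z, of 1] z0 M.primitive_left_end[of 0 z]
    by (simp add: mean_zero_primitive_def)
next
  case False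
  with x have "frac x = x" by (simp add: frac_eq)
  then show ?thesis by (simp add: mean_zero_primitive_def)
qed

lemma T_left_limit:
  assumes z: "square_integrable M z" and z0: "(\<integral>y. z y \<partial>M) = 0" and x: "0 < x" "x \<le> 1"
  shows "(T z \<longlongrightarrow> - ((\<integral>t. primitive M L z t \<partial>N) / measure N (space N)) + primitive M lessThan z x) (at_left x)"
proof (rule Lim_transform_eventually)
  let ?c = "- ((\<integral>t. primitive M L z t \<partial>N) / measure N (space N))"
  show "((\<lambda>t. ?c + primitive M L z t) \<longlongrightarrow> ?c + primitive M lessThan z x) (at_left x)"
    by (intro tendsto_add tendsto_const M.primitive_left_limit z)
  show "eventually (\<lambda>t. ?c + primitive M L z t = T z t) (at_left x)"
    using eventually_at_left_real[OF x(1)]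
    by (rule eventually_mono) (use x in \<open>simp add: T_on_unit[OF z z0]\<close>)
qed

lemma T_right_limit:
  assumes z: "square_integrable M z" and z0: "(\<integral>y. z y \<partial>M) = 0" and x: "0 \<le> x" "x < 1"
  shows "(T z \<longlongrightarrow> - ((\<integral>t. primitive M L z t \<partial>N) / measure N (space N)) + primitive M atMost z x) (at_right x)"
proof (rule Lim_transform_eventually)
  let ?c = "- ((\<integral>t. primitive M L z t \<partial>N) / measure N (space N))"
  show "((\<lambda>t. ?c + primitive M L z t) \<longlongrightarrow> ?c + primitive M atMost z x) (at_right x)"
    by (intro tendsto_add tendsto_const M.primitive_right_limit z)
  show "eventually (\<lambda>t. ?c + primitive M L z t = T z t) (at_right x)"
    using eventually_at_right_real[OF x(2)]
    by (rule eventually_mono) (use x in \<open>simp add: T_on_unit[OF z z0]\<close>)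
qed

lemma T_cadlag:
  assumes "square_integrable M z" "(\<integral>y. z y \<partial>M) = 0" and L: "L = atMost"
  shows "cadlag (T z)"
  using T_right_limit[OF assms(1,2)] T_left_limit[OF assms(1,2)] T_on_unit[OF assms(1,2)]
  by (intro periodic_cadlag T_periodic) (auto simp: L)

lemma T_caglad:
  assumes "square_integrable M z" "(\<integral>y. z y \<partial>M) = 0" and L: "L = lessThan"
  shows "caglad (T z)"
  using T_right_limit[OF assms(1,2)] T_left_limit[OF assms(1,2)] T_on_unit[OF assms(1,2)]
  by (intro periodic_caglad T_periodic) (auto simp: L)

end

section \<open>Lateral derivatives\<close>

text \<open>
  The form without quotients survives integration and telescoping.
\<close>

lemma has_left_derivative_iff:
  assumes W: "strict_mono W"
  shows "has_left_derivative W f D x \<longleftrightarrow>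
    (\<forall>e>0. \<exists>a<x. \<forall>t. a < t \<and> t < x \<longrightarrow> \<bar>f x - f t - D * (W x - W t)\<bar> \<le> e * (W x - W t))"
    (is "_ \<longleftrightarrow> ?R")
proof -
  have quot: "dist ((f (x + (t - x)) - f x) / (W (x + (t - x)) - W x)) D =
      \<bar>f x - f t - D * (W x - W t)\<bar> / (W x - W t)" if "t < x" for t
  proof -
    have pos: "0 < W x - W t" using W that by (simp add: strict_mono_less)
    have "(f t - f x) / (W t - W x) - D = (f x - f t - D * (W x - W t)) / (W x - W t)"
      using pos by (simp add: field_simps)
    then show ?thesis using pos by (simp add: dist_real_def abs_divide)
  qed
  have ev: "eventually P (at_left 0) \<longleftrightarrow> (\<exists>a<x. \<forall>t. a < t \<and> t < x \<longrightarrow> P (t - x))" for P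
  proof -
    have "(\<exists>b<0. \<forall>h>b. h < 0 \<longrightarrow> P h) \<longleftrightarrow> (\<exists>a<x. \<forall>t. a < t \<and> t < x \<longrightarrow> P (t - x))"
    proof
      assume "\<exists>b<0. \<forall>h>b. h < 0 \<longrightarrow> P h"
      then obtain b where "b < 0" "\<And>h. b < h \<Longrightarrow> h < 0 \<Longrightarrow> P h" by blast
      then show "\<exists>a<x. \<forall>t. a < t \<and> t < x \<longrightarrow> P (t - x)"
        by (intro exI[of _ "x + b"]) auto
    next
      assume "\<exists>a<x. \<forall>t. a < t \<and> t < x \<longrightarrow> P (t - x)"
      then obtain a where a: "a < x" "\<And>t. a < t \<Longrightarrow> t < x \<Longrightarrow> P (t - x)" by blast
      have "P h" if "a - x < h" "h < 0" for h
        using a(2)[of "x + h"] that by simp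
      with a(1) show "\<exists>b<0. \<forall>h>b. h < 0 \<longrightarrow> P h"
        by (intro exI[of _ "a - x"]) auto
    qed
    then show ?thesis by (simp add: eventually_at_left_field)
  qed
  have "has_left_derivative W f D x \<longleftrightarrow>
    (\<forall>e>0. \<exists>a<x. \<forall>t. a < t \<and> t < x \<longrightarrow> \<bar>f x - f t - D * (W x - W t)\<bar> / (W x - W t) < e)"
    unfolding has_left_derivative_def tendsto_iff ev using quot by (metis (no_types, lifting))
  also have "\<dots> \<longleftrightarrow> ?R"
  proof (intro iffI allI impI)
    fix e :: real
    assume "0 < e" and *: "\<forall>e>0. \<exists>a<x. \<forall>t. a < t \<and> t < x \<longrightarrow> \<bar>f x - f t - D * (W x - W t)\<bar> / (W x - W t) < e"
    then obtain a where a: "a < x" "\<And>t. a < t \<Longrightarrow> t < x \<Longrightarrow> \<bar>f x - f t - D * (W x - W t)\<bar> / (W x - W t) < e"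
      by blast
    have "\<bar>f x - f t - D * (W x - W t)\<bar> \<le> e * (W x - W t)" if "a < t" "t < x" for t
    proof -
      have "0 < W x - W t" using W that by (simp add: strict_mono_less)
      with a(2)[OF that] show ?thesis by (simp add: pos_divide_less_eq)
    qed
    with a(1) show "\<exists>a<x. \<forall>t. a < t \<and> t < x \<longrightarrow> \<bar>f x - f t - D * (W x - W t)\<bar> \<le> e * (W x - W t)"
      by blast
  next
    fix e :: real
    assume "0 < e" and *: ?R
    then have "0 < e / 2" by simp
    with * obtain a where a: "a < x" "\<And>t. a < t \<Longrightarrow> t < x \<Longrightarrow> \<bar>f x - f t - D * (W x - W t)\<bar> \<le> e / 2 * (W x - W t)"
      by blast
    have "\<bar>f x - f t - D * (W x - W t)\<bar> / (W x - W t) < e" if "a < t" "t < x" for t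
    proof -
      have pos: "0 < W x - W t" using W that by (simp add: strict_mono_less)
      have "e / 2 * (W x - W t) < e * (W x - W t)"
        using pos \<open>0 < e\<close> by simp
      with a(2)[OF that] pos show ?thesis by (simp add: pos_divide_less_eq)
    qed
    with a(1) show "\<exists>a<x. \<forall>t. a < t \<and> t < x \<longrightarrow> \<bar>f x - f t - D * (W x - W t)\<bar> / (W x - W t) < e"
      by blast
  qed
  finally show ?thesis .
qed

lemma has_right_derivative_reflect:
  "has_right_derivative V g D x \<longleftrightarrow>
    has_left_derivative (\<lambda>t. - V (- t)) (\<lambda>t. - g (- t)) D (- x)"
proof -
  have "(- g (x + h) - - g x) / (- V (x + h) - - V x) = (g (x + h) - g x) / (V (x + h) - V x)" for h
    using minus_divide_divide[of "g (x + h) - g x" "V (x + h) - V x"] by simp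
  then show ?thesis
    unfolding has_right_derivative_def has_left_derivative_def filterlim_at_left_to_right
    by (simp add: add.commute)
qed

lemma strict_mono_reflect: "strict_mono V \<Longrightarrow> strict_mono (\<lambda>t::real. - V (- t) :: real)"
  by (simp add: strict_mono_def)

lemma has_right_derivative_iff:
  assumes V: "strict_mono V"
  shows "has_right_derivative V g D x \<longleftrightarrow>
    (\<forall>e>0. \<exists>b>x. \<forall>t. x < t \<and> t < b \<longrightarrow> \<bar>g t - g x - D * (V t - V x)\<bar> \<le> e * (V t - V x))"
    (is "_ \<longleftrightarrow> ?R")
proof -
  have flip: "(\<exists>a<(- x). \<forall>t. a < t \<and> t < - x \<longrightarrow> Q (- t)) \<longleftrightarrow> (\<exists>b>x. \<forall>t. x < t \<and> t < b \<longrightarrow> Q t)"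
    (is "?L \<longleftrightarrow> ?R'") for Q
  proof
    assume ?L
    then obtain a where a: "a < - x" "\<And>t. a < t \<Longrightarrow> t < - x \<Longrightarrow> Q (- t)" by blast
    have "Q t" if "x < t" "t < - a" for t
      using a(2)[of "- t"] that by simp
    with a(1) show ?R' by (intro exI[of _ "- a"]) auto
  next
    assume ?R'
    then obtain b where b: "x < b" "\<And>t. x < t \<Longrightarrow> t < b \<Longrightarrow> Q t" by blast
    have "Q (- t)" if "- b < t" "t < - x" for t
      using b(2)[of "- t"] that by simp
    with b(1) show ?L by (intro exI[of _ "- b"]) auto
  qed
  show ?thesis
    unfolding has_right_derivative_reflect has_left_derivative_iff[OF strict_mono_reflect[OF V]]
      flip[symmetric] by (simp add: algebra_simps)
qed

lemma has_left_derivative_unique: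
  assumes "has_left_derivative W f D x" "has_left_derivative W f E x" shows "D = E"
  using assms unfolding has_left_derivative_def by (intro tendsto_unique[of "at_left (0::real)"]) auto

lemma has_right_derivative_unique:
  assumes "has_right_derivative W f D x" "has_right_derivative W f E x" shows "D = E"
  using assms unfolding has_right_derivative_def by (intro tendsto_unique[of "at_right (0::real)"]) auto

lemma left_deriv_eq: "has_left_derivative W f D x \<Longrightarrow> left_deriv W f x = D"
  unfolding left_deriv_def by (rule the_equality) (auto intro: has_left_derivative_unique)

lemma right_deriv_eq: "has_right_derivative V f D x \<Longrightarrow> right_deriv V f x = D"
  unfolding right_deriv_def by (rule the_equality) (auto intro: has_right_derivative_unique)

lemma left_deriv_works: "left_differentiable W f \<Longrightarrow> has_left_derivative W f (left_deriv W f x) x"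
  using left_deriv_eq unfolding left_differentiable_def by metis

lemma right_deriv_works: "right_differentiable V f \<Longrightarrow> has_right_derivative V f (right_deriv V f x) x"
  using right_deriv_eq unfolding right_differentiable_def by metis

lemma has_left_derivative_diff:
  assumes "has_left_derivative W f D x" "has_left_derivative W g E x"
  shows "has_left_derivative W (\<lambda>t. f t - g t) (D - E) x"
  using tendsto_diff[OF assms[unfolded has_left_derivative_def]]
  unfolding has_left_derivative_def by (simp add: algebra_simps flip: diff_divide_distrib)

lemma has_right_derivative_diff:
  assumes "has_right_derivative W f D x" "has_right_derivative W g E x"
  shows "has_right_derivative W (\<lambda>t. f t - g t) (D - E) x"
  using tendsto_diff[OF assms[unfolded has_right_derivative_def]]
  unfolding has_right_derivative_def by (simp add: algebra_simps flip: diff_divide_distrib)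

lemma has_left_derivative_shift_const:
  "has_left_derivative W (\<lambda>t. c + f t) D x \<longleftrightarrow> has_left_derivative W f D x"
  unfolding has_left_derivative_def by simp

lemma has_right_derivative_shift_const:
  "has_right_derivative W (\<lambda>t. c + f t) D x \<longleftrightarrow> has_right_derivative W f D x"
  unfolding has_right_derivative_def by simp

text \<open>
  For each \<open>e\<close> the bound \<open>\<bar>q b - q t\<bar> \<le> e (W b - W t)\<close> is propagated from \<open>b\<close> to the left.  At the
  infimum of the points reached so far it persists by right continuity, and beyond that infimum it
  continues because the left derivative there is zero; so the infimum can only be \<open>a\<close>.
\<close>

lemma left_derivative_zero_imp_eq:
  assumes W: "strict_mono W" and "a \<le> b"
    and cont: "\<And>x. a \<le> x \<Longrightarrow> x < b \<Longrightarrow> (W \<longlongrightarrow> W x) (at_right x) \<and> (q \<longlongrightarrow> q x) (at_right x)"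
    and zero: "\<And>x. a < x \<Longrightarrow> x \<le> b \<Longrightarrow> has_left_derivative W q 0 x"
  shows "q a = q b"
proof (cases "a = b")
  case False
  with \<open>a \<le> b\<close> have "a < b" by simp
  have key: "\<bar>q b - q a\<bar> \<le> e * (W b - W a)" if "e > 0" for e
  proof -
    \<comment> \<open>The points down to which the bound has been established.\<close>
    define S where "S = {s. a \<le> s \<and> s \<le> b \<and> (\<forall>t. s \<le> t \<and> t \<le> b \<longrightarrow> \<bar>q b - q t\<bar> \<le> e * (W b - W t))}"
    have "b \<in> S"
    proof -
      have "\<bar>q b - q t\<bar> \<le> e * (W b - W t)" if "b \<le> t \<and> t \<le> b" for t
        using that by (metis abs_zero antisym diff_self mult_zero_right order_refl)
      then show ?thesis using \<open>a \<le> b\<close> by (auto simp: S_def)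
    qed
    define s where "s = Inf S"
    have bdd: "bdd_below S" by (rule bdd_belowI[of _ a]) (auto simp: S_def)
    have "a \<le> s" unfolding s_def using \<open>b \<in> S\<close> by (intro cInf_greatest) (auto simp: S_def)
    have "s \<le> b" unfolding s_def using \<open>b \<in> S\<close> bdd by (rule cInf_lower)
    have above: "\<bar>q b - q t\<bar> \<le> e * (W b - W t)" if "s < t" "t \<le> b" for t
    proof -
      obtain r where "r \<in> S" "r < t"
        using \<open>s < t\<close> \<open>b \<in> S\<close> cInf_lessD[of S t] unfolding s_def by blast
      with that show ?thesis by (auto simp: S_def)
    qed
    have at_s: "\<bar>q b - q s\<bar> \<le> e * (W b - W s)"
    proof (cases "s = b")
      case False
      with \<open>s \<le> b\<close> have "s < b" by simp
      show ?thesis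
      proof (rule tendsto_le[OF trivial_limit_at_right_real])
        show "((\<lambda>t. e * (W b - W t)) \<longlongrightarrow> e * (W b - W s)) (at_right s)"
          "((\<lambda>t. \<bar>q b - q t\<bar>) \<longlongrightarrow> \<bar>q b - q s\<bar>) (at_right s)"
          using cont[OF \<open>a \<le> s\<close> \<open>s < b\<close>] by (auto intro!: tendsto_intros)
        show "eventually (\<lambda>t. \<bar>q b - q t\<bar> \<le> e * (W b - W t)) (at_right s)"
          using eventually_at_right_real[OF \<open>s < b\<close>] by (rule eventually_mono) (auto intro: above)
      qed
    qed simp
    have "s = a"
    proof (rule ccontr)
      assume "s \<noteq> a"
      with \<open>a \<le> s\<close> have "a < s" by simp
      then obtain c where c: "c < s"
        "\<And>t. c < t \<Longrightarrow> t < s \<Longrightarrow> \<bar>q s - q t - 0 * (W s - W t)\<bar> \<le> e * (W s - W t)"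
        using zero[OF _ \<open>s \<le> b\<close>] \<open>e > 0\<close> unfolding has_left_derivative_iff[OF W] by blast
      define r where "r = (max a c + s) / 2"
      have r: "a \<le> r" "c < r" "r < s" using c(1) \<open>a < s\<close> by (auto simp: r_def max_def)
      have "\<bar>q b - q t\<bar> \<le> e * (W b - W t)" if t: "r \<le> t \<and> t \<le> b" for t
      proof (cases t s rule: linorder_cases)
        case less
        have "\<bar>q s - q t\<bar> \<le> e * (W s - W t)" using c(2)[of t] less t r by simp
        with at_s show ?thesis by (simp add: algebra_simps)
      next
        case equal
        then show ?thesis using at_s by simp
      next
        case greater
        then show ?thesis using above t by blast
      qed
      then have "r \<in> S" using r \<open>s \<le> b\<close> by (auto simp: S_def)
      then have "s \<le> r" unfolding s_def using bdd by (rule cInf_lower)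
      with r show False by simp
    qed
    with at_s show ?thesis by simp
  qed
  have pos: "0 < W b - W a" using W \<open>a < b\<close> by (simp add: strict_mono_less)
  have "\<bar>q b - q a\<bar> \<le> 0"
  proof (rule field_le_epsilon)
    fix e :: real assume "0 < e"
    with key[of "e / (W b - W a)"] pos show "\<bar>q b - q a\<bar> \<le> 0 + e" by simp
  qed
  then show ?thesis by simp
qed simp

lemma right_derivative_zero_imp_eq:
  assumes V: "strict_mono V" and "a \<le> b"
    and cont: "\<And>x. a < x \<Longrightarrow> x \<le> b \<Longrightarrow> (V \<longlongrightarrow> V x) (at_left x) \<and> (q \<longlongrightarrow> q x) (at_left x)"
    and zero: "\<And>x. a \<le> x \<Longrightarrow> x < b \<Longrightarrow> has_right_derivative V q 0 x"
  shows "q a = q b"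
proof -
  have "- q (- (- b)) = - q (- (- a))"
  proof (rule left_derivative_zero_imp_eq[OF strict_mono_reflect[OF V], of "- b" "- a" "\<lambda>t. - q (- t)"])
    fix x assume "- b \<le> x" "x < - a"
    with cont[of "- x"] show "((\<lambda>t. - V (- t)) \<longlongrightarrow> - V (- x)) (at_right x) \<and>
        ((\<lambda>t. - q (- t)) \<longlongrightarrow> - q (- x)) (at_right x)"
      by (auto simp: filterlim_at_left_to_right intro!: tendsto_minus)
  next
    fix x assume "- b < x" "x \<le> - a"
    with zero[of "- x"] show "has_left_derivative (\<lambda>t. - V (- t)) (\<lambda>t. - q (- t)) 0 x"
      by (simp add: has_right_derivative_reflect)
  qed (use \<open>a \<le> b\<close> in simp)
  then show ?thesis by simp
qed

lemma D_space_diff: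
  assumes u: "u \<in> D_space W V" and v: "v \<in> D_space W V"
  shows "(\<lambda>x. u x - v x) \<in> D_space W V"
    and "left_deriv W (\<lambda>x. u x - v x) = (\<lambda>x. left_deriv W u x - left_deriv W v x)"
proof -
  have der: "has_left_derivative W (\<lambda>x. u x - v x) (left_deriv W u x - left_deriv W v x) x" for x
    using u v by (intro has_left_derivative_diff left_deriv_works) (auto simp: D_space_def)
  then show eq: "left_deriv W (\<lambda>x. u x - v x) = (\<lambda>x. left_deriv W u x - left_deriv W v x)"
    by (intro ext left_deriv_eq)
  have der2: "has_right_derivative V (\<lambda>x. left_deriv W u x - left_deriv W v x)
     (right_deriv V (left_deriv W u) x - right_deriv V (left_deriv W v) x) x" for x
    using u v by (intro has_right_derivative_diff right_deriv_works) (auto simp: D_space_def)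
  then have eq2: "right_deriv V (\<lambda>x. left_deriv W u x - left_deriv W v x) =
     (\<lambda>x. right_deriv V (left_deriv W u) x - right_deriv V (left_deriv W v) x)"
    by (intro ext right_deriv_eq)
  show "(\<lambda>x. u x - v x) \<in> D_space W V"
    using u v der der2 unfolding D_space_def mem_Collect_eq eq eq2
    by (auto intro: cadlag_diff caglad_diff simp: periodic_def left_differentiable_def right_differentiable_def)
qed

section \<open>The measures of the two weights\<close>

locale circle_weights =
  fixes W V :: "real \<Rightarrow> real"
  assumes W_mono: "strict_mono W" and V_mono: "strict_mono V"
    and W_cadlag: "cadlag W" and V_caglad: "caglad V"
    and W_step: "\<And>x. W (x + 1) - W x = W 1 - W 0"
    and V_step: "\<And>x. V (x + 1) - V x = V 1 - V 0"
    and W_cont0: "isCont W 0" and V_cont0: "isCont V 0"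
begin

abbreviation "PW \<equiv> primitive (dW W) atMost"
abbreviation "PV \<equiv> primitive (dV V) lessThan"

lemma W_right: "(W \<longlongrightarrow> W x) (at_right x)"
  using W_cadlag by (simp add: cadlag_def continuous_within)

lemma V_left: "(V \<longlongrightarrow> V x) (at_left x)"
  using V_caglad by (simp add: caglad_def continuous_within)

lemma W_less: "x < y \<Longrightarrow> W x < W y" and V_less: "x < y \<Longrightarrow> V x < V y"
  using W_mono V_mono by (auto simp: strict_mono_less)

lemma W_le: "x \<le> y \<Longrightarrow> W x \<le> W y" and V_le: "x \<le> y \<Longrightarrow> V x \<le> V y"
  using W_mono V_mono by (auto simp: strict_mono_less_eq)

text \<open>
  Removing the linear part leaves a periodic function.
\<close>

lemma W_diff_shift: "W (x + of_int n) - W (y + of_int n) = W x - W y"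
proof -
  have "periodic (\<lambda>x. W x - x * (W 1 - W 0))"
    using W_step by (auto simp: periodic_def algebra_simps)
  from periodic_shift[OF this, of x n] periodic_shift[OF this, of y n]
  show ?thesis by (simp add: algebra_simps)
qed

lemma V_diff_shift: "V (x + of_int n) - V (y + of_int n) = V x - V y"
proof -
  have "periodic (\<lambda>x. V x - x * (V 1 - V 0))"
    using V_step by (auto simp: periodic_def algebra_simps)
  from periodic_shift[OF this, of x n] periodic_shift[OF this, of y n]
  show ?thesis by (simp add: algebra_simps)
qed

lemma space_dW: "space (dW W) = {0<..1}" and space_dV: "space (dV V) = {0..<1}"
  by (simp_all add: dW_def dV_def space_restrict_space)

lemma finite_dW: "finite_measure (dW W)"
proof
  show "emeasure (dW W) (space (dW W)) \<noteq> \<infinity>"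
    using emeasure_dW[OF W_mono W_cadlag, of 0 1] by (simp add: space_dW)
qed

lemma finite_dV: "finite_measure (dV V)"
proof
  show "emeasure (dV V) (space (dV V)) \<noteq> \<infinity>"
    using emeasure_dV[OF V_mono V_caglad, of 0 1] by (simp add: space_dV)
qed

lemma ident_dW: "(\<lambda>x. x) \<in> borel_measurable (dW W)"
  unfolding dW_def by (intro measurable_restrict_space1 measurable_ident_sets) simp

lemma ident_dV: "(\<lambda>x. x) \<in> borel_measurable (dV V)"
  unfolding dV_def by (intro measurable_restrict_space1 measurable_ident_sets) simp

lemma sets_dW: "A \<subseteq> {0<..1} \<Longrightarrow> A \<in> sets borel \<Longrightarrow> A \<in> sets (dW W)"
  by (simp add: dW_def sets_restrict_space_iff)

lemma sets_dV: "A \<subseteq> {0..<1} \<Longrightarrow> A \<in> sets borel \<Longrightarrow> A \<in> sets (dV V)"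
  by (simp add: dV_def sets_restrict_space_iff)

lemma measure_dW: "0 \<le> a \<Longrightarrow> a \<le> b \<Longrightarrow> b \<le> 1 \<Longrightarrow> measure (dW W) {a<..b} = W b - W a"
  using emeasure_dW[OF W_mono W_cadlag] W_le by (simp add: measure_def)

lemma measure_dV: "0 \<le> a \<Longrightarrow> a \<le> b \<Longrightarrow> b \<le> 1 \<Longrightarrow> measure (dV V) {a..<b} = V b - V a"
  using emeasure_dV[OF V_mono V_caglad] V_le by (simp add: measure_def)

lemma W_left_at_1: "(W \<longlongrightarrow> W 1) (at_left 1)"
proof -
  have "(W \<longlongrightarrow> W 0) (at_left 0)"
    using W_cont0 unfolding isCont_def filterlim_at_split by blast
  then have "((\<lambda>t. W t + (W 1 - W 0)) \<longlongrightarrow> W 0 + (W 1 - W 0)) (at_left 0)"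
    by (intro tendsto_add tendsto_const)
  also have "(\<lambda>t. W t + (W 1 - W 0)) = (\<lambda>t. W (t + 1))"
    using W_step by (auto simp: algebra_simps)
  finally have "((\<lambda>t. W (t + 1)) \<longlongrightarrow> W 1) (at_left 0)" by simp
  from filterlim_compose[OF this filterlim_shift_left[of "- 1" 1, simplified]]
  show ?thesis by simp
qed

lemma V_right_at_0: "(V \<longlongrightarrow> V 0) (at_right 0)"
  using V_cont0 unfolding isCont_def filterlim_at_split by blast

sublocale W: circle_measure "dW W" atMost
proof (intro circle_measure.intro borel_finite_measure.intro finite_dW
    borel_finite_measure_axioms.intro ident_dW circle_measure_axioms.intro)
  interpret finite_measure "dW W" by (rule finite_dW)
  have "measure (dW W) {1} \<le> 0"
  proof (rule tendsto_lowerbound[OF _ _ trivial_limit_at_left_real])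
    show "((\<lambda>a. W 1 - W a) \<longlongrightarrow> 0) (at_left 1)"
      using tendsto_diff[OF tendsto_const W_left_at_1, of "W 1"] by simp
    show "eventually (\<lambda>a. measure (dW W) {1} \<le> W 1 - W a) (at_left 1)"
      using eventually_at_left_real[of 0 "1::real", OF zero_less_one]
    proof (rule eventually_mono)
      fix a :: real assume a: "a \<in> {0<..<1}"
      have "measure (dW W) {1} \<le> measure (dW W) {a<..1}"
        using a by (intro finite_measure_mono sets_dW) auto
      also have "\<dots> = W 1 - W a"
        using a by (intro measure_dW) auto
      finally show "measure (dW W) {1} \<le> W 1 - W a" .
    qed
  qed
  then have "emeasure (dW W) {1} = 0"
    by (simp add: emeasure_eq_measure measure_le_0_iff)
  then have "{1} \<in> null_sets (dW W)"
    by (intro null_setsI sets_dW) auto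
  from AE_not_in[OF this] AE_space[of "dW W"]
  show "AE x in dW W. 0 < x \<and> x < 1"
    by eventually_elim (auto simp: space_dW)
  fix a b :: real assume ab: "0 \<le> a" "a < b" "b \<le> 1"
  have "0 < W ((a + b) / 2) - W a"
    using W_less[of a "(a + b) / 2"] ab by simp
  also have "\<dots> = measure (dW W) {a<..(a + b) / 2}"
    using ab by (intro measure_dW[symmetric]) auto
  also have "\<dots> \<le> measure (dW W) ({a<..<b} \<inter> space (dW W))"
    using ab by (intro finite_measure_mono sets_dW) (auto simp: space_dW)
  finally show "0 < (\<integral>x. indicator {a<..<b} x \<partial>dW W :: real)"
    by simp
qed simp

sublocale V: circle_measure "dV V" lessThan
proof (intro circle_measure.intro borel_finite_measure.intro finite_dV
    borel_finite_measure_axioms.intro ident_dV circle_measure_axioms.intro)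
  interpret finite_measure "dV V" by (rule finite_dV)
  have "measure (dV V) {0} \<le> 0"
  proof (rule tendsto_lowerbound[OF _ _ trivial_limit_at_right_real])
    show "((\<lambda>b. V b - V 0) \<longlongrightarrow> 0) (at_right 0)"
      using tendsto_diff[OF V_right_at_0 tendsto_const, of "V 0"] by simp
    show "eventually (\<lambda>b. measure (dV V) {0} \<le> V b - V 0) (at_right 0)"
      using eventually_at_right_real[of 0 "1::real", OF zero_less_one]
    proof (rule eventually_mono)
      fix b :: real assume b: "b \<in> {0<..<1}"
      have "measure (dV V) {0} \<le> measure (dV V) {0..<b}"
        using b by (intro finite_measure_mono sets_dV) auto
      also have "\<dots> = V b - V 0"
        using b by (intro measure_dV) auto
      finally show "measure (dV V) {0} \<le> V b - V 0" .
    qed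
  qed
  then have "emeasure (dV V) {0} = 0"
    by (simp add: emeasure_eq_measure measure_le_0_iff)
  then have "{0} \<in> null_sets (dV V)"
    by (intro null_setsI sets_dV) auto
  from AE_not_in[OF this] AE_space[of "dV V"]
  show "AE x in dV V. 0 < x \<and> x < 1"
    by eventually_elim (auto simp: space_dV)
  fix a b :: real assume ab: "0 \<le> a" "a < b" "b \<le> 1"
  have "0 < V b - V ((a + b) / 2)"
    using V_less[of "(a + b) / 2" b] ab by simp
  also have "\<dots> = measure (dV V) {(a + b) / 2..<b}"
    using ab by (intro measure_dV[symmetric]) auto
  also have "\<dots> \<le> measure (dV V) ({a<..<b} \<inter> space (dV V))"
    using ab by (intro finite_measure_mono sets_dV) (auto simp: space_dV)
  finally show "0 < (\<integral>x. indicator {a<..<b} x \<partial>dV V :: real)"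
    by simp
qed simp

sublocale WV: circle_pair "dW W" atMost "dV V" lessThan ..
sublocale VW: circle_pair "dV V" lessThan "dW W" atMost ..

section \<open>Differentiation and integration with respect to the weights\<close>

text \<open>
  The difference quotient is the mean of the integrand over \<open>(t, x]\<close>.  Left continuity controls the
  integrand on the interval, and a possible atom at \<open>x\<close> is multiplied by \<open>z x\<close> itself.
\<close>

lemma PW_has_left_derivative:
  assumes z: "bounded_borel z" and zx: "(z \<longlongrightarrow> z x) (at_left x)" and x: "0 < x" "x \<le> 1"
  shows "has_left_derivative W (PW z) (z x) x"
  unfolding has_left_derivative_iff[OF W_mono]
proof (intro allI impI)
  fix e :: real assume "0 < e"
  have sq: "square_integrable (dW W) z" by (rule W.bounded_square_integrable[OF z])
  from tendstoD[OF zx \<open>0 < e\<close>] obtain c where c: "c < x" "\<And>t. c < t \<Longrightarrow> t < x \<Longrightarrow> \<bar>z t - z x\<bar> < e"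
    unfolding eventually_at_left_field dist_real_def by blast
  have "\<bar>PW z x - PW z t - z x * (W x - W t)\<bar> \<le> e * (W x - W t)" if t: "max 0 c < t" "t < x" for t
  proof -
    have ind: "(\<integral>y. indicator {t<..x} y \<partial>dW W) = W x - W t"
      using t x measure_dW[of t x] by (simp add: space_dW Int_absorb2 greaterThanAtMost_subseteq_atLeastAtMost_iff subset_iff)
    have int: "integrable (dW W) (\<lambda>y. z y * indicator {t<..x} y)" "integrable (dW W) (\<lambda>y. indicator {t<..x} y :: real)"
      by (intro W.bounded_integrable bounded_borel_mult z bounded_borel_indicator; simp)+
    have "PW z x - PW z t = (\<integral>y. z y * indicator {..x} y - z y * indicator {..t} y \<partial>dW W)"
      unfolding primitive_def using W.integrable_segment[OF sq] by simp
    also have "\<dots> = (\<integral>y. z y * indicator {t<..x} y \<partial>dW W)"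
      using t by (intro Bochner_Integration.integral_cong) (auto simp: indicator_def)
    finally have "PW z x - PW z t - z x * (W x - W t) =
        (\<integral>y. z y * indicator {t<..x} y \<partial>dW W) - z x * (\<integral>y. indicator {t<..x} y \<partial>dW W)"
      by (simp only: ind)
    also have "\<dots> = (\<integral>y. (z y - z x) * indicator {t<..x} y \<partial>dW W)"
      using int by (simp add: left_diff_distrib)
    also have "\<bar>\<dots>\<bar> \<le> (\<integral>y. e * indicator {t<..x} y \<partial>dW W)"
    proof (rule order_trans[OF integral_abs_bound integral_mono])
      have "integrable (dW W) (\<lambda>y. (z y - z x) * indicator {t<..x} y)"
        by (intro W.bounded_integrable bounded_borel_mult bounded_borel_diff bounded_borel_const
            z bounded_borel_indicator) simp
      then show "integrable (dW W) (\<lambda>y. \<bar>(z y - z x) * indicator {t<..x} y\<bar>)" by simp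
      show "integrable (dW W) (\<lambda>y. e * indicator {t<..x} y)" using int by simp
      show "\<bar>(z y - z x) * indicator {t<..x} y\<bar> \<le> e * indicator {t<..x} y" for y
        using c(2)[of y] t \<open>0 < e\<close> by (cases "y = x") (auto simp: indicator_def less_imp_le)
    qed
    also have "\<dots> = e * (W x - W t)" using ind by simp
    finally show ?thesis .
  qed
  then show "\<exists>a<x. \<forall>t. a < t \<and> t < x \<longrightarrow> \<bar>PW z x - PW z t - z x * (W x - W t)\<bar> \<le> e * (W x - W t)"
    using c(1) x by (intro exI[of _ "max 0 c"]) auto
qed

lemma PV_has_right_derivative:
  assumes z: "bounded_borel z" and zx: "(z \<longlongrightarrow> z x) (at_right x)" and x: "0 \<le> x" "x < 1"
  shows "has_right_derivative V (PV z) (z x) x"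
  unfolding has_right_derivative_iff[OF V_mono]
proof (intro allI impI)
  fix e :: real assume "0 < e"
  have sq: "square_integrable (dV V) z" by (rule V.bounded_square_integrable[OF z])
  from tendstoD[OF zx \<open>0 < e\<close>] obtain c where c: "x < c" "\<And>t. x < t \<Longrightarrow> t < c \<Longrightarrow> \<bar>z t - z x\<bar> < e"
    unfolding eventually_at_right_field dist_real_def by blast
  have "\<bar>PV z t - PV z x - z x * (V t - V x)\<bar> \<le> e * (V t - V x)" if t: "x < t" "t < min 1 c" for t
  proof -
    have ind: "(\<integral>y. indicator {x..<t} y \<partial>dV V) = V t - V x"
      using t x measure_dV[of x t] by (simp add: space_dV Int_absorb2 subset_iff)
    have int: "integrable (dV V) (\<lambda>y. z y * indicator {x..<t} y)" "integrable (dV V) (\<lambda>y. indicator {x..<t} y :: real)"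
      by (intro V.bounded_integrable bounded_borel_mult z bounded_borel_indicator; simp)+
    have "PV z t - PV z x = (\<integral>y. z y * indicator {..<t} y - z y * indicator {..<x} y \<partial>dV V)"
      unfolding primitive_def using V.integrable_segment[OF sq] by simp
    also have "\<dots> = (\<integral>y. z y * indicator {x..<t} y \<partial>dV V)"
      using t by (intro Bochner_Integration.integral_cong) (auto simp: indicator_def)
    finally have "PV z t - PV z x - z x * (V t - V x) =
        (\<integral>y. z y * indicator {x..<t} y \<partial>dV V) - z x * (\<integral>y. indicator {x..<t} y \<partial>dV V)"
      by (simp only: ind)
    also have "\<dots> = (\<integral>y. (z y - z x) * indicator {x..<t} y \<partial>dV V)"
      using int by (simp add: left_diff_distrib)
    also have "\<bar>\<dots>\<bar> \<le> (\<integral>y. e * indicator {x..<t} y \<partial>dV V)"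
    proof (rule order_trans[OF integral_abs_bound integral_mono])
      have "integrable (dV V) (\<lambda>y. (z y - z x) * indicator {x..<t} y)"
        by (intro V.bounded_integrable bounded_borel_mult bounded_borel_diff bounded_borel_const
            z bounded_borel_indicator) simp
      then show "integrable (dV V) (\<lambda>y. \<bar>(z y - z x) * indicator {x..<t} y\<bar>)" by simp
      show "integrable (dV V) (\<lambda>y. e * indicator {x..<t} y)" using int by simp
      show "\<bar>(z y - z x) * indicator {x..<t} y\<bar> \<le> e * indicator {x..<t} y" for y
        using c(2)[of y] t \<open>0 < e\<close> by (cases "y = x") (auto simp: indicator_def less_imp_le)
    qed
    also have "\<dots> = e * (V t - V x)" using ind by simp
    finally show ?thesis .
  qed
  then show "\<exists>b>x. \<forall>t. x < t \<and> t < b \<longrightarrow> \<bar>PV z t - PV z x - z x * (V t - V x)\<bar> \<le> e * (V t - V x)"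
    using c(1) x by (intro exI[of _ "min 1 c"]) auto
qed

lemma has_left_derivative_shift:
  assumes "periodic f"
  shows "has_left_derivative W f D (x + of_int n) \<longleftrightarrow> has_left_derivative W f D x"
proof -
  have "f (x + of_int n + h) = f (x + h)" for h
    using periodic_shift[OF assms, of "x + h" n] by (simp add: algebra_simps)
  moreover have "W (x + of_int n + h) - W (x + of_int n) = W (x + h) - W x" for h
    using W_diff_shift[of "x + h" n x] by (simp add: algebra_simps)
  ultimately show ?thesis
    by (simp add: has_left_derivative_def periodic_shift[OF assms])
qed

lemma has_right_derivative_shift:
  assumes "periodic f"
  shows "has_right_derivative V f D (x + of_int n) \<longleftrightarrow> has_right_derivative V f D x"
proof -
  have "f (x + of_int n + h) = f (x + h)" for h
    using periodic_shift[OF assms, of "x + h" n] by (simp add: algebra_simps)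
  moreover have "V (x + of_int n + h) - V (x + of_int n) = V (x + h) - V x" for h
    using V_diff_shift[of "x + h" n x] by (simp add: algebra_simps)
  ultimately show ?thesis
    by (simp add: has_right_derivative_def periodic_shift[OF assms])
qed

lemma has_left_derivative_T:
  assumes z: "bounded_borel z" "periodic z" "caglad z" and z0: "(\<integral>y. z y \<partial>dW W) = 0"
  shows "has_left_derivative W (WV.T z) (z x) x"
proof -
  have sq: "square_integrable (dW W) z" by (rule W.bounded_square_integrable[OF z(1)])
  obtain n where n: "0 < x + of_int n" "x + of_int n \<le> 1"
    using shift_into_unit_right by blast
  let ?y = "x + of_int n" and ?c = "- ((\<integral>t. PW z t \<partial>dV V) / measure (dV V) (space (dV V)))"
  have "has_left_derivative W (\<lambda>t. ?c + PW z t) (z ?y) ?y"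
    unfolding has_left_derivative_shift_const
    using z(3) n by (intro PW_has_left_derivative z(1)) (auto simp: caglad_def continuous_within)
  then have "has_left_derivative W (WV.T z) (z ?y) ?y"
    unfolding has_left_derivative_def
  proof (rule Lim_transform_eventually)
    show "eventually (\<lambda>h. (?c + PW z (?y + h) - (?c + PW z ?y)) / (W (?y + h) - W ?y) =
        (WV.T z (?y + h) - WV.T z ?y) / (W (?y + h) - W ?y)) (at_left 0)"
      using eventually_at_left_real[of "- ?y" 0]  n
      by (auto elim!: eventually_mono simp: WV.T_on_unit[OF sq z0])
  qed
  then show ?thesis
    by (simp add: has_left_derivative_shift[OF WV.T_periodic] periodic_shift[OF z(2)])
qed

lemma has_right_derivative_T:
  assumes z: "bounded_borel z" "periodic z" "cadlag z" and z0: "(\<integral>y. z y \<partial>dV V) = 0"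
  shows "has_right_derivative V (VW.T z) (z x) x"
proof -
  have sq: "square_integrable (dV V) z" by (rule V.bounded_square_integrable[OF z(1)])
  obtain n where n: "0 \<le> x + of_int n" "x + of_int n < 1"
    using shift_into_unit_left by blast
  let ?y = "x + of_int n" and ?c = "- ((\<integral>t. PV z t \<partial>dW W) / measure (dW W) (space (dW W)))"
  have "has_right_derivative V (\<lambda>t. ?c + PV z t) (z ?y) ?y"
    unfolding has_right_derivative_shift_const
    using z(3) n by (intro PV_has_right_derivative z(1)) (auto simp: cadlag_def continuous_within)
  then have "has_right_derivative V (VW.T z) (z ?y) ?y"
    unfolding has_right_derivative_def
  proof (rule Lim_transform_eventually)
    show "eventually (\<lambda>h. (?c + PV z (?y + h) - (?c + PV z ?y)) / (V (?y + h) - V ?y) =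
        (VW.T z (?y + h) - VW.T z ?y) / (V (?y + h) - V ?y)) (at_right 0)"
      using eventually_at_right_real[of 0 "1 - ?y"]  n
      by (auto elim!: eventually_mono simp: VW.T_on_unit[OF sq z0])
  qed
  then show ?thesis
    by (simp add: has_right_derivative_shift[OF VW.T_periodic] periodic_shift[OF z(2)])
qed

text \<open>
  The difference of \<open>u\<close> and the primitive of its derivative is cadlag with zero left derivative.
\<close>

lemma left_fundamental_theorem:
  assumes u: "cadlag u" and F: "bounded_borel F" "caglad F"
    and der: "\<And>x. has_left_derivative W u (F x) x" and b: "0 \<le> b" "b \<le> 1"
  shows "u b = u 0 + PW F b"
proof -
  have sq: "square_integrable (dW W) F" by (rule W.bounded_square_integrable[OF F(1)])
  have "u 0 - PW F 0 = u b - PW F b"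
  proof (rule left_derivative_zero_imp_eq[OF W_mono b(1), of "\<lambda>x. u x - PW F x"])
    fix x
    have "(u \<longlongrightarrow> u x) (at_right x)" using u by (simp add: cadlag_def continuous_within)
    then show "(W \<longlongrightarrow> W x) (at_right x) \<and> ((\<lambda>x. u x - PW F x) \<longlongrightarrow> u x - PW F x) (at_right x)"
      by (intro conjI W_right tendsto_diff W.primitive_right_limit sq)
    assume "0 < x" "x \<le> b"
    then have "has_left_derivative W (PW F) (F x) x"
      using F(2) b by (intro PW_has_left_derivative F(1)) (auto simp: caglad_def continuous_within)
    from has_left_derivative_diff[OF der this]
    show "has_left_derivative W (\<lambda>x. u x - PW F x) 0 x" by simp
  qed
  then show ?thesis by (simp add: W.primitive_left_end)
qed

lemma right_fundamental_theorem:
  assumes g: "caglad g" and G: "bounded_borel G" "cadlag G"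
    and der: "\<And>x. has_right_derivative V g (G x) x" and b: "0 \<le> b" "b \<le> 1"
  shows "g b = g 0 + PV G b"
proof -
  have sq: "square_integrable (dV V) G" by (rule V.bounded_square_integrable[OF G(1)])
  have "g 0 - PV G 0 = g b - PV G b"
  proof (rule right_derivative_zero_imp_eq[OF V_mono b(1), of "\<lambda>x. g x - PV G x"])
    fix x
    have "(g \<longlongrightarrow> g x) (at_left x)" using g by (simp add: caglad_def continuous_within)
    then show "(V \<longlongrightarrow> V x) (at_left x) \<and> ((\<lambda>x. g x - PV G x) \<longlongrightarrow> g x - PV G x) (at_left x)"
      by (intro conjI V_left tendsto_diff V.primitive_left_limit sq)
    assume "0 \<le> x" "x < b"
    then have "has_right_derivative V (PV G) (G x) x"
      using G(2) b by (intro PV_has_right_derivative G(1)) (auto simp: cadlag_def continuous_within)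
    from has_right_derivative_diff[OF der this]
    show "has_right_derivative V (\<lambda>x. g x - PV G x) 0 x" by simp
  qed
  then show ?thesis by (simp add: V.primitive_left_end)
qed

text \<open>
  The square is cut along the diagonal: \<open>PW\<close> collects the region \<open>y \<le> x\<close> and \<open>PV\<close> the complementary
  region \<open>x < y\<close>, so common atoms are counted exactly once.
\<close>

lemma integration_by_parts:
  assumes F: "square_integrable (dW W) F" and G: "square_integrable (dV V) G"
  shows "(\<integral>x. PW F x * G x \<partial>dV V) + (\<integral>y. F y * PV G y \<partial>dW W) = (\<integral>y. F y \<partial>dW W) * (\<integral>x. G x \<partial>dV V)"
proof -
  interpret P: pair_sigma_finite "dV V" "dW W" ..
  define k where "k x y = (G x * F y) * indicator {..x} y" for x y :: real
  have fst: "(\<lambda>p. fst p) \<in> borel_measurable (dV V \<Otimes>\<^sub>M dW W)"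
    using measurable_compose[OF measurable_fst V.ident] .
  have snd: "(\<lambda>p. snd p) \<in> borel_measurable (dV V \<Otimes>\<^sub>M dW W)"
    using measurable_compose[OF measurable_snd W.ident] .
  have "(\<lambda>p. G (fst p)) \<in> borel_measurable (dV V \<Otimes>\<^sub>M dW W)"
    "(\<lambda>p. F (snd p)) \<in> borel_measurable (dV V \<Otimes>\<^sub>M dW W)"
    using F G by (auto simp: square_integrable_def intro: measurable_compose[OF fst] measurable_compose[OF snd])
  then have "(\<lambda>p. if snd p \<le> fst p then G (fst p) * F (snd p) else 0) \<in> borel_measurable (dV V \<Otimes>\<^sub>M dW W)"
    by (intro measurable_If borel_measurable_times borel_measurable_const borel_measurable_le fst snd)
  also have "(\<lambda>p. if snd p \<le> fst p then G (fst p) * F (snd p) else 0) = case_prod k"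
    by (auto simp: k_def indicator_def)
  finally have meas: "case_prod k \<in> borel_measurable (dV V \<Otimes>\<^sub>M dW W)" .
  have inner: "(\<integral>y. k x y \<partial>dW W) = G x * PW F x" for x
    unfolding k_def primitive_def by (simp add: mult.assoc)
  have absF: "square_integrable (dW W) (\<lambda>y. \<bar>F y\<bar>)"
    using F by (auto simp: square_integrable_def)
  have absG: "square_integrable (dV V) (\<lambda>y. \<bar>G y\<bar>)"
    using G by (auto simp: square_integrable_def)
  have "integrable (dV V \<Otimes>\<^sub>M dW W) (case_prod k)"
  proof (rule P.Fubini_integrable[OF meas])
    have "(\<integral>y. norm (case (x, y) of (x, y) \<Rightarrow> k x y) \<partial>dW W) = \<bar>G x\<bar> * PW (\<lambda>y. \<bar>F y\<bar>) x" for x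
      unfolding k_def primitive_def by (simp add: abs_mult mult.assoc)
    moreover have "integrable (dV V) (\<lambda>x. \<bar>G x\<bar> * PW (\<lambda>y. \<bar>F y\<bar>) x)"
      by (intro V.square_integrable_product absG V.bounded_square_integrable
          W.primitive_bounded_borel absF)
    ultimately show "integrable (dV V) (\<lambda>x. \<integral>y. norm (case (x, y) of (x, y) \<Rightarrow> k x y) \<partial>dW W)"
      by simp
    show "AE x in dV V. integrable (dW W) (\<lambda>y. case (x, y) of (x, y) \<Rightarrow> k x y)"
      using W.integrable_segment[OF F] by (auto simp: k_def mult.assoc)
  qed
  from P.Fubini_integral[OF this]
  have swap: "(\<integral>y. (\<integral>x. k x y \<partial>dV V) \<partial>dW W) = (\<integral>x. G x * PW F x \<partial>dV V)"
    by (simp add: inner)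
  have outer: "(\<integral>x. k x y \<partial>dV V) = F y * ((\<integral>x. G x \<partial>dV V) - PV G y)" for y
  proof -
    have "(\<integral>x. k x y \<partial>dV V) = (\<integral>x. F y * (G x - G x * indicator {..<y} x) \<partial>dV V)"
      by (intro Bochner_Integration.integral_cong) (auto simp: k_def indicator_def)
    also have "\<dots> = F y * ((\<integral>x. G x \<partial>dV V) - PV G y)"
      using V.integrable_segment[OF G] V.square_integrable_integrable[OF G] by (simp add: primitive_def)
    finally show ?thesis .
  qed
  have "(\<integral>x. G x * PW F x \<partial>dV V) = (\<integral>y. F y * (\<integral>x. G x \<partial>dV V) - F y * PV G y \<partial>dW W)"
    unfolding swap[symmetric] outer by (simp add: right_diff_distrib)
  also have "\<dots> = (\<integral>y. F y \<partial>dW W) * (\<integral>x. G x \<partial>dV V) - (\<integral>y. F y * PV G y \<partial>dW W)"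
    using W.square_integrable_integrable[OF F]
      W.square_integrable_product[OF F W.bounded_square_integrable[OF V.primitive_bounded_borel[OF G]]]
    by simp
  finally show ?thesis by (simp add: mult.commute)
qed

end

section \<open>Test functions\<close>

context circle_weights begin

text \<open>
  Going up the sequence integrates and going down differentiates.  The even terms live on the \<open>W\<close> side
  (caglad, mean zero for \<open>dW\<close>) and the odd ones on the \<open>V\<close> side, as the iterated derivatives of a test
  function do.
\<close>

definition smooth_chain :: "(nat \<Rightarrow> real \<Rightarrow> real) \<Rightarrow> bool" where
  "smooth_chain X \<longleftrightarrow> (\<forall>n. bounded_borel (X n)) \<and>
     (\<forall>n. X n = (if even n then VW.T else WV.T) (X (Suc n)))"

lemma smooth_chain_side:
  assumes "smooth_chain X"
  shows smooth_chain_bounded: "bounded_borel (X n)"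
    and "periodic (X n)"
    and "even n \<Longrightarrow> (\<integral>x. X n x \<partial>dW W) = 0"
    and "odd n \<Longrightarrow> (\<integral>x. X n x \<partial>dV V) = 0"
proof -
  have b: "bounded_borel (X n)" and eq: "X n = (if even n then VW.T else WV.T) (X (Suc n))" for n
    using assms unfolding smooth_chain_def by blast+
  show "bounded_borel (X n)" by (rule b)
  show "periodic (X n)"
    by (subst eq) (simp add: WV.T_periodic VW.T_periodic)
  show "even n \<Longrightarrow> (\<integral>x. X n x \<partial>dW W) = 0"
    by (subst eq) (simp add: VW.T_mean V.bounded_square_integrable b)
  show "odd n \<Longrightarrow> (\<integral>x. X n x \<partial>dV V) = 0"
    by (subst eq) (simp add: WV.T_mean W.bounded_square_integrable b)
qed

lemma smooth_chain_regular:
  assumes X: "smooth_chain X"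
  shows "even n \<Longrightarrow> caglad (X n)" "odd n \<Longrightarrow> cadlag (X n)"
proof -
  have eq: "X n = (if even n then VW.T else WV.T) (X (Suc n))"
    using X unfolding smooth_chain_def by blast
  show "caglad (X n)" if "even n"
    unfolding eq using that
    by (auto intro!: VW.T_caglad V.bounded_square_integrable simp: smooth_chain_side[OF X])
  show "cadlag (X n)" if "odd n"
    unfolding eq using that
    by (auto intro!: WV.T_cadlag W.bounded_square_integrable simp: smooth_chain_side[OF X])
qed

lemma smooth_chain_derivative:
  assumes X: "smooth_chain X"
  shows "even n \<Longrightarrow> has_right_derivative V (X n) (X (Suc n) x) x"
    and "odd n \<Longrightarrow> has_left_derivative W (X n) (X (Suc n) x) x"
proof -
  have eq: "X n = (if even n then VW.T else WV.T) (X (Suc n))"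
    using X unfolding smooth_chain_def by blast
  show "has_right_derivative V (X n) (X (Suc n) x) x" if "even n"
    unfolding eq using that
    by (auto intro!: has_right_derivative_T simp: smooth_chain_side[OF X] smooth_chain_regular[OF X])
  show "has_left_derivative W (X n) (X (Suc n) x) x" if "odd n"
    unfolding eq using that
    by (auto intro!: has_left_derivative_T simp: smooth_chain_side[OF X] smooth_chain_regular[OF X])
qed

lemma smooth_chain_test_function:
  assumes X: "smooth_chain X"
  shows "X 0 \<in> C_inf_zero V W"
proof -
  have iter: "iter_deriv V W (X 0) n = X n" for n
  proof (induction n)
    case (Suc n)
    show ?case
      using smooth_chain_derivative[OF X, of n] by (auto simp: Suc intro!: ext right_deriv_eq left_deriv_eq)
  qed simp
  show ?thesis
    unfolding C_inf_zero_def mem_Collect_eq iter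
  proof
    fix n
    show "if even n then X n \<in> C1 W \<and> right_differentiable V (X n)
      else X n \<in> C0 V \<and> left_differentiable W (X n)"
    proof (cases "even n")
      case True
      have "right_differentiable V (X n)"
        unfolding right_differentiable_def using smooth_chain_derivative(1)[OF X True] by blast
      with True show ?thesis
        using smooth_chain_side[OF X, of n] smooth_chain_regular[OF X, of n] by (simp add: C1_def)
    next
      case False
      have "left_differentiable W (X n)"
        unfolding left_differentiable_def using smooth_chain_derivative(2)[OF X False] by blast
      with False show ?thesis
        using smooth_chain_side[OF X, of n] smooth_chain_regular[OF X, of n] by (simp add: C0_def)
    qed
  qed
qed

lemma C_inf_zero_subset: "C_inf_zero V W \<subseteq> C_inf V W"
  unfolding C_inf_def by (auto intro: exI[of _ 0])

lemma smooth_chain_dense_dW: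
  assumes y: "square_integrable (dW W) y" "(\<integral>x. y x \<partial>dW W) = 0" and e: "0 < e"
  obtains X where "smooth_chain X" "(\<integral>x. (y x - X 0 x)\<^sup>2 \<partial>dW W) < e"
proof -
  from VW.smooth_chain_dense[OF y e] obtain X where X: "\<And>n. bounded_borel (X n)"
    "\<And>n. even n \<Longrightarrow> X n = VW.T (X (Suc n))" "\<And>n. odd n \<Longrightarrow> X n = WV.T (X (Suc n))"
    and lt: "(\<integral>x. (y x - X 0 x)\<^sup>2 \<partial>dW W) < e"
    by blast
  have "X n = (if even n then VW.T else WV.T) (X (Suc n))" for n
  proof (cases "even n")
    case True
    then show ?thesis unfolding if_P[OF True] by (rule X(2))
  next
    case False
    then show ?thesis unfolding if_not_P[OF False] by (rule X(3))
  qed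
  with X(1) have "smooth_chain X" unfolding smooth_chain_def by blast
  with lt show ?thesis using that by blast
qed

text \<open>
  A sequence starting on the \<open>V\<close> side becomes a chain after integrating its first term once more.
\<close>

lemma smooth_chain_dense_dV:
  assumes y: "square_integrable (dV V) y" "(\<integral>x. y x \<partial>dV V) = 0" and e: "0 < e"
  obtains X where "smooth_chain X" "(\<integral>x. (y x - X 1 x)\<^sup>2 \<partial>dV V) < e"
proof -
  from WV.smooth_chain_dense[OF y e] obtain X where X: "\<And>n. bounded_borel (X n)"
    "\<And>n. even n \<Longrightarrow> X n = WV.T (X (Suc n))" "\<And>n. odd n \<Longrightarrow> X n = VW.T (X (Suc n))"
    and lt: "(\<integral>x. (y x - X 0 x)\<^sup>2 \<partial>dV V) < e"
    by blast
  define Z where "Z n = (case n of 0 \<Rightarrow> VW.T (X 0) | Suc k \<Rightarrow> X k)" for n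
  have "smooth_chain Z"
    unfolding smooth_chain_def
  proof (intro conjI allI)
    fix n
    show "bounded_borel (Z n)"
      using X(1) by (auto simp: Z_def intro!: VW.T_bounded_borel V.bounded_square_integrable split: nat.split)
    show "Z n = (if even n then VW.T else WV.T) (Z (Suc n))"
    proof (cases n)
      case (Suc k)
      have "X k = (if even k then WV.T else VW.T) (X (Suc k))"
      proof (cases "even k")
        case True
        then show ?thesis unfolding if_P[OF True] by (rule X(2))
      next
        case False
        then show ?thesis unfolding if_not_P[OF False] by (rule X(3))
      qed
      then show ?thesis
        unfolding Suc Z_def nat.case even_Suc by (cases "even k") simp_all
    qed (simp add: Z_def)
  qed
  with lt show ?thesis using that[of Z] by (simp add: Z_def)
qed

text \<open>
  Integration by parts without boundary terms.  Since the integrands have mean zero, the constants of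
  integration drop out.
\<close>

lemma primitives_pairing:
  assumes F: "square_integrable (dW W) F" "(\<integral>y. F y \<partial>dW W) = 0"
    and G: "square_integrable (dV V) G" "(\<integral>x. G x \<partial>dV V) = 0"
    and u: "bounded_borel u" "\<And>x. 0 \<le> x \<Longrightarrow> x \<le> 1 \<Longrightarrow> u x = c + PW F x"
    and g: "bounded_borel g" "\<And>x. 0 \<le> x \<Longrightarrow> x \<le> 1 \<Longrightarrow> g x = d + PV G x"
  shows "(\<integral>x. u x * G x \<partial>dV V) = - (\<integral>y. F y * g y \<partial>dW W)"
proof -
  have iPW: "integrable (dV V) (\<lambda>x. PW F x * G x)"
    by (intro V.square_integrable_product V.bounded_square_integrable W.primitive_bounded_borel F G)
  have iPV: "integrable (dW W) (\<lambda>y. F y * PV G y)"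
    by (intro W.square_integrable_product W.bounded_square_integrable V.primitive_bounded_borel F G)
  have "(\<integral>x. u x * G x \<partial>dV V) = (\<integral>x. c * G x + PW F x * G x \<partial>dV V)"
    using space_dV u(2) by (intro Bochner_Integration.integral_cong) (auto simp: distrib_right)
  also have "\<dots> = (\<integral>x. PW F x * G x \<partial>dV V)"
    using iPW V.square_integrable_integrable[OF G(1)] G(2) by simp
  also have "\<dots> = - (\<integral>y. F y * PV G y \<partial>dW W)"
    using integration_by_parts[OF F(1) G(1)] F(2) by simp
  also have "(\<integral>y. F y * PV G y \<partial>dW W) = (\<integral>y. d * F y + F y * PV G y \<partial>dW W)"
    using iPV W.square_integrable_integrable[OF F(1)] F(2) by simp
  also have "\<dots> = (\<integral>y. F y * g y \<partial>dW W)"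
    using space_dW g(2) by (intro Bochner_Integration.integral_cong) (auto simp: algebra_simps)
  finally show ?thesis .
qed

section \<open>Functions in the energetic domain\<close>

text \<open>
  Lateral derivatives of periodic functions are periodic and, having one-sided limits, bounded, so the two
  fundamental theorems apply.  Comparing the values at 0 and 1 shows that their means vanish.
\<close>

lemma D_space_structure:
  assumes u: "u \<in> D_space W V"
  defines "F \<equiv> left_deriv W u"
  defines "G \<equiv> right_deriv V F"
  shows "periodic u" "cadlag u" "bounded_borel u" "bounded_borel F" "bounded_borel G"
    and "(\<integral>y. F y \<partial>dW W) = 0" "(\<integral>x. G x \<partial>dV V) = 0"
    and "\<And>x. 0 \<le> x \<Longrightarrow> x \<le> 1 \<Longrightarrow> u x = u 0 + PW F x"
    and "\<And>x. 0 \<le> x \<Longrightarrow> x \<le> 1 \<Longrightarrow> F x = F 0 + PV G x"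
proof -
  have D: "periodic u" "cadlag u" "left_differentiable W u" "caglad F" "right_differentiable V F" "cadlag G"
    using u by (auto simp: D_space_def F_def G_def)
  have derF: "has_left_derivative W u (F x) x" for x
    unfolding F_def by (rule left_deriv_works[OF D(3)])
  have derG: "has_right_derivative V F (G x) x" for x
    unfolding G_def by (rule right_deriv_works[OF D(5)])
  have pF: "periodic F"
    unfolding periodic_def
  proof
    fix x
    show "F (x + 1) = F x"
      using derF[of "x + 1"] has_left_derivative_shift[OF D(1), of _ x 1] derF[of x]
      by (auto intro: has_left_derivative_unique)
  qed
  have pG: "periodic G"
    unfolding periodic_def
  proof
    fix x
    show "G (x + 1) = G x"
      using derG[of "x + 1"] has_right_derivative_shift[OF pF, of _ x 1] derG[of x]
      by (auto intro: has_right_derivative_unique)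
  qed
  show "periodic u" "cadlag u" by fact+
  show "bounded_borel u" by (rule cadlag_bounded_borel[OF D(1,2)])
  show bF: "bounded_borel F" by (rule caglad_bounded_borel[OF pF D(4)])
  show bG: "bounded_borel G" by (rule cadlag_bounded_borel[OF pG D(6)])
  show uF: "u x = u 0 + PW F x" if "0 \<le> x" "x \<le> 1" for x
    by (rule left_fundamental_theorem[OF D(2) bF D(4) derF that])
  show FG: "F x = F 0 + PV G x" if "0 \<le> x" "x \<le> 1" for x
    by (rule right_fundamental_theorem[OF D(4) bG D(6) derG that])
  show "(\<integral>y. F y \<partial>dW W) = 0"
    using uF[of 1] D(1)[unfolded periodic_def, rule_format, of 0]
      W.primitive_right_end[OF W.bounded_square_integrable[OF bF], of 1] by simp
  show "(\<integral>x. G x \<partial>dV V) = 0"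
    using FG[of 1] pF[unfolded periodic_def, rule_format, of 0]
      V.primitive_right_end[OF V.bounded_square_integrable[OF bG], of 1] by simp
qed

text \<open>
  Integration by parts turns \<open>- \<langle>D\<^sup>+\<^sub>V D\<^sup>-\<^sub>W u, u\<rangle>\<close> into the squared norm of \<open>D\<^sup>-\<^sub>W u\<close>, so that energetic
  Cauchy sequences are those whose members and left derivatives are both Cauchy in \<open>L\<^sup>2\<close>.
\<close>

lemma energetic_norm_eq:
  assumes u: "u \<in> D_space W V"
  shows "energetic_norm W V u = sqrt ((\<integral>x. (u x)\<^sup>2 \<partial>dV V) + (\<integral>y. (left_deriv W u y)\<^sup>2 \<partial>dW W))"
proof -
  define F where "F = left_deriv W u"
  define G where "G = right_deriv V F"
  note s = D_space_structure[OF u, folded F_def, folded G_def]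
  have "(\<integral>x. u x * G x \<partial>dV V) = - (\<integral>y. F y * F y \<partial>dW W)"
    by (rule primitives_pairing[OF _ s(6) _ s(7) s(3) s(8) s(4) s(9)])
      (auto intro: W.bounded_square_integrable V.bounded_square_integrable s)
  moreover have "(\<integral>x. (u x - G x) * u x \<partial>dV V) = (\<integral>x. (u x)\<^sup>2 \<partial>dV V) - (\<integral>x. u x * G x \<partial>dV V)"
  proof -
    have "(\<integral>x. (u x - G x) * u x \<partial>dV V) = (\<integral>x. (u x)\<^sup>2 - u x * G x \<partial>dV V)"
      by (simp add: power2_eq_square algebra_simps)
    also have "\<dots> = (\<integral>x. (u x)\<^sup>2 \<partial>dV V) - (\<integral>x. u x * G x \<partial>dV V)"
      using V.bounded_integrable[OF bounded_borel_mult[OF s(3,3)]] V.bounded_integrable[OF bounded_borel_mult[OF s(3,5)]]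
      by (simp add: power2_eq_square)
    finally show ?thesis .
  qed
  ultimately show ?thesis
    by (simp add: energetic_norm_def L2_inner_def F_def G_def power2_eq_square)
qed

lemma C_inf_structure:
  assumes g: "g \<in> C_inf V W"
  defines "G \<equiv> right_deriv V g"
  shows "bounded_borel g" "bounded_borel G" "(\<integral>x. G x \<partial>dV V) = 0"
    and "\<And>x. 0 \<le> x \<Longrightarrow> x \<le> 1 \<Longrightarrow> g x = g 0 + PV G x"
proof -
  obtain c k where k: "k \<in> C_inf_zero V W" and gk: "g = (\<lambda>x. c + k x)"
    using g by (auto simp: C_inf_def)
  have "k \<in> C1 W" "right_differentiable V k" "right_deriv V k \<in> C0 V"
    using k[unfolded C_inf_zero_def, simplified, rule_format, of 0]
      k[unfolded C_inf_zero_def, simplified, rule_format, of 1] by auto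
  then have k': "periodic k" "caglad k" "periodic (right_deriv V k)" "cadlag (right_deriv V k)"
    "(\<integral>x. right_deriv V k x \<partial>dV V) = 0" "\<And>x. has_right_derivative V k (right_deriv V k x) x"
    by (auto simp: C1_def C0_def intro: right_deriv_works)
  have "has_right_derivative V g (right_deriv V k x) x" for x
    unfolding gk has_right_derivative_shift_const by (rule k')
  then have G: "G = right_deriv V k"
    unfolding G_def by (intro ext right_deriv_eq)
  show bG: "bounded_borel G" unfolding G by (rule cadlag_bounded_borel[OF k'(3,4)])
  show "bounded_borel g"
    unfolding gk by (intro bounded_borel_add bounded_borel_const caglad_bounded_borel k')
  show "(\<integral>x. G x \<partial>dV V) = 0" unfolding G by (rule k')
  show "g x = g 0 + PV G x" if "0 \<le> x" "x \<le> 1" for x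
    using right_fundamental_theorem[OF k'(2) _ k'(4) k'(6) that] bG by (simp add: gk G)
qed

lemma D_space_weak_derivative:
  assumes u: "u \<in> D_space W V" and g: "g \<in> C_inf V W"
  shows "(\<integral>x. u x * right_deriv V g x \<partial>dV V) = - (\<integral>y. left_deriv W u y * g y \<partial>dW W)"
proof -
  note s = D_space_structure[OF u] and t = C_inf_structure[OF g]
  show ?thesis
    by (rule primitives_pairing[OF W.bounded_square_integrable[OF s(4)] s(6)
          V.bounded_square_integrable[OF t(2)] t(3) s(3) s(8) t(1) t(4)])
qed

section \<open>Equality of the two spaces\<close>

text \<open>
  The derivatives of the approximating sequence are Cauchy in \<open>L\<^sup>2\<^sub>W\<close>; the weak identity and the
  mean-zero condition pass to their limit, as both are pairings with fixed bounded functions.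
\<close>

lemma H_energetic_subset: "H_energetic W V \<subseteq> H_weak W V"
proof
  fix f assume "f \<in> H_energetic W V"
  then obtain u where f: "f \<in> L2 (dV V)" and u: "\<And>n. u n \<in> D_space W V"
    and lim: "(\<lambda>n. L2_norm (dV V) (\<lambda>x. u n x - f x)) \<longlonglongrightarrow> 0"
    and Cauchy: "\<And>e. e > 0 \<Longrightarrow> \<exists>N. \<forall>m\<ge>N. \<forall>n\<ge>N. energetic_norm W V (\<lambda>x. u m x - u n x) < e"
    by (auto simp: H_energetic_def)
  define F where "F n = left_deriv W (u n)" for n
  note s = D_space_structure[OF u]
  have F: "square_integrable (dW W) (F n)" for n
    unfolding F_def by (intro W.bounded_square_integrable s)
  have uV: "square_integrable (dV V) (u n)" for n
    by (intro V.bounded_square_integrable s)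
  have "\<exists>N. \<forall>m\<ge>N. \<forall>n\<ge>N. (\<integral>y. (F m y - F n y)\<^sup>2 \<partial>dW W) < e" if "e > 0" for e
  proof -
    obtain N where N: "\<And>m n. N \<le> m \<Longrightarrow> N \<le> n \<Longrightarrow> energetic_norm W V (\<lambda>x. u m x - u n x) < sqrt e"
      using Cauchy[of "sqrt e"] \<open>e > 0\<close> by auto
    have "(\<integral>y. (F m y - F n y)\<^sup>2 \<partial>dW W) < e" if "N \<le> m" "N \<le> n" for m n
    proof -
      have "(\<integral>x. (u m x - u n x)\<^sup>2 \<partial>dV V) + (\<integral>y. (F m y - F n y)\<^sup>2 \<partial>dW W) < e"
        using N[OF that] unfolding energetic_norm_eq[OF D_space_diff(1)[OF u u]] D_space_diff(2)[OF u u]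
        by (simp add: F_def)
      moreover have "0 \<le> (\<integral>x. (u m x - u n x)\<^sup>2 \<partial>dV V)" by simp
      ultimately show ?thesis by linarith
    qed
    then show ?thesis by blast
  qed
  then obtain F0 where F0: "square_integrable (dW W) F0"
    and F0_lim: "(\<lambda>n. \<integral>y. (F n y - F0 y)\<^sup>2 \<partial>dW W) \<longlonglongrightarrow> 0"
    using W.L2_complete[of F, OF F] by blast
  \<comment> \<open>The \<open>L\<^sup>2\<close> limit comes from values on a fundamental domain only; \<open>Fp\<close> is its periodic
    representative.\<close>
  define Fp where "Fp x = F0 (frac x)" for x
  have per: "periodic Fp" by (simp add: periodic_def Fp_def frac_1_eq)
  have Fp_borel: "Fp \<in> borel_measurable borel"
    unfolding Fp_def[abs_def] using F0
    by (intro measurable_compose[OF borel_measurable_frac]) (simp add: square_integrable_def)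
  have AE: "AE y in dW W. Fp y = F0 y"
    using W.AE_frac by eventually_elim (simp add: Fp_def)
  have pair: "(\<integral>y. Fp y * g y \<partial>dW W) = (\<integral>y. F0 y * g y \<partial>dW W)" if "g \<in> borel_measurable borel" for g
    using AE F0 Fp_borel that
    by (intro integral_cong_AE) (auto simp: square_integrable_def intro!: W.borel borel_measurable_times)
  have Fp: "square_integrable (dW W) Fp"
  proof -
    have "integrable (dW W) (\<lambda>y. (Fp y)\<^sup>2) \<longleftrightarrow> integrable (dW W) (\<lambda>y. (F0 y)\<^sup>2)"
      using AE F0 Fp_borel
      by (intro integrable_cong_AE) (auto simp: square_integrable_def intro!: W.borel)
    then show ?thesis using F0 Fp_borel by (simp add: square_integrable_def)
  qed
  have F_pair: "(\<lambda>n. \<integral>y. F n y * g y \<partial>dW W) \<longlonglongrightarrow> (\<integral>y. Fp y * g y \<partial>dW W)" if "bounded_borel g" for g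
    using W.L2_pairing_tendsto[OF F F0 W.bounded_square_integrable[OF that] F0_lim] pair[of g] that
    by (simp add: bounded_borel_def)
  have "(\<integral>x. f x * right_deriv V g x \<partial>dV V) = - (\<integral>y. Fp y * g y \<partial>dW W)" if g: "g \<in> C_inf V W" for g
  proof (rule LIMSEQ_unique)
    show "(\<lambda>n. \<integral>x. u n x * right_deriv V g x \<partial>dV V) \<longlonglongrightarrow> (\<integral>x. f x * right_deriv V g x \<partial>dV V)"
      using f lim C_inf_structure(2)[OF g]
      by (intro V.L2_pairing_tendsto uV)
        (auto simp: L2_iff L2_norm_tendsto_iff intro: V.bounded_square_integrable)
    show "(\<lambda>n. \<integral>x. u n x * right_deriv V g x \<partial>dV V) \<longlonglongrightarrow> - (\<integral>y. Fp y * g y \<partial>dW W)"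
      unfolding D_space_weak_derivative[OF u g]
      using tendsto_minus[OF F_pair[OF C_inf_structure(1)[OF g]]] by (simp add: F_def)
  qed
  moreover have "(\<integral>y. Fp y \<partial>dW W) = 0"
  proof (rule LIMSEQ_unique)
    show "(\<lambda>n. \<integral>y. F n y \<partial>dW W) \<longlonglongrightarrow> (\<integral>y. Fp y \<partial>dW W)"
      using F_pair[OF bounded_borel_const[of 1]] by simp
    show "(\<lambda>n. \<integral>y. F n y \<partial>dW W) \<longlonglongrightarrow> 0"
      using s(6) by (simp add: F_def)
  qed
  ultimately show "f \<in> H_weak W V"
    using f Fp per unfolding H_weak_def has_weak_derivative_def L2_mean_zero_def
    by (auto simp: L2_iff)
qed

text \<open>
  Subtracting from \<open>f\<close> the primitive of \<open>F\<close> leaves a function that annihilates \<open>D\<^sup>+\<^sub>V g\<close> for every test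
  function \<open>g\<close>.  These derivatives are dense among the mean-zero functions of \<open>L\<^sup>2\<^sub>V\<close>, so it is constant.
\<close>

lemma weak_derivative_imp_primitive:
  assumes f: "square_integrable (dV V) f" and F: "square_integrable (dW W) F" "(\<integral>y. F y \<partial>dW W) = 0"
    and weak: "\<And>g. g \<in> C_inf V W \<Longrightarrow> (\<integral>x. f x * right_deriv V g x \<partial>dV V) = - (\<integral>y. F y * g y \<partial>dW W)"
  obtains c where "AE x in dV V. f x = c + PW F x"
proof -
  have PF: "square_integrable (dV V) (PW F)"
    by (intro V.bounded_square_integrable W.primitive_bounded_borel F)
  define c where "c = (\<integral>x. f x - PW F x \<partial>dV V) / measure (dV V) (space (dV V))"
  \<comment> \<open>The constant \<open>c\<close> makes the mean of \<open>h\<close> zero.\<close>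
  define h where "h x = f x - PW F x - c" for x
  have h: "square_integrable (dV V) h"
    unfolding h_def[abs_def] by (intro V.square_integrable_diff f PF V.square_integrable_const)
  have h0: "(\<integral>x. h x \<partial>dV V) = 0"
    unfolding h_def c_def
    using V.square_integrable_integrable[OF f] V.square_integrable_integrable[OF PF] V.mass_pos by simp
  have "(\<integral>x. (h x)\<^sup>2 \<partial>dV V) < e" if "e > 0" for e
  proof -
    obtain X where X: "smooth_chain X" and lt: "(\<integral>x. (h x - X 1 x)\<^sup>2 \<partial>dV V) < e"
      using smooth_chain_dense_dV[OF h h0 \<open>e > 0\<close>] by blast
    have X1: "square_integrable (dV V) (X 1)" "(\<integral>x. X 1 x \<partial>dV V) = 0"
      using smooth_chain_side[OF X] by (auto intro: V.bounded_square_integrable)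
    have g: "X 0 \<in> C_inf V W"
      using smooth_chain_test_function[OF X] C_inf_zero_subset by blast
    have dg: "right_deriv V (X 0) = X 1"
      using smooth_chain_derivative(1)[OF X, of 0] by (intro ext right_deriv_eq) simp
    have "(\<integral>x. f x * X 1 x \<partial>dV V) = - (\<integral>y. F y * X 0 y \<partial>dW W)"
      using weak[OF g] by (simp add: dg)
    also have "\<dots> = (\<integral>x. PW F x * X 1 x \<partial>dV V)"
    proof (rule primitives_pairing[OF F X1, symmetric])
      show "bounded_borel (PW F)" by (rule W.primitive_bounded_borel[OF F(1)])
      show "PW F x = 0 + PW F x" for x by simp
      show "bounded_borel (X 0)" by (rule smooth_chain_bounded[OF X])
      show "X 0 x = X 0 0 + PV (X 1) x" if "0 \<le> x" "x \<le> 1" for x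
        using C_inf_structure(4)[OF g that] unfolding dg .
    qed
    finally have "(\<integral>x. h x * X 1 x \<partial>dV V) = 0"
      using V.square_integrable_product[OF f X1(1)] V.square_integrable_product[OF PF X1(1)]
        V.square_integrable_integrable[OF X1(1)] X1(2)
      by (simp add: h_def left_diff_distrib)
    moreover have "(\<integral>x. (h x - X 1 x)\<^sup>2 \<partial>dV V) =
        (\<integral>x. (h x)\<^sup>2 \<partial>dV V) - 2 * (\<integral>x. h x * X 1 x \<partial>dV V) + (\<integral>x. (X 1 x)\<^sup>2 \<partial>dV V)"
      using h X1(1) V.square_integrable_product[OF h X1(1)]
      by (simp add: power2_diff square_integrable_def mult.assoc)
    moreover have "0 \<le> (\<integral>x. (X 1 x)\<^sup>2 \<partial>dV V)" by simp
    ultimately show ?thesis using lt by linarith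
  qed
  then have "(\<integral>x. (h x)\<^sup>2 \<partial>dV V) \<le> 0"
    by (meson less_irrefl not_le)
  then have "(\<integral>x. (h x)\<^sup>2 \<partial>dV V) = 0"
    by (intro antisym) auto
  then have "AE x in dV V. (h x)\<^sup>2 = 0"
    using h by (subst (asm) integral_nonneg_eq_0_iff_AE) (auto simp: square_integrable_def)
  then have "AE x in dV V. f x = c + PW F x"
    by eventually_elim (simp add: h_def)
  then show ?thesis by (rule that)
qed

text \<open>
  With \<open>f = c + PW F\<close>, smooth approximations of \<open>F\<close> integrate to an energetic approximation of \<open>f\<close>,
  since \<open>PW\<close> is continuous from \<open>L\<^sup>2\<^sub>W\<close> to the sup norm.
\<close>

lemma H_weak_subset: "H_weak W V \<subseteq> H_energetic W V"
proof
  fix f assume "f \<in> H_weak W V"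
  then obtain F where f: "f \<in> L2 (dV V)"
    and F: "square_integrable (dW W) F" "(\<integral>y. F y \<partial>dW W) = 0"
    and weak: "\<And>g. g \<in> C_inf V W \<Longrightarrow> (\<integral>x. f x * right_deriv V g x \<partial>dV V) = - (\<integral>y. F y * g y \<partial>dW W)"
    by (auto simp: H_weak_def has_weak_derivative_def L2_mean_zero_def L2_iff)
  have f': "square_integrable (dV V) f" using f by (simp add: L2_iff)
  obtain c where fc: "AE x in dV V. f x = c + PW F x"
    using weak_derivative_imp_primitive[OF f' F weak] by blast
  have "\<exists>X. smooth_chain X \<and> (\<integral>y. (F y - X 0 y)\<^sup>2 \<partial>dW W) < inverse (real (Suc n))" for n
    using smooth_chain_dense_dW[OF F, of "inverse (real (Suc n))"] by (metis inverse_positive_iff_positive of_nat_0_less_iff zero_less_Suc)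
  then obtain X where X: "\<And>n. smooth_chain (X n)"
    and XF: "\<And>n. (\<integral>y. (F y - X n 0 y)\<^sup>2 \<partial>dW W) < inverse (real (Suc n))"
    by metis
  define H where "H n = X n 0" for n
  have H: "bounded_borel (H n)" "periodic (H n)" "caglad (H n)" "(\<integral>y. H n y \<partial>dW W) = 0" for n
    using smooth_chain_side[OF X[of n], of 0] smooth_chain_regular[OF X[of n], of 0] by (auto simp: H_def)
  have Hsq: "square_integrable (dW W) (H n)" for n by (intro W.bounded_square_integrable H)
  have H_der: "has_right_derivative V (H n) (X n 1 x) x" for n x
    using smooth_chain_derivative(1)[OF X[of n], of 0] by (simp add: H_def)
  \<comment> \<open>The second summand undoes the mean-zero normalisation, so that \<open>u n = c + PW (H n)\<close> on a period.\<close>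
  define d where "d n = c + (\<integral>t. PW (H n) t \<partial>dV V) / measure (dV V) (space (dV V))" for n
  define u where "u n x = d n + WV.T (H n) x" for n x
  have u_unit: "u n x = c + PW (H n) x" if "0 \<le> x" "x \<le> 1" for n x
    using WV.T_on_unit[OF Hsq H(4) that] by (simp add: u_def d_def)
  have u_der: "has_left_derivative W (u n) (H n x) x" for n x
    unfolding u_def[abs_def] has_left_derivative_shift_const by (intro has_left_derivative_T H)
  have left_u: "left_deriv W (u n) = H n" for n
    by (intro ext left_deriv_eq u_der)
  have right_H: "right_deriv V (H n) = X n 1" for n
    by (intro ext right_deriv_eq H_der)
  have uD: "u n \<in> D_space W V" for n
  proof -
    have "periodic (u n)"
      using WV.T_periodic[of "H n"] by (simp add: periodic_def u_def)
    moreover have "cadlag (u n)"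
    proof -
      have "cadlag (\<lambda>x. - d n)"
        unfolding cadlag_def continuous_within by (blast intro: tendsto_const)
      from cadlag_diff[OF WV.T_cadlag[OF Hsq[of n] H(4) refl] this] show ?thesis
        by (simp add: u_def[abs_def] add.commute)
    qed
    moreover have "cadlag (X n 1)"
      using smooth_chain_regular(2)[OF X[of n], of 1] by simp
    moreover have "left_differentiable W (u n)"
      unfolding left_differentiable_def using u_der by blast
    moreover have "right_differentiable V (H n)"
      unfolding right_differentiable_def using H_der by blast
    ultimately show ?thesis
      using H(3) by (simp add: D_space_def left_u right_H)
  qed
  have u_sq: "square_integrable (dV V) (u n)" for n
    by (intro V.bounded_square_integrable D_space_structure(3)[OF uD])
  define m where "m = measure (dV V) (space (dV V)) * measure (dW W) (space (dW W))"
  define a where "a n = (\<integral>y. (H n y - F y)\<^sup>2 \<partial>dW W)" for n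
  have a_lim: "a \<longlonglongrightarrow> 0"
  proof (rule tendsto_sandwich[OF _ _ tendsto_const LIMSEQ_inverse_real_of_nat])
    show "eventually (\<lambda>n. a n \<le> inverse (real (Suc n))) sequentially"
      using XF by (auto simp: a_def H_def power2_commute intro!: always_eventually less_imp_le)
  qed (simp add: a_def)
  have b_le: "(\<integral>x. (u n x - f x)\<^sup>2 \<partial>dV V) \<le> m * a n" for n
  proof -
    have dif: "square_integrable (dW W) (\<lambda>y. H n y - F y)"
      by (intro W.square_integrable_diff Hsq F)
    have "(\<integral>x. (u n x - f x)\<^sup>2 \<partial>dV V) \<le> (\<integral>x. (\<integral>y. \<bar>H n y - F y\<bar> \<partial>dW W)\<^sup>2 \<partial>dV V)"
    proof (rule integral_mono_AE)
      show "integrable (dV V) (\<lambda>x. (u n x - f x)\<^sup>2)"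
        using V.square_integrable_diff[OF u_sq f'] by (simp add: square_integrable_def)
      show "AE x in dV V. (u n x - f x)\<^sup>2 \<le> (\<integral>y. \<bar>H n y - F y\<bar> \<partial>dW W)\<^sup>2"
        using fc V.interior
      proof eventually_elim
        case (elim x)
        then have "u n x - f x = PW (\<lambda>y. H n y - F y) x"
          using W.primitive_diff[OF Hsq F(1)] by (simp add: u_unit)
        then show ?case
          using W.primitive_bound[OF dif, of x] by (metis abs_ge_zero power2_abs power_mono)
      qed
    qed simp
    also have "\<dots> = measure (dV V) (space (dV V)) * (\<integral>y. \<bar>H n y - F y\<bar> \<partial>dW W)\<^sup>2"
      by simp
    also have "\<dots> \<le> measure (dV V) (space (dV V)) * (measure (dW W) (space (dW W)) * a n)"
      unfolding a_def by (intro mult_left_mono W.L1_le_L2 dif) simp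
    finally show ?thesis by (simp add: m_def mult.assoc)
  qed
  have b_lim: "(\<lambda>n. \<integral>x. (u n x - f x)\<^sup>2 \<partial>dV V) \<longlonglongrightarrow> 0"
  proof (rule tendsto_sandwich[OF _ _ tendsto_const])
    show "(\<lambda>n. m * a n) \<longlonglongrightarrow> 0" using tendsto_mult_left[OF a_lim, of m] by simp
  qed (use b_le in \<open>auto intro!: always_eventually\<close>)
  have "\<exists>N. \<forall>i\<ge>N. \<forall>j\<ge>N. energetic_norm W V (\<lambda>x. u i x - u j x) < e" if "e > 0" for e
  proof -
    define s where "s n = (\<integral>x. (u n x - f x)\<^sup>2 \<partial>dV V) + a n" for n
    have "s \<longlonglongrightarrow> 0" unfolding s_def using tendsto_add[OF b_lim a_lim] by simp
    then have "eventually (\<lambda>n. s n < e\<^sup>2 / 4) sequentially"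
      using \<open>e > 0\<close> by (intro order_tendstoD(2)) auto
    then obtain N where N: "\<And>n. N \<le> n \<Longrightarrow> s n < e\<^sup>2 / 4"
      by (auto simp: eventually_sequentially)
    have "energetic_norm W V (\<lambda>x. u i x - u j x) < e" if "N \<le> i" "N \<le> j" for i j
    proof -
      have "(\<integral>x. (u i x - u j x)\<^sup>2 \<partial>dV V) \<le>
          2 * (\<integral>x. (u i x - f x)\<^sup>2 \<partial>dV V) + 2 * (\<integral>x. (f x - u j x)\<^sup>2 \<partial>dV V)"
        by (intro V.L2_dist_triangle u_sq f')
      moreover have "(\<integral>y. (H i y - H j y)\<^sup>2 \<partial>dW W) \<le> 2 * a i + 2 * (\<integral>y. (F y - H j y)\<^sup>2 \<partial>dW W)"
        unfolding a_def by (intro W.L2_dist_triangle Hsq F)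
      ultimately have "(\<integral>x. (u i x - u j x)\<^sup>2 \<partial>dV V) + (\<integral>y. (H i y - H j y)\<^sup>2 \<partial>dW W) \<le> 2 * s i + 2 * s j"
        by (simp add: s_def a_def power2_commute)
      also have "\<dots> < e\<^sup>2" using N[OF that(1)] N[OF that(2)] by simp
      finally have "sqrt ((\<integral>x. (u i x - u j x)\<^sup>2 \<partial>dV V) + (\<integral>y. (H i y - H j y)\<^sup>2 \<partial>dW W)) < e"
        using \<open>e > 0\<close> by (intro real_less_lsqrt) auto
      then show ?thesis
        unfolding energetic_norm_eq[OF D_space_diff(1)[OF uD uD]] D_space_diff(2)[OF uD uD] left_u .
    qed
    then show ?thesis by blast
  qed
  then show "f \<in> H_energetic W V"
    using f uD b_lim unfolding H_energetic_def by (auto simp: L2_norm_tendsto_iff intro!: exI[of _ u])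
qed

end

theorem theorem8:
  fixes W V :: "real \<Rightarrow> real"
  assumes "strict_mono W" and "strict_mono V"
    and "cadlag W" and "caglad V"
    and "\<And>x. W (x + 1) - W x = W 1 - W 0"
    and "\<And>x. V (x + 1) - V x = V 1 - V 0"
    and "isCont W 0" and "isCont V 0"
    and "W 0 = 0" and "V 0 = 0"
  shows "H_weak W V = H_energetic W V"
proof -
  interpret circle_weights W V
    using assms by unfold_locales
  show ?thesis
    using H_weak_subset H_energetic_subset by blast
qed

end
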